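(* Let the pair $\{E,F\}$ (equivalently, the DAE $E(t)x'(t)+F(t)x(t)=q(t)$) be regular on $\mathcal I$ with index $\mu$ and characteristic values $r,\theta_0\ge\dots\ge\theta_{\mu-2}>\theta_{\mu-1}=0$. Then: (1) for every $t\in\mathcal I$ the flow-subspace $S_{can}(t)$ has dimension $d=r-\sum_{i=0}^{\mu-2}\theta_i=r_{\mu-1}$, and the matrix function $C=C_0C_1\cdots C_{\mu-2}:\mathcal I\to\mathbb R^{m\times d}$ generated by the reduction procedure has columns forming a basis of $S_{can}(t)$ for every $t\in\mathcal I$; (2) for every subinterval $\mathcal I_{sub}\subset\mathcal I$, the restriction of the pair to $\mathcal I_{sub}$ is regular with the same index $\mu$ and the same characteristic values.
   Context: Let $\mathcal I\subseteq\mathbb R$ be an interval and $E,F:\mathcal I\to\mathbb R^{m\times m}$ sufficiently smooth (of class $C^m$). For a pair $\{E,F\}$ put $S(t)=\{z\in\mathbb R^m: F(t)z\in\operatorname{im}E(t)\}$. The pair is called pre-regular on $\mathcal I$ if $\operatorname{im}[E(t)\ F(t)]=\mathbb R^m$, $\operatorname{rank}E(t)=r$ and $\dim(S(t)\cap\ker E(t))=\theta$ for all $t\in\mathcal I$, with constant integers $r,\theta$. Reduction procedure: $E_0=E$, $F_0=F$, $m_0=m$. Given a pre-regular pair $\{E_i,F_i\}$ of size $m_i\times m_i$ with $\operatorname{rank}E_i=r_i$, choose smooth matrix functions $Y_i$ ($m_i\times r_i$) and $Z_i$ ($m_i\times(m_i-r_i)$) whose columns form bases of $\operatorname{im}E_i(t)$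 and $(\operatorname{im}E_i(t))^\perp$, and a smooth $C_i$ ($m_i\times r_i$) whose columns form a basis of $S_i(t)=\ker Z_i(t)^*F_i(t)$; set $E_{i+1}=Y_i^*E_iC_i$, $F_{i+1}=Y_i^*(F_iC_i+E_iC_i')$ (size $r_i\times r_i$), and $\theta_i=\dim(\ker E_i\cap S_i)$; then $r_{i+1}=r_i-\theta_i$. The pair $\{E,F\}$ with $r=\operatorname{rank}E<m$ is called regular with index $\mu\in\mathbb N$ if the procedure is well defined up to level $\mu-1$, each pair $\{E_i,F_i\}$, $i=0,\dots,\mu-1$, is pre-regular, and the constants satisfy $\theta_0\ge\dots\ge\theta_{\mu-2}>\theta_{\mu-1}=0$ (for $\mu=1$: $\theta_0=0$). The values $r,\theta_0,\dots,\theta_{\mu-2}$ are the characteristic values; they do not depend on the choice of bases. The flow-subspace is $S_{can}(\bar t)=\{x(\bar t): x$ is a solution of $Ex'+Fx=0$ on $(\bar t-\delta,\bar t+\delta)\cap\mathcal I$ for some $\delta>0\}$.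
   Formalization: The product C_0⋯C_{μ-2} (which has r_{μ-2} > d columns, or is the m×m identity if μ=1) is corrected to C_0⋯C_{μ-1}, for every choice of smooth bases at levels 0,…,μ-1; intervals contain more than one point. *)

theory Defs
  imports "HOL-Analysis.Analysis" "Jordan_Normal_Form.DL_Rank" "Jordan_Normal_Form.Matrix_Kernel"
begin

definition real_interval :: "real set \<Rightarrow> bool" where
  "real_interval I \<longleftrightarrow> is_interval I \<and> (\<exists>a b. a < b \<and> a \<in> I \<and> b \<in> I)"

fun Ck_on :: "nat \<Rightarrow> real set \<Rightarrow> (real \<Rightarrow> real) \<Rightarrow> bool" where
  "Ck_on 0 I f = continuous_on I f"
| "Ck_on (Suc k) I f =
     (\<exists>f'. (\<forall>t\<in>I. (f has_real_derivative f' t) (at t within I)) \<and> Ck_on k I f')"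

definition mat_Ck :: "nat \<Rightarrow> real set \<Rightarrow> nat \<Rightarrow> nat \<Rightarrow> (real \<Rightarrow> real mat) \<Rightarrow> bool" where
  "mat_Ck k I nr nc A \<longleftrightarrow>
     (\<forall>t\<in>I. A t \<in> carrier_mat nr nc) \<and>
     (\<forall>i j. i < nr \<longrightarrow> j < nc \<longrightarrow> Ck_on k I (\<lambda>t. A t $$ (i, j)))"

definition has_mat_deriv_on :: "real set \<Rightarrow> nat \<Rightarrow> nat \<Rightarrow> (real \<Rightarrow> real mat) \<Rightarrow> (real \<Rightarrow> real mat) \<Rightarrow> bool" where
  "has_mat_deriv_on I nr nc A A' \<longleftrightarrow>
     (\<forall>t\<in>I. A' t \<in> carrier_mat nr nc \<and>
        (\<forall>i j. i < nr \<longrightarrow> j < nc \<longrightarrow>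
           ((\<lambda>s. A s $$ (i, j)) has_real_derivative (A' t $$ (i, j))) (at t within I)))"

definition mat_image :: "real mat \<Rightarrow> real vec set" where
  "mat_image A = {A *\<^sub>v v | v. v \<in> carrier_vec (dim_col A)}"

definition orth_compl :: "nat \<Rightarrow> real vec set \<Rightarrow> real vec set" where
  "orth_compl n W = {z \<in> carrier_vec n. \<forall>y\<in>W. z \<bullet> y = 0}"

definition subspace_dim :: "nat \<Rightarrow> real vec set \<Rightarrow> nat" where
  "subspace_dim n W = vectorspace.dim class_ring ((module_vec TYPE(real) n)\<lparr>carrier := W\<rparr>)"

definition cols_basis :: "nat \<Rightarrow> real mat \<Rightarrow> real vec set \<Rightarrow> bool" where
  "cols_basis n A W \<longleftrightarrow>
     dim_row A = n \<and> set (cols A) \<subseteq> W \<and>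
     (\<forall>w\<in>W. \<exists>v\<in>carrier_vec (dim_col A). w = A *\<^sub>v v) \<and>
     (\<forall>v\<in>carrier_vec (dim_col A). A *\<^sub>v v = 0\<^sub>v n \<longrightarrow> v = 0\<^sub>v (dim_col A))"

definition S_space :: "real mat \<Rightarrow> real mat \<Rightarrow> real vec set" where
  "S_space E F = {z \<in> carrier_vec (dim_col F). F *\<^sub>v z \<in> mat_image E}"

definition pre_regular :: "real set \<Rightarrow> nat \<Rightarrow> (real \<Rightarrow> real mat) \<Rightarrow> (real \<Rightarrow> real mat) \<Rightarrow> nat \<Rightarrow> nat \<Rightarrow> bool" where
  "pre_regular I m E F r \<theta> \<longleftrightarrow>
     (\<forall>t\<in>I. E t \<in> carrier_mat m m \<and> F t \<in> carrier_mat m m \<and>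
        (\<forall>z\<in>carrier_vec m. \<exists>u\<in>carrier_vec m. \<exists>v\<in>carrier_vec m. z = E t *\<^sub>v u + F t *\<^sub>v v) \<and>
        vec_space.rank m (E t) = r \<and>
        subspace_dim m (S_space (E t) (F t) \<inter> mat_kernel (E t)) = \<theta>)"

text \<open>A run of the reduction procedure on I starting from the m x m pair (E,F), in which bases
  Ys i, Zs i, Cs i have been chosen at the levels i < n, and the pairs (Es i, Fs i) of size ms i
  are defined for i \<le> n. Cds i is the derivative of Cs i. At level i the basis functions are
  required to be of class C^(m-i) (the smoothness of the level-i pair when E, F are C^m).\<close>
definition reduction_run ::
  "real set \<Rightarrow> nat \<Rightarrow> (real \<Rightarrow> real mat) \<Rightarrow> (real \<Rightarrow> real mat) \<Rightarrow> nat \<Rightarrow>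
   (nat \<Rightarrow> real \<Rightarrow> real mat) \<Rightarrow> (nat \<Rightarrow> real \<Rightarrow> real mat) \<Rightarrow>
   (nat \<Rightarrow> real \<Rightarrow> real mat) \<Rightarrow> (nat \<Rightarrow> real \<Rightarrow> real mat) \<Rightarrow>
   (nat \<Rightarrow> real \<Rightarrow> real mat) \<Rightarrow> (nat \<Rightarrow> real \<Rightarrow> real mat) \<Rightarrow> (nat \<Rightarrow> nat) \<Rightarrow> bool" where
  "reduction_run I m E F n Es Fs Ys Zs Cs Cds ms \<longleftrightarrow>
     ms 0 = m \<and> Es 0 = E \<and> Fs 0 = F \<and>
     (\<forall>i<n.
        mat_Ck (m - i) I (ms i) (ms (Suc i)) (Ys i) \<and>
        mat_Ck (m - i) I (ms i) (ms i - ms (Suc i)) (Zs i) \<and>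
        mat_Ck (m - i) I (ms i) (ms (Suc i)) (Cs i) \<and>
        has_mat_deriv_on I (ms i) (ms (Suc i)) (Cs i) (Cds i) \<and>
        (\<forall>t\<in>I.
           cols_basis (ms i) (Ys i t) (mat_image (Es i t)) \<and>
           cols_basis (ms i) (Zs i t) (orth_compl (ms i) (mat_image (Es i t))) \<and>
           cols_basis (ms i) (Cs i t) (mat_kernel (transpose_mat (Zs i t) * Fs i t)) \<and>
           Es (Suc i) t = transpose_mat (Ys i t) * Es i t * Cs i t \<and>
           Fs (Suc i) t = transpose_mat (Ys i t) * (Fs i t * Cs i t + Es i t * Cds i t)))"

definition regular_index ::
  "real set \<Rightarrow> nat \<Rightarrow> (real \<Rightarrow> real mat) \<Rightarrow> (real \<Rightarrow> real mat) \<Rightarrow> nat \<Rightarrow> nat \<Rightarrow> (nat \<Rightarrow> nat) \<Rightarrow> bool" where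
  "regular_index I m E F \<mu> r \<theta> \<longleftrightarrow>
     1 \<le> \<mu> \<and> r < m \<and>
     (\<exists>Es Fs Ys Zs Cs Cds ms rs.
        reduction_run I m E F (\<mu> - 1) Es Fs Ys Zs Cs Cds ms \<and>
        (\<forall>i<\<mu>. pre_regular I (ms i) (Es i) (Fs i) (rs i) (\<theta> i)) \<and>
        rs 0 = r) \<and>
     (\<forall>i. Suc i \<le> \<mu> - 2 \<longrightarrow> \<theta> (Suc i) \<le> \<theta> i) \<and>
     (2 \<le> \<mu> \<longrightarrow> \<theta> (\<mu> - 2) > 0) \<and>
     \<theta> (\<mu> - 1) = 0"

definition dae_solution_on :: "real set \<Rightarrow> nat \<Rightarrow> (real \<Rightarrow> real mat) \<Rightarrow> (real \<Rightarrow> real mat) \<Rightarrow> (real \<Rightarrow> real vec) \<Rightarrow> bool" where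
  "dae_solution_on J m E F x \<longleftrightarrow>
     (\<forall>t\<in>J. x t \<in> carrier_vec m) \<and>
     (\<exists>x'. (\<forall>t\<in>J. x' t \<in> carrier_vec m) \<and>
        (\<forall>k<m. \<forall>t\<in>J. ((\<lambda>s. x s $ k) has_real_derivative (x' t $ k)) (at t within J)) \<and>
        (\<forall>k<m. continuous_on J (\<lambda>t. x' t $ k)) \<and>
        (\<forall>t\<in>J. E t *\<^sub>v x' t + F t *\<^sub>v x t = 0\<^sub>v m))"

definition flow_subspace :: "real set \<Rightarrow> nat \<Rightarrow> (real \<Rightarrow> real mat) \<Rightarrow> (real \<Rightarrow> real mat) \<Rightarrow> real \<Rightarrow> real vec set" where
  "flow_subspace I m E F tb =
     {x tb | x. \<exists>\<delta>>0. dae_solution_on ({tb - \<delta> <..< tb + \<delta>} \<inter> I) m E F x}"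

fun chain_prod :: "nat \<Rightarrow> (nat \<Rightarrow> real \<Rightarrow> real mat) \<Rightarrow> nat \<Rightarrow> real \<Rightarrow> real mat" where
  "chain_prod m Cs 0 t = 1\<^sub>m m"
| "chain_prod m Cs (Suc n) t = chain_prod m Cs n t * Cs n t"

end

theory Submission
  imports Defs
begin

text \<open>A curve \<open>x\<close> solves the pair \<open>{E\<^sub>i, F\<^sub>i}\<close> iff \<open>x = C\<^sub>i y\<close> for a solution \<open>y\<close> of \<open>{E\<^sub>i\<^sub>+\<^sub>1, F\<^sub>i\<^sub>+\<^sub>1}\<close>:
  solutions stay in \<open>S\<^sub>i = im C\<^sub>i\<close>, and \<open>Y\<^sub>i\<^sup>T\<close> is injective on \<open>im E\<^sub>i\<close>, where the residual lives. Since
  \<open>\<theta>\<^sub>\<mu>\<^sub>-\<^sub>1 = 0\<close>, the matrix \<open>E\<^sub>\<mu>\<close> is nonsingular, so every initial value of the last pair is attained by a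
  linear ODE and the flow-subspace is the image of \<open>C\<^sub>0 \<cdots> C\<^sub>\<mu>\<^sub>-\<^sub>1\<close>. Two runs of the reduction are
  related level by level by \<open>E' = L E K\<close>, \<open>F' = L (F K + E K')\<close> with invertible \<open>L, K\<close>, which makes the
  characteristic values independent of the chosen bases. A run of length \<open>\<mu>\<close> need not be given globally,
  but near each point smooth bases of the last level exist, and the flow-subspace is a local object.
  The smoothness suffices since the ranks strictly decrease, whence \<open>\<mu> \<le> m\<close>.\<close>

text \<open>Regularity supplies bases only below level \<open>\<mu> - 1\<close>, where E is still
  singular: its rank d is smaller than its size. One further step is needed to reach a nonsingular
  pair, so every statement about the flow uses a run of length \<mu>, while the given characteristic
  values belong to a shorter run with possibly different bases. Each step costs one derivative,
  since the next F contains the derivative of C. Level i therefore has class C^(m-i), and comparing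
  solutions across a step requires i < m; this is where the strict decrease of the ranks enters. The
  sizes of the reduced pairs are values, not types, and everything must depend smoothly on t. Hence
  full column rank is handled through the Gram determinant of A: its nonvanishing is an open
  condition in t, and the inverse Gram matrix gives a left inverse and an orthogonal projector by
  explicit formulas that keep the smoothness of A. Derivatives are taken within the interval,
  one-sided at an endpoint. They are unique because intervals have two points, and this uniqueness
  is what allows the derivative of a solution x to be compared with the product rule for C
  y.\<close>

section \<open>Matrices of full column rank\<close>

definition full_col :: "nat \<Rightarrow> nat \<Rightarrow> real mat \<Rightarrow> bool" where
  "full_col n k A \<longleftrightarrow> A \<in> carrier_mat n k \<and>
     (\<forall>v\<in>carrier_vec k. A *\<^sub>v v = 0\<^sub>v n \<longrightarrow> v = 0\<^sub>v k)"

definition is_subspace :: "nat \<Rightarrow> real vec set \<Rightarrow> bool" where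
  "is_subspace n W \<longleftrightarrow> W \<subseteq> carrier_vec n \<and> 0\<^sub>v n \<in> W \<and>
     (\<forall>v\<in>W. \<forall>w\<in>W. v + w \<in> W) \<and> (\<forall>c. \<forall>v\<in>W. c \<cdot>\<^sub>v v \<in> W)"

lemma full_colD:
  assumes "full_col n k A"
  shows "A \<in> carrier_mat n k" "v \<in> carrier_vec k \<Longrightarrow> A *\<^sub>v v = 0\<^sub>v n \<Longrightarrow> v = 0\<^sub>v k"
  using assms by (auto simp: full_col_def)

lemma mat_image_eq:
  "A \<in> carrier_mat n k \<Longrightarrow> mat_image A = (\<lambda>v. A *\<^sub>v v) ` carrier_vec k"
  by (auto simp: mat_image_def)

lemma mult_mat_vec_zero [simp]: "A \<in> carrier_mat n k \<Longrightarrow> A *\<^sub>v 0\<^sub>v k = (0\<^sub>v n :: real vec)"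
  by (intro eq_vecI) auto

lemma is_subspace_mat_image:
  assumes A: "A \<in> carrier_mat n k"
  shows "is_subspace n (mat_image A)"
  unfolding is_subspace_def mat_image_eq[OF A]
proof (intro conjI ballI allI)
  show "0\<^sub>v n \<in> (\<lambda>v. A *\<^sub>v v) ` carrier_vec k"
    using A by (intro image_eqI[of _ _ "0\<^sub>v k"]) auto
next
  fix v w assume "v \<in> (\<lambda>v. A *\<^sub>v v) ` carrier_vec k" "w \<in> (\<lambda>v. A *\<^sub>v v) ` carrier_vec k"
  then obtain a b where ab: "a \<in> carrier_vec k" "b \<in> carrier_vec k" "v = A *\<^sub>v a" "w = A *\<^sub>v b" by auto
  then show "v + w \<in> (\<lambda>v. A *\<^sub>v v) ` carrier_vec k"
    using A by (intro image_eqI[of _ _ "a + b"]) (auto simp: mult_add_distrib_mat_vec)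
next
  fix c v assume "v \<in> (\<lambda>v. A *\<^sub>v v) ` carrier_vec k"
  then obtain a where ab: "a \<in> carrier_vec k" "v = A *\<^sub>v a" by auto
  then show "c \<cdot>\<^sub>v v \<in> (\<lambda>v. A *\<^sub>v v) ` carrier_vec k"
    using A by (intro image_eqI[of _ _ "c \<cdot>\<^sub>v a"]) (auto simp: mult_mat_vec)
qed (use A in auto)

section \<open>Dimension, image and rank\<close>

lemma rank_nullity_mat:
  assumes A: "A \<in> carrier_mat n k"
  shows "subspace_dim n (mat_image A) + subspace_dim k (mat_kernel A) = k"
proof -
  interpret V: vec_space "TYPE(real)" k .
  interpret W: vec_space "TYPE(real)" n .
  interpret L: linear_map "class_ring" "module_vec TYPE(real) k" "module_vec TYPE(real) n" "\<lambda>v. A *\<^sub>v v"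
    by unfold_locales (use A in \<open>auto simp: module_hom_def module_vec_simps class_ring_simps
        mult_add_distrib_mat_vec mult_mat_vec\<close>)
  have "L.imT = mat_image A" "L.kerT = mat_kernel A"
    using A by (auto simp: L.im_def L.ker_def mat_image_def mat_kernel_def module_vec_simps)
  with L.rank_nullity show ?thesis
    by (simp add: subspace_dim_def V.dim_is_n)
qed

lemma subspace_dim_zero: "subspace_dim n {0\<^sub>v n} = 0"
proof -
  interpret V: vec_space "TYPE(real)" n .
  have "V.span {} = {0\<^sub>v n}"
    by (simp add: V.span_empty module_vec_simps)
  then show ?thesis using V.dim_zero_vs by (simp add: subspace_dim_def)
qed

lemma subspace_dim_full_col:
  assumes "full_col n k A"
  shows "subspace_dim n (mat_image A) = k"
proof -
  have "mat_kernel A = {0\<^sub>v k}"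
    using assms by (auto simp: full_col_def mat_kernel_def)
  then show ?thesis
    using rank_nullity_mat[of A n k] assms subspace_dim_zero by (simp add: full_col_def)
qed

lemma mat_image_span_cols:
  assumes A: "A \<in> carrier_mat n k"
  shows "mat_image A = LinearCombinations.module.span class_ring (module_vec TYPE(real) n) (set (cols A))"
proof -
  interpret V: vec_space "TYPE(real)" n .
  have "mat_image A = V.col_space A"
    using A unfolding V.col_space_eq[OF A] by (auto simp: mat_image_def)
  then show ?thesis by (simp add: V.col_space_def)
qed

lemma rank_eq_subspace_dim:
  assumes A: "A \<in> carrier_mat n k"
  shows "vec_space.rank n A = subspace_dim n (mat_image A)"
  by (simp add: subspace_dim_def vec_space.rank_def mat_image_span_cols[OF A])


lemma mult_mat_unit_vec:
  assumes A: "A \<in> carrier_mat n k" and j: "j < k"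
  shows "A *\<^sub>v unit_vec k j = (col A j :: real vec)"
  using A j by (intro eq_vecI) (auto simp: scalar_prod_right_unit)

lemma mat_eq_by_mult_vec:
  assumes A: "A \<in> carrier_mat n k" and B: "B \<in> carrier_mat n k"
    and eq: "\<And>v. v \<in> carrier_vec k \<Longrightarrow> A *\<^sub>v v = B *\<^sub>v v"
  shows "A = (B :: real mat)"
proof (rule mat_col_eqI)
  fix j assume j: "j < dim_col B"
  have "A *\<^sub>v unit_vec k j = col A j" "B *\<^sub>v unit_vec k j = col B j"
    using A B j by (auto intro!: mult_mat_unit_vec)
  then show "col A j = col B j" using eq[of "unit_vec k j"] by simp
qed (use A B in auto)

lemma scalar_prod_self_eq_0:
  assumes v: "v \<in> carrier_vec n" and z: "scalar_prod v v = (0::real)"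
  shows "v = 0\<^sub>v n"
proof -
  have "(\<Sum>i<n. (v $ i)\<^sup>2) = 0"
    using z v by (simp add: scalar_prod_def power2_eq_square atLeast0LessThan)
  then have "\<forall>i<n. v $ i = 0"
    by (subst (asm) sum_nonneg_eq_0_iff) auto
  then show ?thesis using v by (intro eq_vecI) auto
qed

lemma full_col_le:
  assumes A: "full_col n k A"
  shows "k \<le> n"
proof -
  interpret V: vec_space "TYPE(real)" n .
  have c: "A \<in> carrier_mat n k" using A by (rule full_colD)
  have sub: "set (cols A) \<subseteq> carrier_vec n" using c cols_dim by blast
  have "V.dim \<ge> vectorspace.dim class_ring (V.vs (V.span (set (cols A))))"
    by (rule V.subspace_dim) (use sub V.fin_dim_span_cols[OF c] V.span_is_subspace in auto)
  then show ?thesis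
    using subspace_dim_full_col[OF A] by (simp add: subspace_dim_def mat_image_span_cols[OF c] V.dim_is_n)
qed

section \<open>Inverse and left inverse by explicit formulas\<close>

lemma full_col_square_iff:
  assumes "A \<in> carrier_mat n n"
  shows "full_col n n A \<longleftrightarrow> Determinant.det A \<noteq> 0"
  using det_0_iff_vec_prod_zero[OF assms] assms by (auto simp: full_col_def)

text \<open>The adjugate formula: the entries are cofactors divided by the determinant, hence as
  smooth in t as the entries of \<open>A\<close>.\<close>

definition minv :: "real mat \<Rightarrow> real mat" where
  "minv A = (1 / Determinant.det A) \<cdot>\<^sub>m adj_mat A"

lemma minv:
  assumes A: "A \<in> carrier_mat n n" and d: "Determinant.det A \<noteq> 0"
  shows "minv A \<in> carrier_mat n n" "A * minv A = 1\<^sub>m n" "minv A * A = 1\<^sub>m n"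
proof -
  note adj = adj_mat[OF A]
  show "minv A \<in> carrier_mat n n" using adj(1) by (simp add: minv_def)
  show "A * minv A = 1\<^sub>m n" "minv A * A = 1\<^sub>m n"
    unfolding minv_def mult_smult_distrib[OF A adj(1)] mult_smult_assoc_mat[OF adj(1) A] adj(2,3)
    using d by (auto intro!: eq_matI)
qed

lemma minv_mult_vec:
  assumes "A \<in> carrier_mat n n" "Determinant.det A \<noteq> 0" "v \<in> carrier_vec n"
  shows "A *\<^sub>v (minv A *\<^sub>v v) = v" "minv A *\<^sub>v (A *\<^sub>v v) = v" "minv A *\<^sub>v v \<in> carrier_vec n"
proof -
  note m = minv[OF assms(1,2)]
  show "A *\<^sub>v (minv A *\<^sub>v v) = v"
    using assoc_mult_mat_vec[OF assms(1) m(1) assms(3)] m(2) assms(3) by simp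
  show "minv A *\<^sub>v (A *\<^sub>v v) = v"
    using assoc_mult_mat_vec[OF m(1) assms(1,3)] m(3) assms(3) by simp
  show "minv A *\<^sub>v v \<in> carrier_vec n" using m(1) assms(3) by auto
qed

text \<open>Since v . (A^T A v) = |A v|^2, the matrices A^T A and A have the same kernel. Full
  column rank becomes the nonvanishing of a single scalar function of the entries.\<close>

lemma gram_det_nonzero_iff:
  assumes A: "A \<in> carrier_mat n k"
  shows "Determinant.det (transpose_mat A * A) \<noteq> 0 \<longleftrightarrow> full_col n k A"
proof -
  have G: "transpose_mat A * A \<in> carrier_mat k k" using A by simp
  have "transpose_mat A * A *\<^sub>v v = 0\<^sub>v k \<longleftrightarrow> A *\<^sub>v v = 0\<^sub>v n" if v: "v \<in> carrier_vec k" for v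
  proof
    assume 0: "transpose_mat A * A *\<^sub>v v = 0\<^sub>v k"
    have "scalar_prod (A *\<^sub>v v) (A *\<^sub>v v) = scalar_prod (transpose_mat A *\<^sub>v (A *\<^sub>v v)) v"
      using A v by (simp add: transpose_vec_mult_scalar)
    also have "\<dots> = 0" using 0 A v by (simp add: assoc_mult_mat_vec[of _ k n _ k])
    finally show "A *\<^sub>v v = 0\<^sub>v n" using A v by (intro scalar_prod_self_eq_0) auto
  next
    assume "A *\<^sub>v v = 0\<^sub>v n"
    then show "transpose_mat A * A *\<^sub>v v = 0\<^sub>v k"
      using A v by (simp add: assoc_mult_mat_vec[of _ k n _ k])
  qed
  then show ?thesis
    using A unfolding full_col_square_iff[OF G, symmetric] by (auto simp: full_col_def)
qed

text \<open>The Moore-Penrose inverse of a matrix of full column rank: \<open>A * pinv A\<close> is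
  then the orthogonal projector onto the image of \<open>A\<close>.\<close>

definition pinv :: "real mat \<Rightarrow> real mat" where
  "pinv A = minv (transpose_mat A * A) * transpose_mat A"

lemma pinv:
  assumes A: "full_col n k A"
  shows "pinv A \<in> carrier_mat k n" "pinv A * A = 1\<^sub>m k"
    "w \<in> mat_image A \<Longrightarrow> A *\<^sub>v (pinv A *\<^sub>v w) = w"
proof -
  have c: "A \<in> carrier_mat n k" using A by (rule full_colD)
  have G: "transpose_mat A * A \<in> carrier_mat k k" using c by simp
  note m = minv[OF G] gram_det_nonzero_iff[OF c, THEN iffD2, OF A]
  show p: "pinv A \<in> carrier_mat k n" using m c by (simp add: pinv_def)
  show pA: "pinv A * A = 1\<^sub>m k" using m c by (simp add: pinv_def assoc_mult_mat[of _ k k _ n _ k])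
  assume "w \<in> mat_image A"
  then obtain v where v: "v \<in> carrier_vec k" "w = A *\<^sub>v v" using c by (auto simp: mat_image_def)
  have "pinv A *\<^sub>v w = v" using v pA p c by (simp flip: assoc_mult_mat_vec)
  with v show "A *\<^sub>v (pinv A *\<^sub>v w) = w" by simp
qed

text \<open>A vector differs from its orthogonal projection onto im A by something orthogonal to the
  columns of A, which A^T annihilates.\<close>

lemma transpose_mult_projection:
  assumes A: "full_col n k A" and w: "w \<in> carrier_vec n"
  shows "transpose_mat A *\<^sub>v (A *\<^sub>v (pinv A *\<^sub>v w)) = transpose_mat A *\<^sub>v w"
proof -
  have cA: "A \<in> carrier_mat n k" using A by (rule full_colD)
  define G where "G = transpose_mat A * A"
  have G: "G \<in> carrier_mat k k" "Determinant.det G \<noteq> 0"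
    using cA A gram_det_nonzero_iff[OF cA] by (auto simp: G_def)
  have Aw: "transpose_mat A *\<^sub>v w \<in> carrier_vec k" using cA w by auto
  have T: "transpose_mat A \<in> carrier_mat k n" using cA by simp
  have p: "pinv A *\<^sub>v w = minv G *\<^sub>v (transpose_mat A *\<^sub>v w)"
    unfolding pinv_def G_def[symmetric] by (rule assoc_mult_mat_vec[OF minv(1)[OF G] T w])
  have "transpose_mat A *\<^sub>v (A *\<^sub>v (minv G *\<^sub>v (transpose_mat A *\<^sub>v w))) = G *\<^sub>v (minv G *\<^sub>v (transpose_mat A *\<^sub>v w))"
    unfolding G_def by (rule assoc_mult_mat_vec[symmetric, OF T cA]) (use minv_mult_vec(3)[OF G Aw] in \<open>simp add: G_def\<close>)
  then show ?thesis unfolding p using minv_mult_vec(1)[OF G Aw] by simp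
qed

section \<open>Products, factorisations and images\<close>

lemma full_col_mult:
  assumes A: "full_col n k A" and B: "full_col k l B"
  shows "full_col n l (A * B)"
  using A B by (auto simp: full_col_def assoc_mult_mat_vec[of _ n k _ l])

lemma mat_image_mult:
  assumes A: "A \<in> carrier_mat n k" and B: "B \<in> carrier_mat k l"
  shows "mat_image (A * B) = (\<lambda>v. A *\<^sub>v v) ` mat_image B"
  using A B by (auto simp: mat_image_eq[of _ n l] mat_image_eq[of _ k l] image_image assoc_mult_mat_vec[of _ n k _ l])

lemma mat_image_surj_right:
  assumes A: "A \<in> carrier_mat n k" and B: "B \<in> carrier_mat k k" "Determinant.det B \<noteq> 0"
  shows "mat_image (A * B) = mat_image A"
proof -
  note m = minv[OF B]
  have "mat_image B = carrier_vec k"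
  proof -
    have "v \<in> mat_image B" if v: "v \<in> carrier_vec k" for v
    proof -
      have "B *\<^sub>v (minv B *\<^sub>v v) = v"
        using m v B by (simp flip: assoc_mult_mat_vec)
      moreover have "minv B *\<^sub>v v \<in> carrier_vec k" using m v by auto
      ultimately show ?thesis using B by (auto simp: mat_image_def intro!: exI[of _ "minv B *\<^sub>v v"])
    qed
    then show ?thesis using B by (auto simp: mat_image_def)
  qed
  then show ?thesis using A B by (simp add: mat_image_mult mat_image_eq)
qed

text \<open>The factor is explicit because it inherits the smoothness of both matrices; it later
  serves as the change of variables between two reductions.\<close>

lemma factor_through:
  assumes B: "full_col n k B" and A: "A \<in> carrier_mat n l" and sub: "mat_image A \<subseteq> mat_image B"
  shows "A = B * (pinv B * A)"
proof (rule mat_eq_by_mult_vec[OF A])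
  have c: "B \<in> carrier_mat n k" using B by (rule full_colD)
  show "B * (pinv B * A) \<in> carrier_mat n l" using pinv(1)[OF B] A c by auto
  fix v :: "real vec" assume v: "v \<in> carrier_vec l"
  have "A *\<^sub>v v \<in> mat_image B" using v A sub by (auto simp: mat_image_def)
  from pinv(3)[OF B this] show "A *\<^sub>v v = B * (pinv B * A) *\<^sub>v v"
    using pinv(1)[OF B] A c v by (simp add: assoc_mult_mat_vec[of _ n k _ l] assoc_mult_mat_vec[of _ k n _ l])
qed

lemma full_col_factor:
  assumes A: "full_col n l A" and B: "B \<in> carrier_mat n k" and X: "X \<in> carrier_mat k l" and eq: "A = B * X"
  shows "full_col k l X"
  unfolding full_col_def
proof (intro conjI ballI impI)
  fix v assume v: "v \<in> carrier_vec l" "X *\<^sub>v v = 0\<^sub>v k"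
  then have "A *\<^sub>v v = 0\<^sub>v n" using B X eq by (simp add: assoc_mult_mat_vec[of _ n k _ l])
  then show "v = 0\<^sub>v l" using A v by (auto simp: full_col_def)
qed (rule X)

text \<open>Equal numbers of columns replace a dimension count: in A = B X the factor X is square
  and injective, hence invertible, so A and B have the same image.\<close>

lemma mat_image_eq_of_subset:
  assumes A: "full_col n k A" and B: "full_col n k B" and sub: "mat_image A \<subseteq> mat_image B"
  shows "mat_image A = mat_image B"
proof -
  have cA: "A \<in> carrier_mat n k" and cB: "B \<in> carrier_mat n k" using A B by (auto dest: full_colD)
  have X: "pinv B * A \<in> carrier_mat k k" using pinv(1)[OF B] cA by auto
  note eq = factor_through[OF B cA sub]
  have "Determinant.det (pinv B * A) \<noteq> 0"
    using full_col_factor[OF A cB X eq] full_col_square_iff[OF X] by simp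
  from mat_image_surj_right[OF cB X this] eq show ?thesis by simp
qed

section \<open>Subspaces and their bases\<close>

lemma is_subspace_diff:
  assumes "is_subspace n W" "v \<in> W" "w \<in> W"
  shows "v - w \<in> W"
proof -
  have "v - w = v + (-1) \<cdot>\<^sub>v w"
    using assms by (intro eq_vecI) (auto simp: is_subspace_def)
  then show ?thesis using assms by (auto simp: is_subspace_def)
qed

lemma mat_image_subset:
  assumes W: "is_subspace n W" and A: "A \<in> carrier_mat n k" and c: "\<And>j. j < k \<Longrightarrow> col A j \<in> W"
  shows "mat_image A \<subseteq> W"
proof -
  have "A *\<^sub>v v \<in> W" if v: "v \<in> carrier_vec k" for v
  proof -
    \<comment> \<open>Induction over the partial sums of the first \<open>l\<close> columns: closure
      under addition and scaling admits one further column at a time.\<close>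
    have "vec n (\<lambda>i. \<Sum>j<l. A $$ (i,j) * v $ j) \<in> W" if "l \<le> k" for l
      using that
    proof (induction l)
      case 0
      have "vec n (\<lambda>i. \<Sum>j<0. A $$ (i,j) * v $ j) = 0\<^sub>v n" by auto
      then show ?case using W by (simp add: is_subspace_def)
    next
      case (Suc l)
      have "vec n (\<lambda>i. \<Sum>j<Suc l. A $$ (i,j) * v $ j) =
          vec n (\<lambda>i. \<Sum>j<l. A $$ (i,j) * v $ j) + v $ l \<cdot>\<^sub>v col A l"
        using Suc.prems A by (intro eq_vecI) auto
      with Suc c W show ?case by (auto simp: is_subspace_def)
    qed
    from this[of k] have "vec n (\<lambda>i. \<Sum>j<k. A $$ (i,j) * v $ j) \<in> W" by simp
    moreover have "vec n (\<lambda>i. \<Sum>j<k. A $$ (i,j) * v $ j) = A *\<^sub>v v"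
      using A v by (intro eq_vecI) (auto simp: scalar_prod_def atLeast0LessThan)
    ultimately show ?thesis by simp
  qed
  then show ?thesis using A by (auto simp: mat_image_def)
qed

text \<open>Take a largest number of independent columns inside \<open>W\<close>; it exists since
  \<open>full_col_le\<close> bounds it by \<open>n\<close>. A vector of \<open>W\<close> outside
  their span could be appended, against maximality.\<close>

lemma subspace_basis_exists:
  assumes W: "is_subspace n W"
  obtains k B where "full_col n k B" "mat_image B = W"
proof -
  define P where "P k \<longleftrightarrow> (\<exists>B. full_col n k B \<and> mat_image B \<subseteq> W)" for k
  have "P 0"
  proof -
    have "full_col n 0 (0\<^sub>m n 0)" by (auto simp: full_col_def)
    moreover have "mat_image (0\<^sub>m n 0) \<subseteq> W" using W by (intro mat_image_subset[of n _ _ 0]) auto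
    ultimately show ?thesis unfolding P_def by blast
  qed
  moreover have bd: "\<And>k. P k \<Longrightarrow> k \<le> n" unfolding P_def using full_col_le by blast
  ultimately obtain k where k: "P k" and mx: "\<And>l. P l \<Longrightarrow> l \<le> k"
    using Nat.ex_has_greatest_nat[of P 0 n] by blast
  from k obtain B where B: "full_col n k B" "mat_image B \<subseteq> W" unfolding P_def by blast
  have cB: "B \<in> carrier_mat n k" using B by (auto dest: full_colD)
  have "w \<in> mat_image B" if w: "w \<in> W" for w
  proof (rule ccontr)
    assume nw: "w \<notin> mat_image B"
    have wc: "w \<in> carrier_vec n" using w W by (auto simp: is_subspace_def)
    define B' where "B' = mat n (Suc k) (\<lambda>(i,j). if j < k then B $$ (i,j) else w $ i)"
    have cB': "B' \<in> carrier_mat n (Suc k)" by (simp add: B'_def)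
    have mv: "B' *\<^sub>v v = B *\<^sub>v vec k (\<lambda>i. v $ i) + v $ k \<cdot>\<^sub>v w" if "v \<in> carrier_vec (Suc k)" for v
      using that cB wc by (intro eq_vecI) (auto simp: B'_def scalar_prod_def atLeast0LessThan)
    have "mat_image B' \<subseteq> W"
    proof -
      have "col B' j \<in> W" if j: "j < Suc k" for j
      proof (cases "j < k")
        case True
        have "col B' j = B *\<^sub>v unit_vec k j"
          unfolding mult_mat_unit_vec[OF cB True] using True cB by (auto simp: B'_def intro!: eq_vecI)
        moreover have "B *\<^sub>v unit_vec k j \<in> mat_image B" using cB by (auto simp: mat_image_def)
        ultimately show ?thesis using B(2) by auto
      next
        case False
        then have "col B' j = w" using j wc by (auto simp: B'_def intro!: eq_vecI)
        then show ?thesis using w by simp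
      qed
      with mat_image_subset[OF W cB'] show ?thesis by blast
    qed
    moreover have "full_col n (Suc k) B'"
      unfolding full_col_def
    proof (intro conjI ballI impI)
      fix v assume v: "v \<in> carrier_vec (Suc k)" and 0: "B' *\<^sub>v v = 0\<^sub>v n"
      let ?u = "vec k (\<lambda>i. v $ i)"
      have e: "B *\<^sub>v ?u + v $ k \<cdot>\<^sub>v w = 0\<^sub>v n" using 0 mv[OF v] by simp
      \<comment> \<open>A nonzero coefficient would let the relation be solved for \<open>w\<close>,
        placing it in the image of \<open>B\<close>.\<close>
      have vk: "v $ k = 0"
      proof (rule ccontr)
        assume nz: "v $ k \<noteq> 0"
        have "w = B *\<^sub>v ((- 1 / v $ k) \<cdot>\<^sub>v ?u)"
        proof (rule eq_vecI)
          fix i assume "i < dim_vec (B *\<^sub>v ((- 1 / v $ k) \<cdot>\<^sub>v ?u))"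
          then have i: "i < n" using cB by auto
          from arg_cong[OF e, of "\<lambda>x. x $ i"] i have "(B *\<^sub>v ?u) $ i + v $ k * w $ i = 0"
            using cB wc by auto
          then show "w $ i = (B *\<^sub>v ((- 1 / v $ k) \<cdot>\<^sub>v ?u)) $ i"
            using nz i cB by (subst mult_mat_vec[of _ n k]) (auto simp: field_simps)
        qed (use cB wc in auto)
        then have "w \<in> mat_image B" using cB by (auto simp: mat_image_def)
        with nw show False ..
      qed
      moreover have "0 \<cdot>\<^sub>v w = 0\<^sub>v n" using wc by auto
      moreover have "B *\<^sub>v ?u \<in> carrier_vec n" using cB by auto
      ultimately have "B *\<^sub>v ?u = 0\<^sub>v n" using e by simp
      then have "?u = 0\<^sub>v k" using B(1) by (auto simp: full_col_def)
      then have "v $ i = 0" if "i < k" for i using that by (metis index_vec index_zero_vec(1))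
      with vk have "v $ i = 0" if "i < Suc k" for i using that less_Suc_eq by auto
      then show "v = 0\<^sub>v (Suc k)" using v by (intro eq_vecI) auto
    qed (rule cB')
    ultimately have "P (Suc k)" unfolding P_def by blast
    then show False using mx by fastforce
  qed
  with B that show ?thesis by blast
qed


lemma subspace_dim_injective_image:
  assumes A: "full_col n k A" and W: "is_subspace k W"
  shows "subspace_dim n ((\<lambda>v. A *\<^sub>v v) ` W) = subspace_dim k W"
proof -
  obtain l B where B: "full_col k l B" "mat_image B = W" using subspace_basis_exists[OF W] .
  have "mat_image (A * B) = (\<lambda>v. A *\<^sub>v v) ` W"
    using mat_image_mult[of A n k B l] A B by (auto simp: full_col_def)
  then show ?thesis
    using subspace_dim_full_col[OF full_col_mult[OF A B(1)]] subspace_dim_full_col[OF B(1)] B(2) by simp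
qed

section \<open>Kernels and orthogonal complements\<close>

lemma is_subspace_mat_kernel:
  assumes A: "A \<in> carrier_mat n k"
  shows "is_subspace k (mat_kernel A)"
  using A by (auto simp: is_subspace_def mat_kernel_def mult_add_distrib_mat_vec[of _ n k] mult_mat_vec[of _ n k])

lemma orth_compl_mat_image:
  assumes A: "A \<in> carrier_mat n k"
  shows "orth_compl n (mat_image A) = mat_kernel (transpose_mat A)"
proof -
  have "(\<forall>y\<in>mat_image A. scalar_prod z y = 0) \<longleftrightarrow> transpose_mat A *\<^sub>v z = 0\<^sub>v k" if z: "z \<in> carrier_vec n" for z
  proof -
    have eq: "scalar_prod z (A *\<^sub>v v) = scalar_prod (transpose_mat A *\<^sub>v z) v" if "v \<in> carrier_vec k" for v
      using A z that by (simp add: transpose_vec_mult_scalar)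
    have c: "transpose_mat A *\<^sub>v z \<in> carrier_vec k" using A z by auto
    show ?thesis
    proof
      assume "\<forall>y\<in>mat_image A. scalar_prod z y = 0"
      then have "scalar_prod z (A *\<^sub>v (transpose_mat A *\<^sub>v z)) = 0"
        using A c by (auto simp: mat_image_def)
      with eq[OF c] show "transpose_mat A *\<^sub>v z = 0\<^sub>v k" using c by (intro scalar_prod_self_eq_0) auto
    next
      assume "transpose_mat A *\<^sub>v z = 0\<^sub>v k"
      with eq show "\<forall>y\<in>mat_image A. scalar_prod z y = 0" using A by (auto simp: mat_image_def)
    qed
  qed
  then show ?thesis using A by (auto simp: orth_compl_def mat_kernel_def)
qed

text \<open>With u the orthogonal projection of w onto im A, the difference w - u is orthogonal to
  im A, hence to u, and by hypothesis also to w. So |w - u|^2 = 0.\<close>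

lemma orth_orth_compl:
  assumes A: "A \<in> carrier_mat n k" and w: "w \<in> carrier_vec n"
    and orth: "\<And>z. z \<in> orth_compl n (mat_image A) \<Longrightarrow> scalar_prod z w = 0"
  shows "w \<in> mat_image A"
proof -
  \<comment> \<open>\<open>A\<close> may have dependent columns; the projector
    \<open>B * pinv B\<close> requires a basis of its image.\<close>
  obtain l B where B: "full_col n l B" "mat_image B = mat_image A"
    using subspace_basis_exists[OF is_subspace_mat_image[OF A]] .
  have cB: "B \<in> carrier_mat n l" using B by (auto dest: full_colD)
  note p = pinv[OF B(1)]
  define u where "u = B *\<^sub>v (pinv B *\<^sub>v w)"
  have u: "u \<in> carrier_vec n" "u \<in> mat_image B"
    using p cB w by (auto simp: u_def mat_image_def)
  have T: "transpose_mat B \<in> carrier_mat l n" using cB by simp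
  have "transpose_mat B *\<^sub>v (w - u) = transpose_mat B *\<^sub>v w - transpose_mat B *\<^sub>v u"
    by (rule mult_minus_distrib_mat_vec[OF T w u(1)])
  also have "\<dots> = 0\<^sub>v l"
    unfolding u_def transpose_mult_projection[OF B(1) w] using T w by auto
  finally have "transpose_mat B *\<^sub>v (w - u) = 0\<^sub>v l" .
  then have o: "w - u \<in> orth_compl n (mat_image A)"
    unfolding B(2)[symmetric] orth_compl_mat_image[OF cB] using cB w u by (auto simp: mat_kernel_def)
  have wu: "w - u \<in> carrier_vec n" using w u by auto
  have "scalar_prod (w - u) (w - u) = scalar_prod (w - u) w - scalar_prod (w - u) u"
    using w u by (intro scalar_prod_minus_distrib[of _ n]) auto
  also have "\<dots> = 0" using orth[OF o] o u(2) B(2) by (auto simp: orth_compl_def)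
  finally have "w - u = 0\<^sub>v n" using wu by (intro scalar_prod_self_eq_0) auto
  have "w = u"
  proof (rule eq_vecI)
    fix i assume "i < dim_vec u"
    then show "w $ i = u $ i"
      using arg_cong[OF \<open>w - u = 0\<^sub>v n\<close>, of "\<lambda>x. x $ i"] u(1) w by simp
  qed (use u(1) w in auto)
  then show ?thesis using u B by simp
qed

text \<open>A^T is onto, as v = A^T (A (A^T A)^(-1) v), so rank-nullity leaves n - k for its
  kernel.\<close>

lemma subspace_dim_kernel_transpose:
  assumes A: "full_col n k A"
  shows "subspace_dim n (mat_kernel (transpose_mat A)) = n - k"
proof -
  have cA: "A \<in> carrier_mat n k" using A by (rule full_colD)
  have G: "transpose_mat A * A \<in> carrier_mat k k" using cA by simp
  have "v \<in> mat_image (transpose_mat A)" if v: "v \<in> carrier_vec k" for v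
  proof -
    note m = minv[OF G] gram_det_nonzero_iff[OF cA, THEN iffD2, OF A]
    have c: "minv (transpose_mat A * A) *\<^sub>v v \<in> carrier_vec k" using m v by auto
    have "transpose_mat A *\<^sub>v (A *\<^sub>v (minv (transpose_mat A * A) *\<^sub>v v))
        = transpose_mat A * A *\<^sub>v (minv (transpose_mat A * A) *\<^sub>v v)"
      by (rule assoc_mult_mat_vec[symmetric]) (use cA c in auto)
    also have "\<dots> = (transpose_mat A * A * minv (transpose_mat A * A)) *\<^sub>v v"
      by (rule assoc_mult_mat_vec[symmetric]) (use G m v in auto)
    also have "\<dots> = v" using m v by simp
    finally show ?thesis using c cA
      by (auto simp: mat_image_def intro!: exI[of _ "A *\<^sub>v (minv (transpose_mat A * A) *\<^sub>v v)"])
  qed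
  then have "mat_image (transpose_mat A) = carrier_vec k"
    using cA by (auto simp: mat_image_def)
  moreover have "mat_image (1\<^sub>m k :: real mat) = carrier_vec k"
    by (force simp: mat_image_def)
  moreover have "subspace_dim k (mat_image (1\<^sub>m k)) = k"
    by (intro subspace_dim_full_col) (auto simp: full_col_def)
  ultimately show ?thesis
    using rank_nullity_mat[of "transpose_mat A" k n] cA by simp
qed

section \<open>Column bases as used by the reduction procedure\<close>

lemma cols_basis_imp:
  assumes b: "cols_basis n A W" and W: "is_subspace n W"
  shows "full_col n (dim_col A) A" "mat_image A = W"
proof -
  have cA: "A \<in> carrier_mat n (dim_col A)" using b by (auto simp: cols_basis_def)
  show "full_col n (dim_col A) A" using b cA unfolding full_col_def cols_basis_def by blast
  have "mat_image A \<subseteq> W"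
    using b by (intro mat_image_subset[OF W cA]) (auto simp: cols_basis_def cols_def)
  moreover have "W \<subseteq> mat_image A" using b by (auto simp: cols_basis_def mat_image_def)
  ultimately show "mat_image A = W" by simp
qed

lemma full_col_imp_cols_basis:
  assumes A: "full_col n k A" and W: "mat_image A = W"
  shows "cols_basis n A W"
proof -
  have cA: "A \<in> carrier_mat n k" using A by (rule full_colD)
  have "col A j \<in> mat_image A" if "j < k" for j
    using mult_mat_unit_vec[OF cA that] cA by (auto simp: mat_image_def intro!: exI[of _ "unit_vec k j"])
  then show ?thesis
    using A W cA by (auto simp: cols_basis_def full_col_def cols_def mat_image_def)
qed

text \<open>The kernel of Z^T is the double orthogonal complement of im E, that is im E itself. Thus
  Z^T F z = 0 says exactly F z in im E, and the choice of Z leaves no trace in what follows.\<close>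

lemma kernel_orth_basis_eq_S_space:
  assumes E: "E \<in> carrier_mat p p" and F: "F \<in> carrier_mat p q"
    and Z: "cols_basis p Z (orth_compl p (mat_image E))"
  shows "mat_kernel (transpose_mat Z * F) = S_space E F"
proof -
  have o: "is_subspace p (orth_compl p (mat_image E))"
    unfolding orth_compl_mat_image[OF E] using E by (intro is_subspace_mat_kernel[of _ p]) auto
  note Zb = cols_basis_imp[OF Z o]
  define l where "l = dim_col Z"
  have cZ: "Z \<in> carrier_mat p l" using Zb(1) by (auto simp: full_col_def l_def)
  have "transpose_mat Z * F *\<^sub>v z = 0\<^sub>v l \<longleftrightarrow> F *\<^sub>v z \<in> mat_image E" if z: "z \<in> carrier_vec q" for z
  proof -
    have Fz: "F *\<^sub>v z \<in> carrier_vec p" using F z by auto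
    have "transpose_mat Z * F *\<^sub>v z = 0\<^sub>v l \<longleftrightarrow> F *\<^sub>v z \<in> mat_kernel (transpose_mat Z)"
      using cZ F z Fz by (auto simp: mat_kernel_def assoc_mult_mat_vec[of _ l p _ q])
    also have "\<dots> \<longleftrightarrow> F *\<^sub>v z \<in> orth_compl p (orth_compl p (mat_image E))"
      using orth_compl_mat_image[OF cZ] Zb(2) by simp
    also have "\<dots> \<longleftrightarrow> F *\<^sub>v z \<in> mat_image E"
    proof
      assume a: "F *\<^sub>v z \<in> orth_compl p (orth_compl p (mat_image E))"
      show "F *\<^sub>v z \<in> mat_image E"
      proof (rule orth_orth_compl[OF E Fz])
        fix y assume y: "y \<in> orth_compl p (mat_image E)"
        then have "scalar_prod (F *\<^sub>v z) y = 0" using a by (auto simp: orth_compl_def)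
        moreover have "y \<in> carrier_vec p" using y by (auto simp: orth_compl_def)
        ultimately show "scalar_prod y (F *\<^sub>v z) = 0" using Fz by (metis comm_scalar_prod)
      qed
    next
      assume a: "F *\<^sub>v z \<in> mat_image E"
      show "F *\<^sub>v z \<in> orth_compl p (orth_compl p (mat_image E))"
        unfolding orth_compl_def
      proof (intro CollectI conjI ballI Fz)
        fix y assume y: "y \<in> {z \<in> carrier_vec p. \<forall>y\<in>mat_image E. scalar_prod z y = 0}"
        then have "scalar_prod y (F *\<^sub>v z) = 0" "y \<in> carrier_vec p" using a by auto
        then show "scalar_prod (F *\<^sub>v z) y = 0" using Fz by (metis comm_scalar_prod)
      qed
    qed
    finally show ?thesis .
  qed
  then show ?thesis using cZ F by (auto simp: mat_kernel_def S_space_def)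
qed

section \<open>Calculus of matrix functions\<close>

text \<open>A connected set with two points has no isolated point. This is what makes derivatives
  within I unique, also at an endpoint.\<close>

lemma real_interval_nontrivial:
  assumes I: "real_interval I" and t: "t \<in> I"
  shows "at t within I \<noteq> bot"
proof -
  have "connected I" using I by (auto simp: real_interval_def is_interval_connected)
  moreover obtain a b where "a < b" "a \<in> I" "b \<in> I" using I by (auto simp: real_interval_def)
  then have "\<nexists>a. I = {a}" by auto
  ultimately have "t islimpt I" using t by (intro connected_imp_perfect) auto
  then show ?thesis by (simp add: trivial_limit_within)
qed

lemma real_interval_localize:
  assumes I: "real_interval I" and t: "t \<in> I" and d: "\<delta> > 0"
  shows "real_interval ({t - \<delta><..<t + \<delta>} \<inter> I)"
proof -
  have int: "is_interval I" using I by (simp add: real_interval_def)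
  obtain a b where ab: "a < b" "a \<in> I" "b \<in> I" using I by (auto simp: real_interval_def)
  have "is_interval ({t - \<delta><..<t + \<delta>} \<inter> I)"
    using int by (intro is_interval_Int) (auto simp: is_interval_oo)
  moreover have "\<exists>a b. a < b \<and> a \<in> {t - \<delta><..<t + \<delta>} \<inter> I \<and> b \<in> {t - \<delta><..<t + \<delta>} \<inter> I"
  \<comment> \<open>\<open>t\<close> may be an endpoint of \<open>I\<close>, so the second point is
    sought on whichever side \<open>I\<close> extends: towards \<open>b\<close> if
    \<open>t < b\<close>, otherwise towards \<open>a\<close>.\<close>
  proof (cases "t < b")
    case True
    let ?c = "min b (t + \<delta> / 2)"
    have "?c \<in> I" by (rule mem_is_interval_1_I[OF int t ab(3)]) (use True d in auto)
    then show ?thesis using True d t by (intro exI[of _ t] exI[of _ ?c]) auto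
  next
    case False
    let ?c = "max a (t - \<delta> / 2)"
    have "?c \<in> I" by (rule mem_is_interval_1_I[OF int ab(2) t]) (use False ab d in auto)
    then show ?thesis using False ab d t by (intro exI[of _ ?c] exI[of _ t]) auto
  qed
  ultimately show ?thesis by (simp add: real_interval_def)
qed

lemma real_derivative_unique_within:
  assumes "real_interval I" "t \<in> I"
    and "(f has_real_derivative a) (at t within I)" "(f has_real_derivative b) (at t within I)"
  shows "a = b"
  using vector_derivative_unique_within[OF real_interval_nontrivial[OF assms(1,2)]] assms(3,4)
  by (simp add: has_real_derivative_iff_has_vector_derivative)

lemma has_real_derivative_cong_on:
  assumes "(f has_real_derivative a) (at t within I)" "t \<in> I" "\<And>s. s \<in> I \<Longrightarrow> g s = f s"
  shows "(g has_real_derivative a) (at t within I)"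
  using assms unfolding has_field_derivative_def by (rule_tac has_derivative_transform) auto

section \<open>Functions of class C^k on a set\<close>

lemma Ck_on_cong:
  assumes "\<And>t. t \<in> I \<Longrightarrow> f t = g t"
  shows "Ck_on k I f \<longleftrightarrow> Ck_on k I g"
proof (cases k)
  case 0
  then show ?thesis using continuous_on_cong[OF refl] assms by simp
next
  case (Suc k)
  have "(f has_real_derivative a) (at t within I) \<longleftrightarrow> (g has_real_derivative a) (at t within I)"
    if "t \<in> I" for a t
    using has_real_derivative_cong_on that assms by metis
  then show ?thesis using Suc by simp
qed

lemma Ck_on_subset:
  assumes "Ck_on k I f" "J \<subseteq> I"
  shows "Ck_on k J f"
  using assms
proof (induction k arbitrary: f)
  case 0
  then show ?case by (auto intro: continuous_on_subset)
next
  case (Suc k)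
  then obtain f' where "\<forall>t\<in>I. (f has_real_derivative f' t) (at t within I)" "Ck_on k I f'" by auto
  then show ?case using Suc by (auto intro!: exI[of _ f'] intro: DERIV_subset)
qed

lemma Ck_on_SucD: "Ck_on (Suc k) I f \<Longrightarrow> Ck_on k I f"
proof (induction k arbitrary: f)
  case 0
  then show ?case
    by (auto simp: continuous_on_eq_continuous_within intro: DERIV_continuous)
next
  case (Suc k)
  from Suc.prems obtain f' where f': "\<forall>t\<in>I. (f has_real_derivative f' t) (at t within I)" "Ck_on (Suc k) I f'"
    by auto
  with Suc.IH[OF f'(2)] show ?case by auto
qed

lemma Ck_on_le:
  assumes "Ck_on k I f" "j \<le> k"
  shows "Ck_on j I f"
  using assms(2,1) by (induction k rule: dec_induct) (auto dest: Ck_on_SucD simp del: Ck_on.simps)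

lemma Ck_on_const: "Ck_on k I (\<lambda>t. c)"
proof (induction k arbitrary: c)
  case (Suc k)
  then show ?case by (auto intro!: exI[of _ "\<lambda>t. 0"])
qed auto

lemma Ck_on_add:
  assumes "Ck_on k I f" "Ck_on k I g"
  shows "Ck_on k I (\<lambda>t. f t + g t)"
  using assms
proof (induction k arbitrary: f g)
  case 0
  then show ?case by (auto intro: continuous_intros)
next
  case (Suc k)
  then obtain f' g' where "\<forall>t\<in>I. (f has_real_derivative f' t) (at t within I)" "Ck_on k I f'"
    "\<forall>t\<in>I. (g has_real_derivative g' t) (at t within I)" "Ck_on k I g'" by auto
  then show ?case using Suc.IH by (auto intro!: exI[of _ "\<lambda>t. f' t + g' t"] derivative_intros)
qed

lemma Ck_on_mult:
  assumes "Ck_on k I f" "Ck_on k I g"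
  shows "Ck_on k I (\<lambda>t. f t * g t)"
  using assms
proof (induction k arbitrary: f g)
  case 0
  then show ?case by (auto intro: continuous_intros)
next
  case (Suc k)
  then obtain f' g' where d: "\<forall>t\<in>I. (f has_real_derivative f' t) (at t within I)" "Ck_on k I f'"
    "\<forall>t\<in>I. (g has_real_derivative g' t) (at t within I)" "Ck_on k I g'" by auto
  have "Ck_on k I (\<lambda>t. f' t * g t + g' t * f t)"
    using d Suc.IH Suc.prems Ck_on_SucD by (intro Ck_on_add) blast+
  then show ?case using d by (auto intro!: exI[of _ "\<lambda>t. f' t * g t + g' t * f t"] DERIV_mult)
qed

lemma Ck_on_sum:
  assumes "\<And>i. i \<in> S \<Longrightarrow> Ck_on k I (f i)"
  shows "Ck_on k I (\<lambda>t. \<Sum>i\<in>S. f i t)"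
  using assms by (induction S rule: infinite_finite_induct) (auto intro: Ck_on_add Ck_on_const)

lemma Ck_on_prod:
  assumes "\<And>i. i \<in> S \<Longrightarrow> Ck_on k I (f i)"
  shows "Ck_on k I (\<lambda>t. \<Prod>i\<in>S. f i t)"
  using assms by (induction S rule: infinite_finite_induct) (auto intro: Ck_on_mult Ck_on_const)

lemma Ck_on_inverse:
  assumes "Ck_on k I f" and nz: "\<And>t. t \<in> I \<Longrightarrow> f t \<noteq> 0"
  shows "Ck_on k I (\<lambda>t. 1 / f t)"
  using assms(1)
proof (induction k)
  case 0
  then show ?case using nz by (auto intro: continuous_intros)
next
  case (Suc k)
  then obtain f' where d: "\<forall>t\<in>I. (f has_real_derivative f' t) (at t within I)" "Ck_on k I f'" by auto
  \<comment> \<open>The derivative -f'/f^2, written with two factors 1/f so that the induction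
    hypothesis applies to each of them.\<close>
  let ?d = "\<lambda>t. - 1 * f' t * (1 / f t * (1 / f t))"
  have "Ck_on k I ?d"
    using d Suc Ck_on_SucD by (intro Ck_on_mult Ck_on_const) blast+
  moreover have "((\<lambda>t. 1 / f t) has_real_derivative ?d t) (at t within I)" if "t \<in> I" for t
    using d that nz by (auto intro!: derivative_eq_intros simp: field_simps)
  ultimately show ?case unfolding Ck_on.simps by (intro exI[of _ ?d] conjI ballI)
qed

section \<open>Matrix functions: smoothness and entrywise derivatives\<close>

lemma mat_Ck_carrier: "mat_Ck k I nr nc A \<Longrightarrow> t \<in> I \<Longrightarrow> A t \<in> carrier_mat nr nc"
  by (simp add: mat_Ck_def)

lemma mat_Ck_subset: "mat_Ck k I nr nc A \<Longrightarrow> J \<subseteq> I \<Longrightarrow> mat_Ck k J nr nc A"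
  unfolding mat_Ck_def by (meson Ck_on_subset subsetD)

lemma mat_Ck_le: "mat_Ck k I nr nc A \<Longrightarrow> j \<le> k \<Longrightarrow> mat_Ck j I nr nc A"
  unfolding mat_Ck_def by (meson Ck_on_le)

lemma mat_Ck_cong:
  assumes "mat_Ck k I nr nc A" and "\<And>t. t \<in> I \<Longrightarrow> B t = A t"
  shows "mat_Ck k I nr nc B"
  unfolding mat_Ck_def
proof (intro conjI ballI allI impI)
  fix i j assume "i < nr" "j < nc"
  then have "Ck_on k I (\<lambda>t. A t $$ (i, j))" using assms by (simp add: mat_Ck_def)
  then show "Ck_on k I (\<lambda>t. B t $$ (i, j))" using assms(2) by (subst Ck_on_cong) auto
qed (use assms in \<open>auto simp: mat_Ck_def\<close>)

lemma mat_Ck_const: "A \<in> carrier_mat nr nc \<Longrightarrow> mat_Ck k I nr nc (\<lambda>t. A)"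
  by (simp add: mat_Ck_def Ck_on_const)

lemma mat_Ck_transpose:
  assumes "mat_Ck k I nr nc A"
  shows "mat_Ck k I nc nr (\<lambda>t. transpose_mat (A t))"
  unfolding mat_Ck_def
proof (intro conjI ballI allI impI)
  fix i j assume ij: "i < nc" "j < nr"
  have "Ck_on k I (\<lambda>t. A t $$ (j, i))" using assms ij by (auto simp: mat_Ck_def)
  then show "Ck_on k I (\<lambda>t. transpose_mat (A t) $$ (i, j))"
    by (subst Ck_on_cong) (use assms ij in \<open>auto dest!: mat_Ck_carrier\<close>)
qed (use assms in \<open>auto dest: mat_Ck_carrier\<close>)

lemma mat_Ck_add:
  assumes "mat_Ck k I nr nc A" "mat_Ck k I nr nc B"
  shows "mat_Ck k I nr nc (\<lambda>t. A t + B t)"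
  unfolding mat_Ck_def
proof (intro conjI ballI allI impI)
  fix i j assume ij: "i < nr" "j < nc"
  have "Ck_on k I (\<lambda>t. A t $$ (i, j) + B t $$ (i, j))"
    using assms ij by (intro Ck_on_add) (auto simp: mat_Ck_def)
  then show "Ck_on k I (\<lambda>t. (A t + B t) $$ (i, j))"
    by (subst Ck_on_cong) (use assms ij in \<open>auto dest!: mat_Ck_carrier\<close>)
qed (use assms in \<open>auto dest: mat_Ck_carrier\<close>)

lemma mat_Ck_mult:
  assumes A: "mat_Ck k I nr n A" and B: "mat_Ck k I n nc B"
  shows "mat_Ck k I nr nc (\<lambda>t. A t * B t)"
  unfolding mat_Ck_def
proof (intro conjI ballI allI impI)
  fix i j assume ij: "i < nr" "j < nc"
  have "Ck_on k I (\<lambda>t. \<Sum>l<n. A t $$ (i, l) * B t $$ (l, j))"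
    using assms ij by (intro Ck_on_sum Ck_on_mult) (auto simp: mat_Ck_def)
  moreover have "(A t * B t) $$ (i, j) = (\<Sum>l<n. A t $$ (i, l) * B t $$ (l, j))" if "t \<in> I" for t
    using mat_Ck_carrier[OF A that] mat_Ck_carrier[OF B that] ij
    by (auto simp: scalar_prod_def atLeast0LessThan)
  ultimately show "Ck_on k I (\<lambda>t. (A t * B t) $$ (i, j))"
    by (subst Ck_on_cong) auto
qed (use mat_Ck_carrier[OF A] mat_Ck_carrier[OF B] in \<open>blast intro: mult_carrier_mat\<close>)

lemma Ck_on_det:
  assumes A: "mat_Ck k I n n A"
  shows "Ck_on k I (\<lambda>t. Determinant.det (A t))"
proof -
  have "Ck_on k I (\<lambda>t. \<Sum>p | p permutes {0..<n}. signof p * (\<Prod>i = 0..<n. A t $$ (i, p i)))"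
    using A permutes_in_image
    by (intro Ck_on_sum Ck_on_mult Ck_on_const Ck_on_prod) (fastforce simp: mat_Ck_def)
  moreover have "Determinant.det (A t) = (\<Sum>p | p permutes {0..<n}. signof p * (\<Prod>i = 0..<n. A t $$ (i, p i)))"
    if "t \<in> I" for t
    by (rule det_def'[OF mat_Ck_carrier[OF A that]])
  ultimately show ?thesis
    by (subst Ck_on_cong) auto
qed

lemma mat_Ck_minv:
  assumes A: "mat_Ck k I n n A" and d: "\<And>t. t \<in> I \<Longrightarrow> Determinant.det (A t) \<noteq> 0"
  shows "mat_Ck k I n n (\<lambda>t. minv (A t))"
  unfolding mat_Ck_def
proof (intro conjI ballI allI impI)
  fix i j assume ij: "i < n" "j < n"
  \<comment> \<open>Row \<open>j\<close> and column \<open>i\<close> are deleted for the entry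
    \<open>(i, j)\<close>, because the adjugate is the transpose of the cofactor matrix.\<close>
  have "mat_Ck k I (n - 1) (n - 1) (\<lambda>t. mat_delete (A t) j i)"
    unfolding mat_Ck_def
  proof (intro conjI ballI allI impI)
    fix a b assume ab: "a < n - 1" "b < n - 1"
    let ?a = "if a < j then a else Suc a" and ?b = "if b < i then b else Suc b"
    have "Ck_on k I (\<lambda>t. A t $$ (?a, ?b))" using A ab by (auto simp: mat_Ck_def)
    moreover have "mat_delete (A t) j i $$ (a, b) = A t $$ (?a, ?b)" if "t \<in> I" for t
      using mat_Ck_carrier[OF A that] ab by (auto simp: mat_delete_def)
    ultimately show "Ck_on k I (\<lambda>t. mat_delete (A t) j i $$ (a, b))"
      by (subst Ck_on_cong) auto
  next
    fix t assume "t \<in> I"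
    from mat_Ck_carrier[OF A this] show "mat_delete (A t) j i \<in> carrier_mat (n - 1) (n - 1)"
      by (auto simp: mat_delete_def)
  qed
  then have "Ck_on k I (\<lambda>t. 1 / Determinant.det (A t) * ((-1) ^ (j + i) * Determinant.det (mat_delete (A t) j i)))"
    using A d by (intro Ck_on_mult Ck_on_const Ck_on_det Ck_on_inverse) auto
  moreover have "minv (A t) $$ (i, j) =
      1 / Determinant.det (A t) * ((-1) ^ (j + i) * Determinant.det (mat_delete (A t) j i))" if "t \<in> I" for t
    using mat_Ck_carrier[OF A that] ij by (auto simp: minv_def adj_mat_def cofactor_def)
  ultimately show "Ck_on k I (\<lambda>t. minv (A t) $$ (i, j))"
    by (subst Ck_on_cong) auto
qed (use mat_Ck_carrier[OF A] minv d in blast)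

lemma mat_Ck_pinv:
  assumes A: "mat_Ck k I n l A" and d: "\<And>t. t \<in> I \<Longrightarrow> full_col n l (A t)"
  shows "mat_Ck k I l n (\<lambda>t. pinv (A t))"
proof -
  have "mat_Ck k I l l (\<lambda>t. transpose_mat (A t) * A t)"
    by (rule mat_Ck_mult[OF mat_Ck_transpose[OF A] A])
  moreover have "Determinant.det (transpose_mat (A t) * A t) \<noteq> 0" if "t \<in> I" for t
    using gram_det_nonzero_iff[OF mat_Ck_carrier[OF A that]] d[OF that] by simp
  ultimately show ?thesis
    unfolding pinv_def by (intro mat_Ck_mult[OF mat_Ck_minv mat_Ck_transpose[OF A]])
qed

lemma mat_Ck_Suc_deriv:
  assumes A: "mat_Ck (Suc k) I nr nc A"
  obtains A' where "has_mat_deriv_on I nr nc A A'" "mat_Ck k I nr nc A'"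
proof -
  have "\<forall>i j. \<exists>f'. i < nr \<longrightarrow> j < nc \<longrightarrow>
    (\<forall>t\<in>I. ((\<lambda>s. A s $$ (i, j)) has_real_derivative f' t) (at t within I)) \<and> Ck_on k I f'"
    using A by (auto simp: mat_Ck_def)
  then obtain f' where f': "\<And>i j. i < nr \<Longrightarrow> j < nc \<Longrightarrow>
    (\<forall>t\<in>I. ((\<lambda>s. A s $$ (i, j)) has_real_derivative f' i j t) (at t within I)) \<and> Ck_on k I (f' i j)"
    by metis
  define A' where "A' t = mat nr nc (\<lambda>(i, j). f' i j t)" for t
  have "has_mat_deriv_on I nr nc A A'" "mat_Ck k I nr nc A'"
    using f' by (auto simp: has_mat_deriv_on_def mat_Ck_def A'_def)
  then show ?thesis using that by blast
qed

lemma has_mat_deriv_onD: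
  assumes "has_mat_deriv_on I nr nc A A'" "t \<in> I"
  shows "A' t \<in> carrier_mat nr nc"
    "i < nr \<Longrightarrow> j < nc \<Longrightarrow> ((\<lambda>s. A s $$ (i, j)) has_real_derivative A' t $$ (i, j)) (at t within I)"
  using assms unfolding has_mat_deriv_on_def by blast+

lemma has_mat_deriv_on_unique:
  assumes I: "real_interval I" and A: "has_mat_deriv_on I nr nc A A'" and B: "has_mat_deriv_on I nr nc B B'"
    and eq: "\<And>t. t \<in> I \<Longrightarrow> A t = B t" and t: "t \<in> I"
  shows "A' t = B' t"
proof (rule eq_matI)
  fix i j assume "i < dim_row (B' t)" "j < dim_col (B' t)"
  then have ij: "i < nr" "j < nc" using has_mat_deriv_onD(1)[OF B t] by auto
  have "((\<lambda>s. A s $$ (i, j)) has_real_derivative A' t $$ (i, j)) (at t within I)"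
    by (rule has_mat_deriv_onD(2)[OF A t ij])
  then have "((\<lambda>s. B s $$ (i, j)) has_real_derivative A' t $$ (i, j)) (at t within I)"
    by (rule has_real_derivative_cong_on[OF _ t]) (simp add: eq)
  then show "A' t $$ (i, j) = B' t $$ (i, j)"
    by (rule real_derivative_unique_within[OF I t _ has_mat_deriv_onD(2)[OF B t ij]])
qed (use has_mat_deriv_onD(1)[OF A t] has_mat_deriv_onD(1)[OF B t] in auto)

text \<open>A run only asserts that \<open>Cds i\<close> is some derivative of \<open>Cs i\<close>;
  uniqueness identifies it with the one that is known to be of class C^k.\<close>

lemma mat_Ck_of_deriv:
  assumes I: "real_interval I" and A: "mat_Ck (Suc k) I nr nc A" and A': "has_mat_deriv_on I nr nc A A'"
  shows "mat_Ck k I nr nc A'"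
proof -
  obtain B where B: "has_mat_deriv_on I nr nc A B" "mat_Ck k I nr nc B" using mat_Ck_Suc_deriv[OF A] .
  show ?thesis
    using mat_Ck_cong[OF B(2)] has_mat_deriv_on_unique[OF I A' B(1)] by blast
qed

lemma has_mat_deriv_on_subset:
  "has_mat_deriv_on I nr nc A A' \<Longrightarrow> J \<subseteq> I \<Longrightarrow> has_mat_deriv_on J nr nc A A'"
  unfolding has_mat_deriv_on_def by (meson DERIV_subset subsetD)

lemma has_mat_deriv_on_mult:
  assumes A: "has_mat_deriv_on I nr n A A'" and B: "has_mat_deriv_on I n nc B B'"
    and cA: "\<And>t. t \<in> I \<Longrightarrow> A t \<in> carrier_mat nr n" and cB: "\<And>t. t \<in> I \<Longrightarrow> B t \<in> carrier_mat n nc"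
  shows "has_mat_deriv_on I nr nc (\<lambda>t. A t * B t) (\<lambda>t. A' t * B t + A t * B' t)"
  unfolding has_mat_deriv_on_def
proof (intro ballI conjI allI impI)
  fix t assume t: "t \<in> I"
  have c: "A' t \<in> carrier_mat nr n" "B' t \<in> carrier_mat n nc" using has_mat_deriv_onD(1)[OF A t] has_mat_deriv_onD(1)[OF B t] by auto
  show "A' t * B t + A t * B' t \<in> carrier_mat nr nc" using c cA[OF t] cB[OF t] by auto
  fix i j assume ij: "i < nr" "j < nc"
  have D: "((\<lambda>s. \<Sum>l<n. A s $$ (i, l) * B s $$ (l, j)) has_real_derivative
      (\<Sum>l<n. A' t $$ (i, l) * B t $$ (l, j) + B' t $$ (l, j) * A t $$ (i, l))) (at t within I)"
    using has_mat_deriv_onD(2)[OF A t] has_mat_deriv_onD(2)[OF B t] ij by (intro DERIV_sum DERIV_mult) auto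
  have e1: "(\<Sum>l<n. A' t $$ (i, l) * B t $$ (l, j) + B' t $$ (l, j) * A t $$ (i, l)) =
      (A' t * B t + A t * B' t) $$ (i, j)"
    using c cA[OF t] cB[OF t] ij
    by (auto simp: scalar_prod_def atLeast0LessThan sum.distrib intro!: sum.cong)
  have e2: "(A s * B s) $$ (i, j) = (\<Sum>l<n. A s $$ (i, l) * B s $$ (l, j))" if "s \<in> I" for s
    using cA[OF that] cB[OF that] ij by (auto simp: scalar_prod_def atLeast0LessThan)
  show "((\<lambda>s. (A s * B s) $$ (i, j)) has_real_derivative (A' t * B t + A t * B' t) $$ (i, j)) (at t within I)"
    by (rule has_real_derivative_cong_on[OF D[unfolded e1] t e2])
qed

text \<open>Names the derivative that \<open>dae_solution_on\<close> hides behind an existential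
  quantifier, so that product rule and uniqueness can refer to it.\<close>

definition vec_C1 :: "real set \<Rightarrow> nat \<Rightarrow> (real \<Rightarrow> real vec) \<Rightarrow> (real \<Rightarrow> real vec) \<Rightarrow> bool" where
  "vec_C1 J n x x' \<longleftrightarrow>
     (\<forall>t\<in>J. x t \<in> carrier_vec n \<and> x' t \<in> carrier_vec n) \<and>
     (\<forall>k<n. \<forall>t\<in>J. ((\<lambda>s. x s $ k) has_real_derivative (x' t $ k)) (at t within J)) \<and>
     (\<forall>k<n. continuous_on J (\<lambda>t. x' t $ k))"

lemma dae_solution_on_iff:
  "dae_solution_on J m E F x \<longleftrightarrow>
     (\<exists>x'. vec_C1 J m x x' \<and> (\<forall>t\<in>J. E t *\<^sub>v x' t + F t *\<^sub>v x t = 0\<^sub>v m))"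
  unfolding dae_solution_on_def vec_C1_def by blast

lemma vec_C1D:
  fixes x x' :: "real \<Rightarrow> real vec"
  assumes "vec_C1 J n x x'"
  shows "t \<in> J \<Longrightarrow> x t \<in> carrier_vec n" "t \<in> J \<Longrightarrow> x' t \<in> carrier_vec n"
    "t \<in> J \<Longrightarrow> k < n \<Longrightarrow> ((\<lambda>s. x s $ k) has_real_derivative (x' t $ k)) (at t within J)"
    "k < n \<Longrightarrow> continuous_on J (\<lambda>t. x' t $ k)"
  using assms unfolding vec_C1_def by blast+

lemma vec_C1_unique:
  fixes x x' y y' :: "real \<Rightarrow> real vec"
  assumes J: "real_interval J" and x: "vec_C1 J n x x'" and y: "vec_C1 J n y y'"
    and eq: "\<And>t. t \<in> J \<Longrightarrow> x t = y t" and t: "t \<in> J"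
  shows "x' t = y' t"
proof (rule eq_vecI)
  fix i assume "i < dim_vec (y' t)"
  then have i: "i < n" using vec_C1D(2)[OF y t] by auto
  have "((\<lambda>s. x s $ i) has_real_derivative x' t $ i) (at t within J)"
    by (rule vec_C1D(3)[OF x t i])
  then have "((\<lambda>s. y s $ i) has_real_derivative x' t $ i) (at t within J)"
    by (rule has_real_derivative_cong_on[OF _ t]) (simp add: eq)
  then show "x' t $ i = y' t $ i"
    by (rule real_derivative_unique_within[OF J t _ vec_C1D(3)[OF y t i]])
qed (use vec_C1D(2)[OF x t] vec_C1D(2)[OF y t] in auto)

lemma vec_C1_mult:
  fixes x x' :: "real \<Rightarrow> real vec"
  assumes A: "has_mat_deriv_on J n k A A'" and A0: "mat_Ck 0 J n k A" and A'0: "mat_Ck 0 J n k A'"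
    and x: "vec_C1 J k x x'"
  shows "vec_C1 J n (\<lambda>t. A t *\<^sub>v x t) (\<lambda>t. A' t *\<^sub>v x t + A t *\<^sub>v x' t)"
proof -
  have c: "A t \<in> carrier_mat n k" "A' t \<in> carrier_mat n k" "x t \<in> carrier_vec k" "x' t \<in> carrier_vec k" if "t \<in> J" for t
    using has_mat_deriv_onD(1)[OF A that] mat_Ck_carrier[OF A0 that] vec_C1D(1,2)[OF x that] by auto
  have e: "(A t *\<^sub>v x t) $ i = (\<Sum>l<k. A t $$ (i, l) * x t $ l)"
    "(A' t *\<^sub>v x t + A t *\<^sub>v x' t) $ i = (\<Sum>l<k. A' t $$ (i, l) * x t $ l + x' t $ l * A t $$ (i, l))"
    if "t \<in> J" "i < n" for t i
    using c[OF that(1)] that(2)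
    by (auto simp: scalar_prod_def atLeast0LessThan sum.distrib intro!: sum.cong)
  have xc: "continuous_on J (\<lambda>t. x t $ l)" if "l < k" for l
    using vec_C1D(3)[OF x _ that] by (auto simp: continuous_on_eq_continuous_within intro: DERIV_continuous)
  show ?thesis
    unfolding vec_C1_def
  proof (intro conjI ballI allI impI)
    fix i t assume i: "i < n" and t: "t \<in> J"
    have "((\<lambda>s. \<Sum>l<k. A s $$ (i, l) * x s $ l) has_real_derivative
      (\<Sum>l<k. A' t $$ (i, l) * x t $ l + x' t $ l * A t $$ (i, l))) (at t within J)"
      using has_mat_deriv_onD(2)[OF A t] vec_C1D(3)[OF x t] i by (intro DERIV_sum DERIV_mult) auto
    then show "((\<lambda>s. (A s *\<^sub>v x s) $ i) has_real_derivative (A' t *\<^sub>v x t + A t *\<^sub>v x' t) $ i) (at t within J)"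
      unfolding e(2)[OF t i] by (rule has_real_derivative_cong_on[OF _ t e(1)[OF _ i]])
  next
    fix i assume i: "i < n"
    have "continuous_on J (\<lambda>t. \<Sum>l<k. A' t $$ (i, l) * x t $ l + x' t $ l * A t $$ (i, l))"
      using A0 A'0 vec_C1D(4)[OF x] xc i by (intro continuous_intros) (auto simp: mat_Ck_def)
    then show "continuous_on J (\<lambda>t. (A' t *\<^sub>v x t + A t *\<^sub>v x' t) $ i)"
      using e(2)[OF _ i] continuous_on_cong[OF refl, of J "\<lambda>t. (A' t *\<^sub>v x t + A t *\<^sub>v x' t) $ i"] by simp
  next
    fix t assume "t \<in> J"
    from c[OF this] show "A t *\<^sub>v x t \<in> carrier_vec n" "A' t *\<^sub>v x t + A t *\<^sub>v x' t \<in> carrier_vec n" by auto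
  qed
qed

section \<open>Linear differential equations\<close>

text \<open>The difference of two integrals starting at \<open>a\<close> acts as the oriented
  integral from \<open>t\<close> to \<open>s\<close>, so times on both sides of the initial time are
  covered by one bound.\<close>

lemma indefinite_integral_diff_bound:
  fixes h :: "real \<Rightarrow> real"
  assumes h: "continuous_on {a..b} h" and K: "\<And>s. s \<in> {a..b} \<Longrightarrow> \<bar>h s\<bar> \<le> K"
    and st: "s \<in> {a..b}" "t \<in> {a..b}"
  shows "\<bar>integral {a..s} h - integral {a..t} h\<bar> \<le> K * (b - a)"
proof -
  have le: "\<bar>integral {a..s} h - integral {a..t} h\<bar> \<le> K * (b - a)"
    if "s \<le> t" "s \<in> {a..b}" "t \<in> {a..b}" for s t
  proof -
    have "h integrable_on {a..t}"
      using that by (intro integrable_continuous_interval continuous_on_subset[OF h]) auto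
    then have "integral {a..s} h + integral {s..t} h = integral {a..t} h"
      using that by (intro Henstock_Kurzweil_Integration.integral_combine) auto
    moreover have "norm (integral {s..t} h) \<le> K * (t - s)"
      using that K by (intro integral_bound continuous_on_subset[OF h]) auto
    moreover have "K * (t - s) \<le> K * (b - a)"
      using that K[of s] by (intro mult_left_mono) auto
    ultimately show ?thesis by auto
  qed
  show ?thesis
  proof (cases "s \<le> t")
    case True
    then show ?thesis using le st by blast
  next
    case False
    then show ?thesis using le[of t s] st by (simp add: abs_minus_commute)
  qed
qed

text \<open>The number of components is not a type, so the Picard operator acts on bounded continuous
  functions of \<open>(t, \<rho>)\<close> with the component index extended to a real \<open>\<rho>\<close> by tent functions.\<close>

lemma linear_system_solution_short_interval:
  fixes A :: "real \<Rightarrow> nat \<Rightarrow> nat \<Rightarrow> real" and v :: "nat \<Rightarrow> real"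
  assumes t0: "t0 \<in> {a..b}" and M: "M > 0"
    and A: "\<And>i j. i < d \<Longrightarrow> j < d \<Longrightarrow> continuous_on {a..b} (\<lambda>t. A t i j)"
    and bd: "\<And>i t. i < d \<Longrightarrow> t \<in> {a..b} \<Longrightarrow> (\<Sum>j<d. \<bar>A t i j\<bar>) \<le> M"
    and small: "real d * (M * (b - a)) \<le> 1 / 2"
  obtains y where "\<And>i. i < d \<Longrightarrow> y t0 i = v i"
    and "\<And>i t. i < d \<Longrightarrow> t \<in> {a..b} \<Longrightarrow>
           ((\<lambda>s. y s i) has_real_derivative (\<Sum>j<d. A t i j * y t j)) (at t within {a..b})"
proof -
  have ab: "a \<le> b" using t0 by auto
  \<comment> \<open>Clamping the time to the interval makes the Picard operator produce functions on
    the whole plane, the domain of the bounded continuous functions.\<close>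
  define c where "c t = max a (min b t)" for t :: real
  have c: "c t \<in> {a..b}" for t using ab by (auto simp: c_def)
  have c_id: "t \<in> {a..b} \<Longrightarrow> c t = t" for t by (auto simp: c_def)
  define \<phi> where "\<phi> x = max 0 (1 - \<bar>x\<bar>)" for x :: real
  have \<phi>: "0 \<le> \<phi> x" "\<phi> x \<le> 1" for x by (auto simp: \<phi>_def)
  have \<phi>_nat: "\<phi> (real i - real j) = (if i = j then 1 else 0)" for i j :: nat
    by (auto simp: \<phi>_def)
  define g where "g u i s = (\<Sum>j<d. A s i j * u (s, real j))" for u :: "real \<times> real \<Rightarrow> real" and i s
  define G where "G u i t = integral {a..c t} (g u i) - integral {a..t0} (g u i)" for u i t
  \<comment> \<open>The integral equation for the components, interpolated in the second coordinate.
    At an integer argument the tents select a single component, and \<open>g\<close> reads its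
    argument only there, so a fixed point solves the system.\<close>
  define T0 where "T0 u p = (\<Sum>i<d. \<phi> (snd p - real i) * (v i + G u i (fst p)))" for u and p :: "real \<times> real"
  have g_cont: "continuous_on {a..b} (g u i)" if "continuous_on UNIV u" "i < d" for u i
    unfolding g_def using that A
    by (intro continuous_intros continuous_on_compose2[OF that(1)]) auto
  have g_bound: "\<bar>g u i s\<bar> \<le> M * B" if "\<And>p. \<bar>u p\<bar> \<le> B" "i < d" "s \<in> {a..b}" for u i s B
  proof -
    have "\<bar>g u i s\<bar> \<le> (\<Sum>j<d. \<bar>A s i j\<bar> * B)"
      unfolding g_def using that(1)
      by (intro order_trans[OF sum_abs] sum_mono) (auto simp: abs_mult intro!: mult_left_mono)
    also have "\<dots> = (\<Sum>j<d. \<bar>A s i j\<bar>) * B" by (simp add: sum_distrib_right)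
    \<comment> \<open>\<open>B\<close> is nonnegative because it bounds an absolute value at some
      point, here an arbitrary one.\<close>
    also have "\<dots> \<le> M * B"
      using bd[OF that(2,3)] that(1)[of undefined] by (intro mult_right_mono) auto
    finally show ?thesis .
  qed
  have G_bound: "\<bar>G u i t\<bar> \<le> M * B * (b - a)"
    if "continuous_on UNIV u" "\<And>p. \<bar>u p\<bar> \<le> B" "i < d" for u i t B
    unfolding G_def using g_bound[OF that(2,3)] g_cont[OF that(1,3)] c t0
    by (intro indefinite_integral_diff_bound) auto
  have G_diff: "G u i t - G w i t = G (\<lambda>p. u p - w p) i t"
    if "continuous_on UNIV u" "continuous_on UNIV w" "i < d" for u w i t
  proof -
    have int: "g u i integrable_on {a..s}" "g w i integrable_on {a..s}" if "s \<in> {a..b}" for s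
      using that \<open>continuous_on UNIV u\<close> \<open>continuous_on UNIV w\<close> \<open>i < d\<close>
      by (auto intro!: integrable_continuous_interval continuous_on_subset[OF g_cont])
    have eq: "g (\<lambda>p. u p - w p) i = (\<lambda>s. g u i s - g w i s)"
      by (auto simp: g_def algebra_simps sum_subtractf)
    show ?thesis
      unfolding G_def eq using integral_diff[OF int[OF c]] integral_diff[OF int[OF t0]] by simp
  qed
  have G_cont: "continuous_on UNIV (G u i)" if "continuous_on UNIV u" "i < d" for u i
  proof -
    have "continuous_on {a..b} (\<lambda>x. integral {a..x} (g u i))"
      by (intro indefinite_integral_continuous_1 integrable_continuous_interval g_cont that)
    moreover have "continuous_on UNIV c" unfolding c_def by (intro continuous_intros)
    ultimately have "continuous_on UNIV (\<lambda>t. integral {a..c t} (g u i))"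
      using c by (intro continuous_on_compose2[of "{a..b}" "\<lambda>x. integral {a..x} (g u i)" UNIV c]) auto
    then show ?thesis unfolding G_def by (intro continuous_intros)
  qed
  have T0_bcontfun: "T0 (apply_bcontfun u) \<in> bcontfun" for u :: "(real \<times> real) \<Rightarrow>\<^sub>C real"
  proof (rule bcontfun_normI)
    have "continuous_on UNIV (\<lambda>p::real\<times>real. G (apply_bcontfun u) i (fst p))" if "i < d" for i
      by (rule continuous_on_compose2[OF G_cont[OF _ that]]) (auto intro!: continuous_intros)
    then show "continuous_on UNIV (T0 (apply_bcontfun u))"
      unfolding T0_def \<phi>_def by (intro continuous_intros) auto
    have ub: "\<bar>apply_bcontfun u p\<bar> \<le> norm u" for p
      using norm_bounded[of u p] by simp
    show "norm (T0 (apply_bcontfun u) p) \<le> (\<Sum>i<d. \<bar>v i\<bar> + M * norm u * (b - a))" for p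
      unfolding T0_def real_norm_def
    proof (intro order_trans[OF sum_abs] sum_mono)
      fix i assume "i \<in> {..<d}"
      then have "\<bar>G (apply_bcontfun u) i (fst p)\<bar> \<le> M * norm u * (b - a)"
        using ub by (intro G_bound) auto
      then have le1: "\<bar>v i + G (apply_bcontfun u) i (fst p)\<bar> \<le> \<bar>v i\<bar> + M * norm u * (b - a)" by linarith
      have le2: "\<bar>\<phi> (snd p - real i) * (v i + G (apply_bcontfun u) i (fst p))\<bar>
          \<le> 1 * \<bar>v i + G (apply_bcontfun u) i (fst p)\<bar>"
        using \<phi> unfolding abs_mult by (intro mult_right_mono) auto
      show "\<bar>\<phi> (snd p - real i) * (v i + G (apply_bcontfun u) i (fst p))\<bar>
          \<le> \<bar>v i\<bar> + M * norm u * (b - a)"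
        by (rule order_trans[OF le2[unfolded mult_1_left] le1])
    qed
  qed
  define T where "T u = Bcontfun (T0 (apply_bcontfun u))" for u
  have T: "apply_bcontfun (T u) = T0 (apply_bcontfun u)" for u
    unfolding T_def by (rule Bcontfun_inverse[OF T0_bcontfun])
  have "dist (T u) (T w) \<le> 1 / 2 * dist u w" for u w
  proof (rule dist_bound)
    fix p
    let ?h = "\<lambda>p. apply_bcontfun u p - apply_bcontfun w p"
    have hb: "\<bar>?h p\<bar> \<le> dist u w" for p using dist_bounded[of u p w] by (simp add: dist_real_def)
    have "T0 (apply_bcontfun u) p - T0 (apply_bcontfun w) p = (\<Sum>i<d. \<phi> (snd p - real i) * G ?h i (fst p))"
      unfolding T0_def sum_subtractf[symmetric]
      by (intro sum.cong refl) (simp add: G_diff[symmetric] algebra_simps)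
    \<comment> \<open>Each tent is estimated by 1 separately; summing over all components produces
      the factor \<open>real d\<close> in the hypothesis \<open>small\<close>.\<close>
    also have "\<bar>\<dots>\<bar> \<le> (\<Sum>i<d. M * dist u w * (b - a))"
    proof (intro order_trans[OF sum_abs] sum_mono)
      fix i assume "i \<in> {..<d}"
      then have le1: "\<bar>G ?h i (fst p)\<bar> \<le> M * dist u w * (b - a)"
        using hb by (intro G_bound) (auto intro!: continuous_intros)
      have le2: "\<bar>\<phi> (snd p - real i) * G ?h i (fst p)\<bar> \<le> 1 * \<bar>G ?h i (fst p)\<bar>"
        using \<phi> unfolding abs_mult by (intro mult_right_mono) auto
      show "\<bar>\<phi> (snd p - real i) * G ?h i (fst p)\<bar> \<le> M * dist u w * (b - a)"
        by (rule order_trans[OF le2[unfolded mult_1_left] le1])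
    qed
    also have "\<dots> = real d * (M * (b - a)) * dist u w" by simp
    also have "\<dots> \<le> 1 / 2 * dist u w" by (rule mult_right_mono[OF small]) simp
    finally show "dist (apply_bcontfun (T u) p) (apply_bcontfun (T w) p) \<le> 1 / 2 * dist u w"
      unfolding T dist_real_def .
  qed
  then have "\<exists>!u. T u = u" by (intro banach_fix_type[of "1/2"]) auto
  then obtain u where u: "T u = u" by auto
  define y where "y t i = apply_bcontfun u (t, real i)" for t i
  have y: "y t i = v i + G (apply_bcontfun u) i t" if "i < d" for t i
  proof -
    have "y t i = T0 (apply_bcontfun u) (t, real i)"
      unfolding y_def using T[of u] u by simp
    also have "\<dots> = (\<Sum>k<d. if i = k then v k + G (apply_bcontfun u) k t else 0)"
      unfolding T0_def by (intro sum.cong) (auto simp: \<phi>_nat)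
    also have "\<dots> = v i + G (apply_bcontfun u) i t" using that by simp
    finally show ?thesis .
  qed
  show thesis
  proof
    fix i assume i: "i < d"
    show "y t0 i = v i" using y[OF i] c_id[OF t0] by (simp add: G_def)
    fix t assume t: "t \<in> {a..b}"
    let ?I = "\<lambda>x. v i + (integral {a..x} (g (apply_bcontfun u) i) - integral {a..t0} (g (apply_bcontfun u) i))"
    have "(?I has_real_derivative 0 + (g (apply_bcontfun u) i t - 0)) (at t within {a..b})"
      by (intro DERIV_add DERIV_diff DERIV_const integral_has_real_derivative g_cont i t) auto
    moreover have "y s i = ?I s" if "s \<in> {a..b}" for s
      using y[OF i] c_id[OF that] by (simp add: G_def)
    ultimately have "((\<lambda>s. y s i) has_real_derivative g (apply_bcontfun u) i t) (at t within {a..b})"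
      using t unfolding has_field_derivative_def
      by (intro has_derivative_transform[of t "{a..b}" "\<lambda>s. y s i" ?I]) auto
    then show "((\<lambda>s. y s i) has_real_derivative (\<Sum>j<d. A t i j * y t j)) (at t within {a..b})"
      by (simp add: g_def y_def)
  qed
qed

text \<open>The solution is built on a compact interval inside \<open>I\<close> that must contain
  all points of \<open>I\<close> close to \<open>t0\<close>. On the right this needs an endpoint
  \<open>b\<close> that works whether or not \<open>t0\<close> is the last point of
  \<open>I\<close>.\<close>

lemma interval_right_bound:
  assumes I: "is_interval I" and t0: "t0 \<in> I" and e: "e > (0::real)"
  obtains b \<delta> where "b \<in> I" "t0 \<le> b" "b \<le> t0 + e" "\<delta> > 0" "\<And>t. t \<in> I \<Longrightarrow> t < t0 + \<delta> \<Longrightarrow> t \<le> b"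
proof (cases "\<exists>b\<in>I. t0 < b")
  case True
  then obtain b where b: "b \<in> I" "t0 < b" by auto
  let ?b = "min b (t0 + e)"
  have "?b \<in> I" by (rule mem_is_interval_1_I[OF I t0 b(1)]) (use b e in auto)
  then show ?thesis using b e by (intro that[of ?b "?b - t0"]) auto
next
  case False
  \<comment> \<open>Nothing of \<open>I\<close> lies to the right of \<open>t0\<close>, so any
    positive \<delta> works; 1 is arbitrary.\<close>
  then show ?thesis using t0 e by (intro that[of t0 1]) (auto simp: not_less)
qed

lemma interval_left_bound:
  assumes I: "is_interval I" and t0: "t0 \<in> I" and e: "e > (0::real)"
  obtains a \<delta> where "a \<in> I" "a \<le> t0" "t0 - e \<le> a" "\<delta> > 0" "\<And>t. t \<in> I \<Longrightarrow> t0 - \<delta> < t \<Longrightarrow> a \<le> t"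
proof (cases "\<exists>b\<in>I. b < t0")
  case True
  then obtain b where b: "b \<in> I" "b < t0" by auto
  let ?b = "max b (t0 - e)"
  have "?b \<in> I" by (rule mem_is_interval_1_I[OF I b(1) t0]) (use b e in auto)
  then show ?thesis using b e by (intro that[of ?b "t0 - ?b"]) auto
next
  case False
  then show ?thesis using t0 e by (intro that[of t0 1]) (auto simp: not_less)
qed

text \<open>The flow-subspace asks for solutions on some neighbourhood only, so the time interval is
  shrunk until the Picard operator contracts, and no continuation is required.\<close>

lemma linear_system_local_solution:
  fixes A :: "real \<Rightarrow> nat \<Rightarrow> nat \<Rightarrow> real" and v :: "nat \<Rightarrow> real"
  assumes I: "is_interval I" and t0: "t0 \<in> I"
    and A: "\<And>i j. i < d \<Longrightarrow> j < d \<Longrightarrow> continuous_on I (\<lambda>t. A t i j)"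
  obtains \<delta> y where "\<delta> > 0" "\<And>i. i < d \<Longrightarrow> y t0 i = v i"
    and "\<And>i t. i < d \<Longrightarrow> t \<in> {t0 - \<delta><..<t0 + \<delta>} \<inter> I \<Longrightarrow>
      ((\<lambda>s. y s i) has_real_derivative (\<Sum>j<d. A t i j * y t j)) (at t within {t0 - \<delta><..<t0 + \<delta>} \<inter> I)"
proof -
  have "\<exists>M>0. \<exists>\<epsilon>>0. \<forall>t\<in>I. \<bar>t - t0\<bar> < \<epsilon> \<longrightarrow> (\<forall>i<d. (\<Sum>j<d. \<bar>A t i j\<bar>) \<le> M)"
  proof -
    \<comment> \<open>One continuous scalar function dominates every row sum; near \<open>t0\<close>
      it stays below its value at \<open>t0\<close> plus 1.\<close>
    define \<sigma> where "\<sigma> t = (\<Sum>i<d. \<Sum>j<d. \<bar>A t i j\<bar>)" for t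
    have "continuous_on I \<sigma>" unfolding \<sigma>_def using A by (intro continuous_intros) auto
    then have "\<exists>\<epsilon>>0. \<forall>t\<in>I. dist t t0 < \<epsilon> \<longrightarrow> dist (\<sigma> t) (\<sigma> t0) < 1"
      using t0 unfolding continuous_on_iff by (auto dest!: bspec[of _ _ t0] spec[of _ "1::real"])
    then obtain \<epsilon> where \<epsilon>: "\<epsilon> > 0" "\<And>t. t \<in> I \<Longrightarrow> dist t t0 < \<epsilon> \<Longrightarrow> dist (\<sigma> t) (\<sigma> t0) < 1"
      by auto
    have "(\<Sum>j<d. \<bar>A t i j\<bar>) \<le> \<sigma> t0 + 1" if "t \<in> I" "\<bar>t - t0\<bar> < \<epsilon>" "i < d" for t i
    proof -
      have "(\<Sum>j<d. \<bar>A t i j\<bar>) \<le> \<sigma> t"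
        unfolding \<sigma>_def using that by (intro member_le_sum[of i "{..<d}" "\<lambda>i. \<Sum>j<d. \<bar>A t i j\<bar>"]) (auto intro: sum_nonneg)
      also have "\<sigma> t \<le> \<sigma> t0 + 1" using \<epsilon>(2)[of t] that by (auto simp: dist_real_def)
      finally show ?thesis .
    qed
    moreover have "\<sigma> t0 + 1 > 0" unfolding \<sigma>_def by (intro add_nonneg_pos sum_nonneg) auto
    ultimately show ?thesis using \<epsilon>(1) by blast
  qed
  then obtain M \<epsilon> where M: "M > 0" "\<epsilon> > 0"
    "\<And>t i. t \<in> I \<Longrightarrow> \<bar>t - t0\<bar> < \<epsilon> \<Longrightarrow> i < d \<Longrightarrow> (\<Sum>j<d. \<bar>A t i j\<bar>) \<le> M" by blast
  \<comment> \<open>From b - a \<le> 2 e follows d M (b - a) \<le> d / (2 (d + 1)) \<le> 1/2. Using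
    d + 1 keeps the denominator positive for d = 0, and half of \<epsilon> keeps the closed interval
    strictly inside the region where M is a bound.\<close>
  define e where "e = min (\<epsilon> / 2) (1 / (4 * M * (real d + 1)))"
  have e: "e > 0" using M by (auto simp: e_def)
  obtain b \<delta>b where b: "b \<in> I" "t0 \<le> b" "b \<le> t0 + e" "\<delta>b > 0" "\<And>t. t \<in> I \<Longrightarrow> t < t0 + \<delta>b \<Longrightarrow> t \<le> b"
    using interval_right_bound[OF I t0 e] by blast
  obtain a \<delta>a where a: "a \<in> I" "a \<le> t0" "t0 - e \<le> a" "\<delta>a > 0" "\<And>t. t \<in> I \<Longrightarrow> t0 - \<delta>a < t \<Longrightarrow> a \<le> t"
    using interval_left_bound[OF I t0 e] by blast
  have sub: "{a..b} \<subseteq> I" using mem_is_interval_1_I[OF I a(1) b(1)] by auto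
  have "b - a \<le> 2 * e" using a b by linarith
  also have "\<dots> \<le> 2 * (1 / (4 * M * (real d + 1)))" unfolding e_def by (intro mult_left_mono) auto
  finally have ba: "b - a \<le> 1 / (2 * M * (real d + 1))" by simp
  have small: "real d * (M * (b - a)) \<le> 1 / 2"
  proof -
    have "real d * (M * (b - a)) \<le> real d * (M * (1 / (2 * M * (real d + 1))))"
      using ba M by (intro mult_left_mono) auto
    also have "\<dots> = real d / (2 * (real d + 1))" using M(1) by simp
    also have "\<dots> \<le> 1 / 2" by (simp add: field_simps)
    finally show ?thesis .
  qed
  have "\<bar>t - t0\<bar> < \<epsilon>" if "t \<in> {a..b}" for t
    using that a b M unfolding e_def by auto
  then have bd: "\<And>i t. i < d \<Longrightarrow> t \<in> {a..b} \<Longrightarrow> (\<Sum>j<d. \<bar>A t i j\<bar>) \<le> M" using M(3) sub by blast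
  obtain y where y: "\<And>i. i < d \<Longrightarrow> y t0 i = v i"
    "\<And>i t. i < d \<Longrightarrow> t \<in> {a..b} \<Longrightarrow>
           ((\<lambda>s. y s i) has_real_derivative (\<Sum>j<d. A t i j * y t j)) (at t within {a..b})"
  proof (rule linear_system_solution_short_interval[of t0 a b M d A v])
    show "t0 \<in> {a..b}" using a b by auto
    show "continuous_on {a..b} (\<lambda>t. A t i j)" if "i < d" "j < d" for i j
      by (rule continuous_on_subset[OF A[OF that] sub])
  qed (use M(1) bd small in auto)
  let ?\<delta> = "min \<delta>a \<delta>b"
  have J: "{t0 - ?\<delta><..<t0 + ?\<delta>} \<inter> I \<subseteq> {a..b}" using a(5) b(5) by auto
  show ?thesis
  proof (rule that[of ?\<delta> y])
    fix i t assume i: "i < d" and t: "t \<in> {t0 - ?\<delta><..<t0 + ?\<delta>} \<inter> I"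
    show "((\<lambda>s. y s i) has_real_derivative (\<Sum>j<d. A t i j * y t j)) (at t within {t0 - ?\<delta><..<t0 + ?\<delta>} \<inter> I)"
      by (rule DERIV_subset[OF y(2)[OF i] J]) (use t J in blast)
  qed (use a b y in auto)
qed

section \<open>Solutions under a reduction step\<close>

text \<open>One step reduced to what solutions see: \<open>S_space\<close> replaces the kernel
  formed with Z, and the new pair is given by its action on vectors. Of the bases only
  \<open>C\<close> has to be differentiable, since only \<open>C\<close> multiplies an unknown that
  is differentiated.\<close>

definition red_step ::
  "real set \<Rightarrow> nat \<Rightarrow> nat \<Rightarrow> (real \<Rightarrow> real mat) \<Rightarrow> (real \<Rightarrow> real mat) \<Rightarrow> (real \<Rightarrow> real mat) \<Rightarrow>
   (real \<Rightarrow> real mat) \<Rightarrow> (real \<Rightarrow> real mat) \<Rightarrow> (real \<Rightarrow> real mat) \<Rightarrow> (real \<Rightarrow> real mat) \<Rightarrow> bool" where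
  "red_step I p q E F Y C Cd E1 F1 \<longleftrightarrow>
     mat_Ck 1 I p q C \<and> has_mat_deriv_on I p q C Cd \<and>
     (\<forall>t\<in>I. E t \<in> carrier_mat p p \<and> F t \<in> carrier_mat p p \<and>
        full_col p q (Y t) \<and> mat_image (Y t) = mat_image (E t) \<and>
        full_col p q (C t) \<and> mat_image (C t) = S_space (E t) (F t) \<and>
        E1 t \<in> carrier_mat q q \<and> F1 t \<in> carrier_mat q q \<and>
        (\<forall>v\<in>carrier_vec q.
           E1 t *\<^sub>v v = transpose_mat (Y t) *\<^sub>v (E t *\<^sub>v (C t *\<^sub>v v)) \<and>
           F1 t *\<^sub>v v = transpose_mat (Y t) *\<^sub>v (F t *\<^sub>v (C t *\<^sub>v v) + E t *\<^sub>v (Cd t *\<^sub>v v))))"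

lemma red_stepD:
  assumes "red_step I p q E F Y C Cd E1 F1"
  shows "mat_Ck 1 I p q C" "has_mat_deriv_on I p q C Cd"
    "t \<in> I \<Longrightarrow> E t \<in> carrier_mat p p" "t \<in> I \<Longrightarrow> F t \<in> carrier_mat p p"
    "t \<in> I \<Longrightarrow> full_col p q (Y t)" "t \<in> I \<Longrightarrow> mat_image (Y t) = mat_image (E t)"
    "t \<in> I \<Longrightarrow> full_col p q (C t)" "t \<in> I \<Longrightarrow> mat_image (C t) = S_space (E t) (F t)"
    "t \<in> I \<Longrightarrow> E1 t \<in> carrier_mat q q" "t \<in> I \<Longrightarrow> F1 t \<in> carrier_mat q q"
    "t \<in> I \<Longrightarrow> v \<in> carrier_vec q \<Longrightarrow> E1 t *\<^sub>v v = transpose_mat (Y t) *\<^sub>v (E t *\<^sub>v (C t *\<^sub>v v))"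
    "t \<in> I \<Longrightarrow> v \<in> carrier_vec q \<Longrightarrow>
       F1 t *\<^sub>v v = transpose_mat (Y t) *\<^sub>v (F t *\<^sub>v (C t *\<^sub>v v) + E t *\<^sub>v (Cd t *\<^sub>v v))"
    "t \<in> I \<Longrightarrow> C t \<in> carrier_mat p q" "t \<in> I \<Longrightarrow> Cd t \<in> carrier_mat p q" "t \<in> I \<Longrightarrow> Y t \<in> carrier_mat p q"
  using assms has_mat_deriv_onD(1) full_colD(1) unfolding red_step_def by blast+

lemma S_space_iff:
  assumes "E \<in> carrier_mat p p" "F \<in> carrier_mat p p"
  shows "z \<in> S_space E F \<longleftrightarrow> z \<in> carrier_vec p \<and> F *\<^sub>v z \<in> mat_image E"
  using assms by (auto simp: S_space_def)

lemma mat_imageI: "A \<in> carrier_mat n k \<Longrightarrow> v \<in> carrier_vec k \<Longrightarrow> A *\<^sub>v v \<in> mat_image A"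
  by (auto simp: mat_image_def)

lemma mat_imageE:
  assumes "w \<in> mat_image A" "A \<in> carrier_mat n k"
  obtains v where "v \<in> carrier_vec k" "w = A *\<^sub>v v"
  using assms by (auto simp: mat_image_def)

lemma mat_image_add:
  assumes "A \<in> carrier_mat n k" "v \<in> mat_image A" "w \<in> mat_image A"
  shows "v + w \<in> mat_image A"
  using is_subspace_mat_image[OF assms(1)] assms by (auto simp: is_subspace_def)

lemma mat_image_carrier:
  assumes "A \<in> carrier_mat n k" "v \<in> mat_image A"
  shows "v \<in> carrier_vec n"
  using is_subspace_mat_image[OF assms(1)] assms by (auto simp: is_subspace_def)

text \<open>A vector w of im Y annihilated by Y^T is orthogonal to im Y, hence to itself.\<close>

lemma transpose_injective_on_image:
  assumes Y: "full_col p q Y" and w: "w \<in> mat_image Y" and 0: "transpose_mat Y *\<^sub>v w = 0\<^sub>v q"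
  shows "w = 0\<^sub>v p"
proof -
  have cY: "Y \<in> carrier_mat p q" using Y by (rule full_colD)
  have wc: "w \<in> carrier_vec p" using mat_image_carrier[OF cY w] .
  have "w \<in> orth_compl p (mat_image Y)"
    unfolding orth_compl_mat_image[OF cY] using cY 0 wc by (auto simp: mat_kernel_def)
  then have "scalar_prod w w = 0" using w by (auto simp: orth_compl_def)
  then show ?thesis by (rule scalar_prod_self_eq_0[OF wc])
qed

text \<open>Here w is the residual of the curve x = C y with x' = C' y + C y'. It lies in im E
  because C y lies in S, so F C y does too; on im E = im Y nothing is lost by applying Y^T.\<close>

lemma red_step_residual:
  assumes s: "red_step I p q E F Y C Cd E1 F1" and t: "t \<in> I"
    and y: "y \<in> carrier_vec q" "y' \<in> carrier_vec q"
  defines "w \<equiv> E t *\<^sub>v (Cd t *\<^sub>v y + C t *\<^sub>v y') + F t *\<^sub>v (C t *\<^sub>v y)"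
  shows "E1 t *\<^sub>v y' + F1 t *\<^sub>v y = transpose_mat (Y t) *\<^sub>v w" "w \<in> mat_image (E t)"
proof -
  note d = red_stepD[OF s]
  have c: "E t \<in> carrier_mat p p" "F t \<in> carrier_mat p p" "C t \<in> carrier_mat p q" "Cd t \<in> carrier_mat p q"
    "Y t \<in> carrier_mat p q" using d t by blast+
  define a b e where "a = E t *\<^sub>v (Cd t *\<^sub>v y)" and "b = E t *\<^sub>v (C t *\<^sub>v y')" and "e = F t *\<^sub>v (C t *\<^sub>v y)"
  have cc: "Cd t *\<^sub>v y \<in> carrier_vec p" "C t *\<^sub>v y' \<in> carrier_vec p" "C t *\<^sub>v y \<in> carrier_vec p"
    "a \<in> carrier_vec p" "b \<in> carrier_vec p" "e \<in> carrier_vec p"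
    using c y by (auto simp: a_def b_def e_def)
  have w: "w = (a + b) + e"
    unfolding w_def mult_add_distrib_mat_vec[OF c(1) cc(1,2)] a_def b_def e_def ..
  have "E1 t *\<^sub>v y' + F1 t *\<^sub>v y = transpose_mat (Y t) *\<^sub>v b + transpose_mat (Y t) *\<^sub>v (e + a)"
    using d(11)[OF t y(2)] d(12)[OF t y(1)] by (simp add: a_def b_def e_def)
  also have "\<dots> = transpose_mat (Y t) *\<^sub>v (b + (e + a))"
    using c cc by (intro mult_add_distrib_mat_vec[symmetric, of _ q p]) auto
  also have "b + (e + a) = w"
    unfolding w using cc by (intro eq_vecI) auto
  finally show "E1 t *\<^sub>v y' + F1 t *\<^sub>v y = transpose_mat (Y t) *\<^sub>v w" .
  have "C t *\<^sub>v y \<in> S_space (E t) (F t)" using d(8)[OF t] mat_imageI[OF c(3) y(1)] by simp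
  then have "e \<in> mat_image (E t)" using c by (simp add: S_space_iff e_def)
  moreover have "a \<in> mat_image (E t)" "b \<in> mat_image (E t)"
    unfolding a_def b_def using cc by (auto intro!: mat_imageI[OF c(1)])
  ultimately show "w \<in> mat_image (E t)"
    unfolding w by (intro mat_image_add[OF c(1)])
qed

text \<open>The equation reads F x = E (-x'), which confines every solution to S.\<close>

lemma dae_solution_neg_image:
  assumes E: "E \<in> carrier_mat p p" and F: "F \<in> carrier_mat p p"
    and x: "x \<in> carrier_vec p" "x' \<in> carrier_vec p" and 0: "E *\<^sub>v x' + F *\<^sub>v x = 0\<^sub>v p"
  shows "x \<in> S_space E F"
proof -
  have "F *\<^sub>v x = E *\<^sub>v ((-1) \<cdot>\<^sub>v x')"
  proof (rule eq_vecI)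
    fix i assume "i < dim_vec (E *\<^sub>v ((-1) \<cdot>\<^sub>v x'))"
    then have i: "i < p" using E by auto
    have "(E *\<^sub>v x') $ i + (F *\<^sub>v x) $ i = 0"
      using arg_cong[OF 0, of "\<lambda>v. v $ i"] i E F x by simp
    then show "(F *\<^sub>v x) $ i = (E *\<^sub>v ((-1) \<cdot>\<^sub>v x')) $ i"
      using i E x by (subst mult_mat_vec[of _ p p]) auto
  qed (use E F in auto)
  then show ?thesis using E F x by (auto simp: S_space_iff intro!: mat_imageI)
qed

lemma flow_subspaceI:
  "dae_solution_on ({tb - \<delta><..<tb + \<delta>} \<inter> I) m E F x \<Longrightarrow> \<delta> > 0 \<Longrightarrow> x tb \<in> flow_subspace I m E F tb"
  unfolding flow_subspace_def by blast

lemma flow_subspace_red_step: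
  assumes I: "real_interval I" and s: "red_step I p q E F Y C Cd E1 F1" and tb: "tb \<in> I"
  shows "flow_subspace I p E F tb = (\<lambda>y. C tb *\<^sub>v y) ` flow_subspace I q E1 F1 tb"
proof (intro equalityI subsetI)
  note d = red_stepD[OF s]
  fix z assume "z \<in> flow_subspace I p E F tb"
  then obtain x \<delta> where z: "z = x tb" and \<delta>: "\<delta> > 0"
    and x: "dae_solution_on ({tb - \<delta><..<tb + \<delta>} \<inter> I) p E F x" by (auto simp: flow_subspace_def)
  define J where "J = {tb - \<delta><..<tb + \<delta>} \<inter> I"
  have J: "real_interval J" "J \<subseteq> I" "tb \<in> J"
    unfolding J_def using real_interval_localize[OF I tb \<delta>] tb \<delta> by auto
  obtain x' where x': "vec_C1 J p x x'" and eq: "\<And>t. t \<in> J \<Longrightarrow> E t *\<^sub>v x' t + F t *\<^sub>v x t = 0\<^sub>v p"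
    using x unfolding J_def dae_solution_on_iff by blast
  have C1: "mat_Ck (Suc 0) J p q C" using mat_Ck_subset[OF d(1) J(2)] by simp
  have Cd: "has_mat_deriv_on J p q C Cd" by (rule has_mat_deriv_on_subset[OF d(2) J(2)])
  \<comment> \<open>The curve y must be C^1, not merely a pointwise solution of C y = x; this holds
    because the left inverse of C is as smooth as C.\<close>
  have P: "mat_Ck (Suc 0) J q p (\<lambda>t. pinv (C t))"
    by (rule mat_Ck_pinv[OF C1]) (use d(7) J(2) in blast)
  obtain P' where P': "has_mat_deriv_on J q p (\<lambda>t. pinv (C t)) P'" "mat_Ck 0 J q p P'"
    using mat_Ck_Suc_deriv[OF P] .
  define y where "y t = pinv (C t) *\<^sub>v x t" for t
  define y' where "y' t = P' t *\<^sub>v x t + pinv (C t) *\<^sub>v x' t" for t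
  have yC1: "vec_C1 J q y y'"
    unfolding y_def y'_def by (rule vec_C1_mult[OF P'(1) mat_Ck_le[OF P] P'(2) x']) simp
  have xS: "x t = C t *\<^sub>v y t" if t: "t \<in> J" for t
  proof -
    have tI: "t \<in> I" using t J by auto
    have "x t \<in> S_space (E t) (F t)"
      using dae_solution_neg_image[OF d(3)[OF tI] d(4)[OF tI] vec_C1D(1,2)[OF x' t] eq[OF t]] .
    then have "x t \<in> mat_image (C t)" using d(8)[OF tI] by simp
    from pinv(3)[OF d(7)[OF tI] this] show ?thesis by (simp add: y_def)
  qed
  have Cy: "vec_C1 J p (\<lambda>t. C t *\<^sub>v y t) (\<lambda>t. Cd t *\<^sub>v y t + C t *\<^sub>v y' t)"
    by (rule vec_C1_mult[OF Cd mat_Ck_le[OF C1] mat_Ck_of_deriv[OF J(1) C1 Cd] yC1]) simp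
  have "E1 t *\<^sub>v y' t + F1 t *\<^sub>v y t = 0\<^sub>v q" if t: "t \<in> J" for t
  proof -
    have tI: "t \<in> I" using t J by auto
    \<comment> \<open>The curves x and C y agree on the whole interval, so by uniqueness the
      derivative of x is the one given by the product rule.\<close>
    have "x' t = Cd t *\<^sub>v y t + C t *\<^sub>v y' t"
      by (rule vec_C1_unique[OF J(1) x' Cy xS t])
    then have "E1 t *\<^sub>v y' t + F1 t *\<^sub>v y t = transpose_mat (Y t) *\<^sub>v (E t *\<^sub>v x' t + F t *\<^sub>v x t)"
      using red_step_residual(1)[OF s tI vec_C1D(1,2)[OF yC1 t]] xS[OF t] by simp
    also have "\<dots> = 0\<^sub>v q" unfolding eq[OF t] using d(15)[OF tI] by simp
    finally show ?thesis .
  qed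
  with yC1 have "dae_solution_on J q E1 F1 y" unfolding dae_solution_on_iff by blast
  then have "y tb \<in> flow_subspace I q E1 F1 tb" using \<delta> by (auto simp: flow_subspace_def J_def)
  with xS[OF J(3)] z show "z \<in> (\<lambda>y. C tb *\<^sub>v y) ` flow_subspace I q E1 F1 tb" by auto
next
  note d = red_stepD[OF s]
  fix z assume "z \<in> (\<lambda>y. C tb *\<^sub>v y) ` flow_subspace I q E1 F1 tb"
  then obtain y \<delta> where z: "z = C tb *\<^sub>v y tb" and \<delta>: "\<delta> > 0"
    and y: "dae_solution_on ({tb - \<delta><..<tb + \<delta>} \<inter> I) q E1 F1 y" by (auto simp: flow_subspace_def)
  define J where "J = {tb - \<delta><..<tb + \<delta>} \<inter> I"
  have J: "real_interval J" "J \<subseteq> I" "tb \<in> J"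
    unfolding J_def using real_interval_localize[OF I tb \<delta>] tb \<delta> by auto
  obtain y' where yC1: "vec_C1 J q y y'" and eq: "\<And>t. t \<in> J \<Longrightarrow> E1 t *\<^sub>v y' t + F1 t *\<^sub>v y t = 0\<^sub>v q"
    using y unfolding J_def dae_solution_on_iff by blast
  have C1: "mat_Ck (Suc 0) J p q C" using mat_Ck_subset[OF d(1) J(2)] by simp
  have Cd: "has_mat_deriv_on J p q C Cd" by (rule has_mat_deriv_on_subset[OF d(2) J(2)])
  have Cy: "vec_C1 J p (\<lambda>t. C t *\<^sub>v y t) (\<lambda>t. Cd t *\<^sub>v y t + C t *\<^sub>v y' t)"
    by (rule vec_C1_mult[OF Cd mat_Ck_le[OF C1] mat_Ck_of_deriv[OF J(1) C1 Cd] yC1]) simp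
  have "E t *\<^sub>v (Cd t *\<^sub>v y t + C t *\<^sub>v y' t) + F t *\<^sub>v (C t *\<^sub>v y t) = 0\<^sub>v p" if t: "t \<in> J" for t
  proof -
    have tI: "t \<in> I" using t J by auto
    note r = red_step_residual[OF s tI vec_C1D(1,2)[OF yC1 t]]
    show ?thesis
      by (rule transpose_injective_on_image[OF d(5)[OF tI]]) (use r d(6)[OF tI] eq[OF t] in simp_all)
  qed
  with Cy have "dae_solution_on J p E F (\<lambda>t. C t *\<^sub>v y t)" unfolding dae_solution_on_iff by blast
  then show "z \<in> flow_subspace I p E F tb"
    unfolding J_def z by (rule flow_subspaceI) (rule \<delta>)
qed

lemma flow_subspace_nonsingular:
  assumes I: "real_interval I" and E: "mat_Ck 0 I d d E" and F: "mat_Ck 0 I d d F"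
    and det: "\<And>t. t \<in> I \<Longrightarrow> Determinant.det (E t) \<noteq> 0" and tb: "tb \<in> I"
  shows "flow_subspace I d E F tb = carrier_vec d"
proof (intro equalityI subsetI)
  fix z assume "z \<in> flow_subspace I d E F tb"
  then show "z \<in> carrier_vec d" using tb by (auto simp: flow_subspace_def dae_solution_on_def)
next
  fix v :: "real vec" assume v: "v \<in> carrier_vec d"
  \<comment> \<open>Invertibility of E turns the equation into x' = -B x with continuous
    coefficients.\<close>
  define B where "B t = minv (E t) * F t" for t
  have B: "mat_Ck 0 I d d B" unfolding B_def by (rule mat_Ck_mult[OF mat_Ck_minv[OF E det] F])
  have int: "is_interval I" using I by (simp add: real_interval_def)
  have Bc: "continuous_on I (\<lambda>t. - B t $$ (i, j))" if "i < d" "j < d" for i j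
    using B that by (intro continuous_intros) (auto simp: mat_Ck_def)
  obtain \<delta> y where \<delta>: "\<delta> > 0" and y0: "\<And>i. i < d \<Longrightarrow> y tb i = v $ i"
    and yd: "\<And>i t. i < d \<Longrightarrow> t \<in> {tb - \<delta><..<tb + \<delta>} \<inter> I \<Longrightarrow>
      ((\<lambda>s. y s i) has_real_derivative (\<Sum>j<d. - B t $$ (i, j) * y t j)) (at t within {tb - \<delta><..<tb + \<delta>} \<inter> I)"
    using linear_system_local_solution[where A = "\<lambda>t i j. - B t $$ (i, j)" and v = "\<lambda>i. v $ i" and d = d,
        OF int tb Bc] by blast
  define J where "J = {tb - \<delta><..<tb + \<delta>} \<inter> I"
  have J: "J \<subseteq> I" "tb \<in> J" using \<delta> tb by (auto simp: J_def)
  have yd: "\<And>i t. i < d \<Longrightarrow> t \<in> J \<Longrightarrow>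
      ((\<lambda>s. y s i) has_real_derivative (\<Sum>j<d. - B t $$ (i, j) * y t j)) (at t within J)"
    using yd unfolding J_def .
  define x where "x t = vec d (y t)" for t
  define x' where "x' t = vec d (\<lambda>i. \<Sum>j<d. - B t $$ (i, j) * y t j)" for t
  have yc: "continuous_on J (\<lambda>t. y t j)" if "j < d" for j
    using yd[OF that] by (auto simp: continuous_on_eq_continuous_within intro: DERIV_continuous)
  have "vec_C1 J d x x'"
    unfolding vec_C1_def
  proof (intro conjI ballI allI impI)
    fix i t assume "i < d" "t \<in> J"
    then show "((\<lambda>s. x s $ i) has_real_derivative x' t $ i) (at t within J)"
      using yd by (simp add: x_def x'_def)
  next
    fix i assume i: "i < d"
    have "continuous_on J (\<lambda>t. \<Sum>j<d. - B t $$ (i, j) * y t j)"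
      using mat_Ck_subset[OF B J(1)] i yc by (intro continuous_intros) (auto simp: mat_Ck_def)
    then show "continuous_on J (\<lambda>t. x' t $ i)" using i by (simp add: x'_def)
  qed (auto simp: x_def x'_def)
  moreover have "E t *\<^sub>v x' t + F t *\<^sub>v x t = 0\<^sub>v d" if t: "t \<in> J" for t
  proof -
    have tI: "t \<in> I" using t J by auto
    have c: "E t \<in> carrier_mat d d" "F t \<in> carrier_mat d d" "B t \<in> carrier_mat d d"
      using mat_Ck_carrier[OF E tI] mat_Ck_carrier[OF F tI] mat_Ck_carrier[OF B tI] .
    note m = minv[OF c(1) det[OF tI]]
    have x: "x t \<in> carrier_vec d" by (simp add: x_def)
    have Bx: "B t *\<^sub>v x t \<in> carrier_vec d" using c x by auto
    have "x' t = (-1) \<cdot>\<^sub>v (B t *\<^sub>v x t)"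
      using c by (intro eq_vecI) (auto simp: x_def x'_def scalar_prod_def atLeast0LessThan sum_negf)
    then have "E t *\<^sub>v x' t = (-1) \<cdot>\<^sub>v (E t *\<^sub>v (B t *\<^sub>v x t))"
      using mult_mat_vec[OF c(1) Bx] by simp
    also have "E t *\<^sub>v (B t *\<^sub>v x t) = F t *\<^sub>v x t"
    proof -
      have "B t *\<^sub>v x t = minv (E t) *\<^sub>v (F t *\<^sub>v x t)"
        unfolding B_def by (rule assoc_mult_mat_vec[OF m(1) c(2) x])
      moreover have "E t *\<^sub>v (minv (E t) *\<^sub>v (F t *\<^sub>v x t)) = (E t * minv (E t)) *\<^sub>v (F t *\<^sub>v x t)"
        by (rule assoc_mult_mat_vec[symmetric, OF c(1) m(1)]) (use c x in auto)
      ultimately show ?thesis using m(2) c x by simp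
    qed
    finally have "E t *\<^sub>v x' t = (-1) \<cdot>\<^sub>v (F t *\<^sub>v x t)" .
    then show ?thesis using c(2) by (intro eq_vecI) auto
  qed
  ultimately have "dae_solution_on J d E F x" unfolding dae_solution_on_iff by blast
  moreover have "x tb = v" using y0 v by (auto simp: x_def)
  ultimately show "v \<in> flow_subspace I d E F tb"
    using \<delta> unfolding flow_subspace_def J_def by blast
qed

section \<open>Rank formula and independence of the bases\<close>

lemma is_subspace_S_space:
  assumes E: "E \<in> carrier_mat p p" and F: "F \<in> carrier_mat p p"
  shows "is_subspace p (S_space E F)"
proof -
  note im = is_subspace_mat_image[OF E]
  show ?thesis
    unfolding is_subspace_def
  proof (intro conjI ballI allI subsetI)
    fix v w assume "v \<in> S_space E F" "w \<in> S_space E F"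
    then show "v + w \<in> S_space E F"
      using E F im by (auto simp: S_space_iff is_subspace_def mult_add_distrib_mat_vec[OF F])
  next
    fix c v assume "v \<in> S_space E F"
    then show "c \<cdot>\<^sub>v v \<in> S_space E F"
      using E F im by (auto simp: S_space_iff is_subspace_def mult_mat_vec[OF F])
  qed (use E F im in \<open>auto simp: S_space_iff is_subspace_def\<close>)
qed

lemma is_subspace_Int: "is_subspace n V \<Longrightarrow> is_subspace n W \<Longrightarrow> is_subspace n (V \<inter> W)"
  by (auto simp: is_subspace_def)

lemma subspace_dim_eq_0D:
  assumes "is_subspace n W" "subspace_dim n W = 0"
  shows "W = {0\<^sub>v n}"
proof -
  obtain k B where B: "full_col n k B" "mat_image B = W" using subspace_basis_exists[OF assms(1)] .
  then have k: "k = 0" using subspace_dim_full_col assms(2) by fastforce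
  have "B *\<^sub>v v = 0\<^sub>v n" if "v \<in> carrier_vec 0" for v
    using B(1) that k by (intro eq_vecI) (auto simp: full_col_def scalar_prod_def)
  then have "W \<subseteq> {0\<^sub>v n}" using B k by (auto simp: full_col_def mat_image_def)
  then show ?thesis using assms(1) by (auto simp: is_subspace_def)
qed

text \<open>C maps the kernel of the new E bijectively onto S \<inter> ker E: C is injective with
  image S, and Y^T annihilates only 0 in im E. Rank-nullity for the new E then gives the rank
  formula, stated as a sum to avoid truncated subtraction.\<close>

lemma red_step_rank:
  assumes s: "red_step I p q E F Y C Cd E1 F1" and t: "t \<in> I"
  shows "vec_space.rank p (E t) = q"
    and "vec_space.rank q (E1 t) + subspace_dim p (S_space (E t) (F t) \<inter> mat_kernel (E t)) = q"
    and "S_space (E t) (F t) \<inter> mat_kernel (E t) = (\<lambda>v. C t *\<^sub>v v) ` mat_kernel (E1 t)"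
proof -
  note d = red_stepD[OF s]
  have c: "E t \<in> carrier_mat p p" "F t \<in> carrier_mat p p" "C t \<in> carrier_mat p q"
    "Y t \<in> carrier_mat p q" "E1 t \<in> carrier_mat q q" using d t by blast+
  show "vec_space.rank p (E t) = q"
    using rank_eq_subspace_dim[OF c(1)] subspace_dim_full_col[OF d(5)[OF t]] d(6)[OF t] by simp
  show eq: "S_space (E t) (F t) \<inter> mat_kernel (E t) = (\<lambda>v. C t *\<^sub>v v) ` mat_kernel (E1 t)"
  proof (intro equalityI subsetI)
    fix z assume z: "z \<in> S_space (E t) (F t) \<inter> mat_kernel (E t)"
    then have "z \<in> mat_image (C t)" using d(8)[OF t] by simp
    then obtain v where v: "v \<in> carrier_vec q" "z = C t *\<^sub>v v" using c(3) by (rule mat_imageE)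
    have "E t *\<^sub>v z = 0\<^sub>v p" using z mat_kernelD[OF c(1)] by auto
    then have "E1 t *\<^sub>v v = 0\<^sub>v q" using d(11)[OF t v(1)] v(2) c(4) by simp
    then have "v \<in> mat_kernel (E1 t)" by (rule mat_kernelI[OF c(5) v(1)])
    then show "z \<in> (\<lambda>v. C t *\<^sub>v v) ` mat_kernel (E1 t)" using v(2) by blast
  next
    fix z assume "z \<in> (\<lambda>v. C t *\<^sub>v v) ` mat_kernel (E1 t)"
    then obtain v where v: "v \<in> carrier_vec q" "z = C t *\<^sub>v v" "E1 t *\<^sub>v v = 0\<^sub>v q"
      using mat_kernelD[OF c(5)] by auto
    have zc: "z \<in> carrier_vec p" using v c by auto
    have "E t *\<^sub>v z = 0\<^sub>v p"
      by (rule transpose_injective_on_image[OF d(5)[OF t]])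
         (use d(6)[OF t] d(11)[OF t v(1)] v mat_imageI[OF c(1) zc] in simp_all)
    then have "z \<in> mat_kernel (E t)" by (rule mat_kernelI[OF c(1) zc])
    moreover have "z \<in> S_space (E t) (F t)" using d(8)[OF t] mat_imageI[OF c(3) v(1)] v(2) by simp
    ultimately show "z \<in> S_space (E t) (F t) \<inter> mat_kernel (E t)" by blast
  qed
  show "vec_space.rank q (E1 t) + subspace_dim p (S_space (E t) (F t) \<inter> mat_kernel (E t)) = q"
    unfolding eq subspace_dim_injective_image[OF d(7)[OF t] is_subspace_mat_kernel[OF c(5)]]
      rank_eq_subspace_dim[OF c(5)] by (rule rank_nullity_mat[OF c(5)])
qed

lemma red_step_nonsingular:
  assumes s: "red_step I p q E F Y C Cd E1 F1" and t: "t \<in> I"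
    and 0: "subspace_dim p (S_space (E t) (F t) \<inter> mat_kernel (E t)) = 0"
  shows "Determinant.det (E1 t) \<noteq> 0"
proof -
  note d = red_stepD[OF s]
  have c: "E1 t \<in> carrier_mat q q" using d t by blast
  have "subspace_dim q (mat_kernel (E1 t)) = 0"
    using 0 subspace_dim_injective_image[OF d(7)[OF t] is_subspace_mat_kernel[OF c]] red_step_rank(3)[OF s t] by simp
  from subspace_dim_eq_0D[OF is_subspace_mat_kernel[OF c] this] have "full_col q q (E1 t)"
    using c by (auto simp: full_col_def mat_kernel_def)
  then show ?thesis using full_col_square_iff[OF c] by simp
qed

section \<open>Equivalent pairs and their reductions\<close>

text \<open>The pair \<open>{E', F'}\<close> arises from \<open>{E, F}\<close> by premultiplication with \<open>L\<close> and the change of variables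
  \<open>x = K z\<close>; \<open>L\<close> need not depend smoothly on \<open>t\<close>.\<close>

definition equiv_pair ::
  "real set \<Rightarrow> nat \<Rightarrow> (real \<Rightarrow> real mat) \<Rightarrow> (real \<Rightarrow> real mat) \<Rightarrow> (real \<Rightarrow> real mat) \<Rightarrow> (real \<Rightarrow> real mat) \<Rightarrow> bool" where
  "equiv_pair I p E F E' F' \<longleftrightarrow>
     (\<exists>K Kd. mat_Ck 1 I p p K \<and> has_mat_deriv_on I p p K Kd \<and>
        (\<forall>t\<in>I. E' t \<in> carrier_mat p p \<and> F' t \<in> carrier_mat p p \<and> Determinant.det (K t) \<noteq> 0 \<and>
           (\<exists>L\<in>carrier_mat p p. Determinant.det L \<noteq> 0 \<and>
              (\<forall>v\<in>carrier_vec p. E' t *\<^sub>v v = L *\<^sub>v (E t *\<^sub>v (K t *\<^sub>v v)) \<and>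
                 F' t *\<^sub>v v = L *\<^sub>v (F t *\<^sub>v (K t *\<^sub>v v) + E t *\<^sub>v (Kd t *\<^sub>v v))))))"

text \<open>The term E K' v in the new F lies in im E and so does not affect membership in S. What
  remains is multiplication by the invertible L and K, which carry the spaces of one pair to those
  of the other.\<close>

lemma equiv_pair_spaces:
  assumes E: "E \<in> carrier_mat p p" and F: "F \<in> carrier_mat p p"
    and E': "E' \<in> carrier_mat p p" and F': "F' \<in> carrier_mat p p"
    and K: "K \<in> carrier_mat p p" "Determinant.det K \<noteq> 0" and Kd: "Kd \<in> carrier_mat p p"
    and L: "L \<in> carrier_mat p p" "Determinant.det L \<noteq> 0"
    and eqE: "\<And>v. v \<in> carrier_vec p \<Longrightarrow> E' *\<^sub>v v = L *\<^sub>v (E *\<^sub>v (K *\<^sub>v v))"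
    and eqF: "\<And>v. v \<in> carrier_vec p \<Longrightarrow> F' *\<^sub>v v = L *\<^sub>v (F *\<^sub>v (K *\<^sub>v v) + E *\<^sub>v (Kd *\<^sub>v v))"
  shows "mat_image E' = (\<lambda>w. L *\<^sub>v w) ` mat_image E"
    and "S_space E F = (\<lambda>v. K *\<^sub>v v) ` S_space E' F'"
    and "S_space E F \<inter> mat_kernel E = (\<lambda>v. K *\<^sub>v v) ` (S_space E' F' \<inter> mat_kernel E')"
proof -
  have Kc: "K *\<^sub>v v \<in> carrier_vec p" if "v \<in> carrier_vec p" for v using K that by auto
  note Kinv = minv_mult_vec[OF K]
  have Linj: "v = w" if "L *\<^sub>v v = L *\<^sub>v w" "v \<in> carrier_vec p" "w \<in> carrier_vec p" for v w
    using minv_mult_vec(2)[OF L that(2)] minv_mult_vec(2)[OF L that(3)] that(1) by metis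
  show im: "mat_image E' = (\<lambda>w. L *\<^sub>v w) ` mat_image E"
  proof (intro equalityI subsetI)
    fix w assume "w \<in> mat_image E'"
    then obtain v where v: "v \<in> carrier_vec p" "w = E' *\<^sub>v v" using E' by (rule mat_imageE)
    then show "w \<in> (\<lambda>w. L *\<^sub>v w) ` mat_image E"
      using eqE mat_imageI[OF E Kc[OF v(1)]] by auto
  next
    fix w assume "w \<in> (\<lambda>w. L *\<^sub>v w) ` mat_image E"
    then obtain u where u: "u \<in> mat_image E" "w = L *\<^sub>v u" by blast
    from u(1) E obtain v where v: "v \<in> carrier_vec p" "u = E *\<^sub>v v" by (rule mat_imageE)
    have "E' *\<^sub>v (minv K *\<^sub>v v) = w" using eqE[OF Kinv(3)[OF v(1)]] Kinv(1)[OF v(1)] v u by simp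
    then show "w \<in> mat_image E'" using mat_imageI[OF E' Kinv(3)[OF v(1)]] by simp
  qed
  have S: "v \<in> S_space E' F' \<longleftrightarrow> K *\<^sub>v v \<in> S_space E F" if v: "v \<in> carrier_vec p" for v
  proof -
    define a b where "a = F *\<^sub>v (K *\<^sub>v v)" and "b = E *\<^sub>v (Kd *\<^sub>v v)"
    have ab: "a \<in> carrier_vec p" "b \<in> carrier_vec p" "b \<in> mat_image E"
      using F E Kd Kc[OF v] v by (auto simp: a_def b_def intro!: mat_imageI)
    have "v \<in> S_space E' F' \<longleftrightarrow> L *\<^sub>v (a + b) \<in> (\<lambda>w. L *\<^sub>v w) ` mat_image E"
      using v eqF[OF v] by (simp add: S_space_iff[OF E' F'] im a_def b_def)
    also have "\<dots> \<longleftrightarrow> a + b \<in> mat_image E"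
    proof
      assume "L *\<^sub>v (a + b) \<in> (\<lambda>w. L *\<^sub>v w) ` mat_image E"
      then obtain w where w: "w \<in> mat_image E" "L *\<^sub>v (a + b) = L *\<^sub>v w" by blast
      then have "a + b = w" using Linj ab mat_image_carrier[OF E w(1)] by auto
      with w show "a + b \<in> mat_image E" by simp
    qed blast
    also have "\<dots> \<longleftrightarrow> a \<in> mat_image E"
    proof
      assume "a + b \<in> mat_image E"
      then have "(a + b) - b \<in> mat_image E"
        using is_subspace_diff[OF is_subspace_mat_image[OF E]] ab by blast
      moreover have "(a + b) - b = a" using ab by (intro eq_vecI) auto
      ultimately show "a \<in> mat_image E" by simp
    qed (use mat_image_add[OF E] ab in blast)
    also have "\<dots> \<longleftrightarrow> K *\<^sub>v v \<in> S_space E F" using Kc[OF v] by (simp add: S_space_iff[OF E F] a_def)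
    finally show ?thesis .
  qed
  have surj: "\<exists>v\<in>carrier_vec p. z = K *\<^sub>v v" if "z \<in> carrier_vec p" for z
    using Kinv(1,3)[OF that] by metis
  have Sc: "S_space E F \<subseteq> carrier_vec p" "S_space E' F' \<subseteq> carrier_vec p"
    using F F' by (auto simp: S_space_def)
  show "S_space E F = (\<lambda>v. K *\<^sub>v v) ` S_space E' F'"
  proof (intro equalityI subsetI)
    fix z assume z: "z \<in> S_space E F"
    then obtain v where v: "v \<in> carrier_vec p" "z = K *\<^sub>v v" using surj Sc by blast
    then show "z \<in> (\<lambda>v. K *\<^sub>v v) ` S_space E' F'" using S z by blast
  next
    fix z assume "z \<in> (\<lambda>v. K *\<^sub>v v) ` S_space E' F'"
    then obtain v where v: "v \<in> S_space E' F'" "z = K *\<^sub>v v" by blast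
    moreover have "v \<in> carrier_vec p" using v(1) Sc by blast
    ultimately show "z \<in> S_space E F" using S by simp
  qed
  have k: "v \<in> mat_kernel E' \<longleftrightarrow> K *\<^sub>v v \<in> mat_kernel E" if v: "v \<in> carrier_vec p" for v
  proof -
    have "v \<in> mat_kernel E' \<longleftrightarrow> L *\<^sub>v (E *\<^sub>v (K *\<^sub>v v)) = L *\<^sub>v 0\<^sub>v p"
      using v eqE[OF v] L(1) by (simp add: mat_kernel[OF E'])
    also have "\<dots> \<longleftrightarrow> E *\<^sub>v (K *\<^sub>v v) = 0\<^sub>v p" using Linj[of "E *\<^sub>v (K *\<^sub>v v)" "0\<^sub>v p"] E Kc[OF v] by auto
    also have "\<dots> \<longleftrightarrow> K *\<^sub>v v \<in> mat_kernel E" using Kc[OF v] by (simp add: mat_kernel[OF E])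
    finally show ?thesis .
  qed
  show "S_space E F \<inter> mat_kernel E = (\<lambda>v. K *\<^sub>v v) ` (S_space E' F' \<inter> mat_kernel E')"
  proof (intro equalityI subsetI)
    fix z assume z: "z \<in> S_space E F \<inter> mat_kernel E"
    then obtain v where v: "v \<in> carrier_vec p" "z = K *\<^sub>v v" using surj Sc by blast
    then have "v \<in> S_space E' F' \<inter> mat_kernel E'" using S k z by simp
    then show "z \<in> (\<lambda>v. K *\<^sub>v v) ` (S_space E' F' \<inter> mat_kernel E')" using v by blast
  next
    fix z assume "z \<in> (\<lambda>v. K *\<^sub>v v) ` (S_space E' F' \<inter> mat_kernel E')"
    then obtain v where v: "v \<in> S_space E' F'" "v \<in> mat_kernel E'" "z = K *\<^sub>v v" by blast
    moreover have "v \<in> carrier_vec p" using v(1) Sc by blast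
    ultimately show "z \<in> S_space E F \<inter> mat_kernel E" using S k by simp
  qed
qed

lemma equiv_pair_invariants:
  assumes eq: "equiv_pair I p E F E' F'" and t: "t \<in> I"
    and E: "E t \<in> carrier_mat p p" and F: "F t \<in> carrier_mat p p"
  shows "vec_space.rank p (E' t) = vec_space.rank p (E t)"
    and "subspace_dim p (S_space (E' t) (F' t) \<inter> mat_kernel (E' t)) =
         subspace_dim p (S_space (E t) (F t) \<inter> mat_kernel (E t))"
proof -
  from eq obtain K Kd where K1: "mat_Ck 1 I p p K" and Kd: "has_mat_deriv_on I p p K Kd"
    and r: "\<forall>t\<in>I. E' t \<in> carrier_mat p p \<and> F' t \<in> carrier_mat p p \<and> Determinant.det (K t) \<noteq> 0 \<and>
           (\<exists>L\<in>carrier_mat p p. Determinant.det L \<noteq> 0 \<and>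
              (\<forall>v\<in>carrier_vec p. E' t *\<^sub>v v = L *\<^sub>v (E t *\<^sub>v (K t *\<^sub>v v)) \<and>
                 F' t *\<^sub>v v = L *\<^sub>v (F t *\<^sub>v (K t *\<^sub>v v) + E t *\<^sub>v (Kd t *\<^sub>v v))))"
    unfolding equiv_pair_def by blast
  from bspec[OF r t] obtain L where c: "E' t \<in> carrier_mat p p" "F' t \<in> carrier_mat p p" "Determinant.det (K t) \<noteq> 0"
    and L: "L \<in> carrier_mat p p" "Determinant.det L \<noteq> 0"
    and e: "\<And>v. v \<in> carrier_vec p \<Longrightarrow> E' t *\<^sub>v v = L *\<^sub>v (E t *\<^sub>v (K t *\<^sub>v v))"
      "\<And>v. v \<in> carrier_vec p \<Longrightarrow> F' t *\<^sub>v v = L *\<^sub>v (F t *\<^sub>v (K t *\<^sub>v v) + E t *\<^sub>v (Kd t *\<^sub>v v))"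
    by blast
  have K: "K t \<in> carrier_mat p p" by (rule mat_Ck_carrier[OF K1 t])
  note sp = equiv_pair_spaces[OF E F c(1,2) K c(3) has_mat_deriv_onD(1)[OF Kd t] L e]
  have "full_col p p L" "full_col p p (K t)" using full_col_square_iff L K c(3) by blast+
  then show "vec_space.rank p (E' t) = vec_space.rank p (E t)"
    "subspace_dim p (S_space (E' t) (F' t) \<inter> mat_kernel (E' t)) =
         subspace_dim p (S_space (E t) (F t) \<inter> mat_kernel (E t))"
    using subspace_dim_injective_image[of p p L, OF _ is_subspace_mat_image[OF E]]
      subspace_dim_injective_image[of p p "K t", OF _ is_subspace_Int[OF is_subspace_S_space[OF c(1,2)] is_subspace_mat_kernel[OF c(1)]]]
      sp(1,3) rank_eq_subspace_dim[OF E] rank_eq_subspace_dim[OF c(1)] by simp_all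
qed

text \<open>The reduced size is the rank of E, which is invariant. This must be known before the
  reduced pairs can be compared, as equivalence is stated for pairs of one size.\<close>

lemma equiv_pair_red_step_size:
  assumes I: "real_interval I" and eq: "equiv_pair I p E F E' F'"
    and s: "red_step I p q E F Y C Cd E1 F1" and s': "red_step I p q' E' F' Y' C' Cd' E1' F1'"
  shows "q' = q"
proof -
  obtain t where t: "t \<in> I" using I by (auto simp: real_interval_def)
  show ?thesis
    using equiv_pair_invariants(1)[OF eq t red_stepD(3)[OF s t] red_stepD(4)[OF s t]]
      red_step_rank(1)[OF s t] red_step_rank(1)[OF s' t] by simp
qed

text \<open>Supplies the left factor at the next level. On im Y the map Y^T is a bijection with
  inverse Y (Y^T Y)^(-1), which forces M = Y'^T L Y (Y^T Y)^(-1). Agreement on im Y suffices because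
  residuals lie there.\<close>

lemma image_transfer_matrix:
  assumes Y: "full_col p q Y" and Y': "full_col p q Y'" and L: "L \<in> carrier_mat p p" "Determinant.det L \<noteq> 0"
    and im: "mat_image Y' = (\<lambda>w. L *\<^sub>v w) ` mat_image Y"
  obtains M where "M \<in> carrier_mat q q" "Determinant.det M \<noteq> 0"
    "\<And>w. w \<in> mat_image Y \<Longrightarrow> M *\<^sub>v (transpose_mat Y *\<^sub>v w) = transpose_mat Y' *\<^sub>v (L *\<^sub>v w)"
proof -
  have c: "Y \<in> carrier_mat p q" "Y' \<in> carrier_mat p q" using Y Y' by (auto dest: full_colD)
  define G where "G = transpose_mat Y * Y"
  have G: "G \<in> carrier_mat q q" "Determinant.det G \<noteq> 0"
    using c Y gram_det_nonzero_iff[OF c(1)] by (auto simp: G_def)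
  define M where "M = transpose_mat Y' * (L * (Y * minv G))"
  have m: "minv G \<in> carrier_mat q q" using minv(1)[OF G] .
  have c2: "Y * minv G \<in> carrier_mat p q" "L * (Y * minv G) \<in> carrier_mat p q" using c m L by auto
  have M: "M \<in> carrier_mat q q" using c c2 by (simp add: M_def)
  have MG: "M *\<^sub>v (G *\<^sub>v u) = transpose_mat Y' *\<^sub>v (L *\<^sub>v (Y *\<^sub>v u))" if u: "u \<in> carrier_vec q" for u
  proof -
    have Gu: "G *\<^sub>v u \<in> carrier_vec q" using G u by auto
    have "M *\<^sub>v (G *\<^sub>v u) = transpose_mat Y' *\<^sub>v (L *\<^sub>v (Y *\<^sub>v (minv G *\<^sub>v (G *\<^sub>v u))))"
      unfolding M_def using c c2 L m Gu
      by (simp add: assoc_mult_mat_vec[of _ q p _ q] assoc_mult_mat_vec[of _ p p _ q] assoc_mult_mat_vec[of _ p q _ q])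
    then show ?thesis using minv_mult_vec(2)[OF G u] by simp
  qed
  have YY: "transpose_mat Y *\<^sub>v (Y *\<^sub>v u) = G *\<^sub>v u" if "u \<in> carrier_vec q" for u
    unfolding G_def using c that by (intro assoc_mult_mat_vec[symmetric]) auto
  \<comment> \<open>If M v = 0, write v = G u. Then L Y u lies in im Y' and is annihilated by Y'^T,
    so it vanishes, and u = 0 by injectivity of L and Y.\<close>
  have "full_col q q M"
    unfolding full_col_def
  proof (intro conjI ballI impI M)
    fix v assume v: "v \<in> carrier_vec q" "M *\<^sub>v v = 0\<^sub>v q"
    define u where "u = minv G *\<^sub>v v"
    have u: "u \<in> carrier_vec q" "G *\<^sub>v u = v" using minv_mult_vec[OF G v(1)] by (auto simp: u_def)
    have "Y *\<^sub>v u \<in> mat_image Y" by (rule mat_imageI[OF c(1) u(1)])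
    then have "L *\<^sub>v (Y *\<^sub>v u) \<in> mat_image Y'" using im by blast
    then have LYu: "L *\<^sub>v (Y *\<^sub>v u) = 0\<^sub>v p"
      by (rule transpose_injective_on_image[OF Y']) (use MG[OF u(1)] u v in simp)
    have "full_col p p L" using full_col_square_iff[OF L(1)] L(2) by simp
    from full_colD(2)[OF this mult_mat_vec_carrier[OF c(1) u(1)] LYu] have "u = 0\<^sub>v q"
      by (rule full_colD(2)[OF Y u(1)])
    then show "v = 0\<^sub>v q" using u(2) G(1) by simp
  qed
  then have "Determinant.det M \<noteq> 0" using full_col_square_iff[OF M] by simp
  moreover have "M *\<^sub>v (transpose_mat Y *\<^sub>v w) = transpose_mat Y' *\<^sub>v (L *\<^sub>v w)" if "w \<in> mat_image Y" for w
  proof -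
    from that c(1) obtain u where u: "u \<in> carrier_vec q" "w = Y *\<^sub>v u" by (rule mat_imageE)
    then show ?thesis using MG YY by simp
  qed
  ultimately show thesis using that M by blast
qed

text \<open>Since K maps S' = im C' onto S = im C, there is an invertible N with K C' = C N, the
  change of variables one level down. Differentiating this identity matches the derivative terms of
  the two reduced pairs; the left factor comes from \<open>image_transfer_matrix\<close>.\<close>

lemma equiv_pair_red_step:
  assumes I: "real_interval I" and eq: "equiv_pair I p E F E' F'"
    and s: "red_step I p q E F Y C Cd E1 F1" and s': "red_step I p q E' F' Y' C' Cd' E1' F1'"
  shows "equiv_pair I q E1 F1 E1' F1'"
proof -
  note d = red_stepD[OF s] and d' = red_stepD[OF s']
  from eq obtain K Kd where K1: "mat_Ck 1 I p p K" and Kd: "has_mat_deriv_on I p p K Kd"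
    and r: "\<forall>t\<in>I. E' t \<in> carrier_mat p p \<and> F' t \<in> carrier_mat p p \<and> Determinant.det (K t) \<noteq> 0 \<and>
           (\<exists>L\<in>carrier_mat p p. Determinant.det L \<noteq> 0 \<and>
              (\<forall>v\<in>carrier_vec p. E' t *\<^sub>v v = L *\<^sub>v (E t *\<^sub>v (K t *\<^sub>v v)) \<and>
                 F' t *\<^sub>v v = L *\<^sub>v (F t *\<^sub>v (K t *\<^sub>v v) + E t *\<^sub>v (Kd t *\<^sub>v v))))"
    unfolding equiv_pair_def by blast
  have "\<forall>t\<in>I. \<exists>L. L \<in> carrier_mat p p \<and> Determinant.det L \<noteq> 0 \<and>
              (\<forall>v\<in>carrier_vec p. E' t *\<^sub>v v = L *\<^sub>v (E t *\<^sub>v (K t *\<^sub>v v)) \<and>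
                 F' t *\<^sub>v v = L *\<^sub>v (F t *\<^sub>v (K t *\<^sub>v v) + E t *\<^sub>v (Kd t *\<^sub>v v)))"
    using r by blast
  from bchoice[OF this] obtain L where L: "\<And>t. t \<in> I \<Longrightarrow> L t \<in> carrier_mat p p"
    "\<And>t. t \<in> I \<Longrightarrow> Determinant.det (L t) \<noteq> 0"
    and eE: "\<And>t v. t \<in> I \<Longrightarrow> v \<in> carrier_vec p \<Longrightarrow> E' t *\<^sub>v v = L t *\<^sub>v (E t *\<^sub>v (K t *\<^sub>v v))"
    and eF: "\<And>t v. t \<in> I \<Longrightarrow> v \<in> carrier_vec p \<Longrightarrow>
      F' t *\<^sub>v v = L t *\<^sub>v (F t *\<^sub>v (K t *\<^sub>v v) + E t *\<^sub>v (Kd t *\<^sub>v v))" by blast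
  have detK: "\<And>t. t \<in> I \<Longrightarrow> Determinant.det (K t) \<noteq> 0" using r by blast
  have cK: "\<And>t. t \<in> I \<Longrightarrow> K t \<in> carrier_mat p p" by (rule mat_Ck_carrier[OF K1])
  have cKd: "\<And>t. t \<in> I \<Longrightarrow> Kd t \<in> carrier_mat p p" by (rule has_mat_deriv_onD(1)[OF Kd])
  have sp: "mat_image (E' t) = (\<lambda>w. L t *\<^sub>v w) ` mat_image (E t)"
    "S_space (E t) (F t) = (\<lambda>v. K t *\<^sub>v v) ` S_space (E' t) (F' t)" if t: "t \<in> I" for t
    using equiv_pair_spaces(1,2)[OF d(3)[OF t] d(4)[OF t] d'(3)[OF t] d'(4)[OF t] cK[OF t] detK[OF t] cKd[OF t]
        L(1)[OF t] L(2)[OF t] eE[OF t] eF[OF t]] by blast+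
  define N where "N t = pinv (C t) * (K t * C' t)" for t
  have N1: "mat_Ck (Suc 0) I q q N"
    unfolding N_def using mat_Ck_mult[OF mat_Ck_pinv[OF d(1) d(7)] mat_Ck_mult[OF K1 d'(1)]] by simp
  have cN: "\<And>t. t \<in> I \<Longrightarrow> N t \<in> carrier_mat q q" by (rule mat_Ck_carrier[OF N1])
  obtain Nd where Nd: "has_mat_deriv_on I q q N Nd" using mat_Ck_Suc_deriv[OF N1] by blast
  have cNd: "\<And>t. t \<in> I \<Longrightarrow> Nd t \<in> carrier_mat q q" by (rule has_mat_deriv_onD(1)[OF Nd])
  have KC: "K t * C' t = C t * N t" if t: "t \<in> I" for t
    unfolding N_def
  proof (rule factor_through[OF d(7)[OF t]])
    show "K t * C' t \<in> carrier_mat p q" using cK[OF t] d'(13)[OF t] by auto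
    have "mat_image (K t * C' t) = (\<lambda>v. K t *\<^sub>v v) ` S_space (E' t) (F' t)"
      using mat_image_mult[OF cK[OF t] d'(13)[OF t]] d'(8)[OF t] by simp
    then show "mat_image (K t * C' t) \<subseteq> mat_image (C t)"
      using sp(2)[OF t] d(8)[OF t] by simp
  qed
  have detN: "Determinant.det (N t) \<noteq> 0" if t: "t \<in> I" for t
  proof -
    have "full_col p p (K t)" using full_col_square_iff[OF cK[OF t]] detK[OF t] by simp
    from full_col_mult[OF this d'(7)[OF t]] have "full_col q q (N t)"
      by (rule full_col_factor[OF _ d(13)[OF t] cN[OF t] KC[OF t]])
    then show ?thesis using full_col_square_iff[OF cN[OF t]] by simp
  qed
  \<comment> \<open>Both sides are product-rule derivatives of the same matrix function
    \<open>K C' = C N\<close>.\<close>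
  have deriv_eq: "Kd t * C' t + K t * Cd' t = Cd t * N t + C t * Nd t" if t: "t \<in> I" for t
    by (rule has_mat_deriv_on_unique[OF I has_mat_deriv_on_mult[OF Kd d'(2) cK d'(13)]
          has_mat_deriv_on_mult[OF d(2) Nd d(13) cN] KC t])
  show ?thesis
    unfolding equiv_pair_def
  proof (rule exI[of _ N], rule exI[of _ Nd], intro conjI ballI)
    show "mat_Ck 1 I q q N" using N1 by simp
    show "has_mat_deriv_on I q q N Nd" by (rule Nd)
    fix t assume t: "t \<in> I"
    show "E1' t \<in> carrier_mat q q" "F1' t \<in> carrier_mat q q" using d'(9,10)[OF t] .
    show "Determinant.det (N t) \<noteq> 0" by (rule detN[OF t])
    have c: "E t \<in> carrier_mat p p" "F t \<in> carrier_mat p p" "C t \<in> carrier_mat p q" "Cd t \<in> carrier_mat p q"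
      "C' t \<in> carrier_mat p q" "Cd' t \<in> carrier_mat p q" "N t \<in> carrier_mat q q" "Nd t \<in> carrier_mat q q"
      "K t \<in> carrier_mat p p" "Kd t \<in> carrier_mat p p" "L t \<in> carrier_mat p p"
      "E1 t \<in> carrier_mat q q" "F1 t \<in> carrier_mat q q"
      using d(3,4,13,14,9,10)[OF t] d'(13,14)[OF t] cN[OF t] cNd[OF t] cK[OF t] cKd[OF t] L(1)[OF t] by blast+
    have "mat_image (Y' t) = (\<lambda>w. L t *\<^sub>v w) ` mat_image (Y t)"
      using sp(1)[OF t] d(6)[OF t] d'(6)[OF t] by simp
    from image_transfer_matrix[OF d(5)[OF t] d'(5)[OF t] L(1)[OF t] L(2)[OF t] this] obtain M where
      M: "M \<in> carrier_mat q q" "Determinant.det M \<noteq> 0"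
      and MY: "\<And>w. w \<in> mat_image (E t) \<Longrightarrow>
        M *\<^sub>v (transpose_mat (Y t) *\<^sub>v w) = transpose_mat (Y' t) *\<^sub>v (L t *\<^sub>v w)"
      unfolding d(6)[OF t] by blast
    show "\<exists>L\<in>carrier_mat q q. Determinant.det L \<noteq> 0 \<and>
        (\<forall>v\<in>carrier_vec q. E1' t *\<^sub>v v = L *\<^sub>v (E1 t *\<^sub>v (N t *\<^sub>v v)) \<and>
           F1' t *\<^sub>v v = L *\<^sub>v (F1 t *\<^sub>v (N t *\<^sub>v v) + E1 t *\<^sub>v (Nd t *\<^sub>v v)))"
    proof (intro bexI[of _ M] conjI ballI M)
      fix v :: "real vec" assume v: "v \<in> carrier_vec q"
      define y y' where "y = N t *\<^sub>v v" and "y' = Nd t *\<^sub>v v"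
      have y: "y \<in> carrier_vec q" "y' \<in> carrier_vec q" using c v by (auto simp: y_def y'_def)
      have C'v: "C' t *\<^sub>v v \<in> carrier_vec p" "Cd' t *\<^sub>v v \<in> carrier_vec p" using c v by auto
      have KCv: "K t *\<^sub>v (C' t *\<^sub>v v) = C t *\<^sub>v y"
        using arg_cong[OF KC[OF t], of "\<lambda>A. A *\<^sub>v v"] assoc_mult_mat_vec[OF c(9,5) v] assoc_mult_mat_vec[OF c(3,7) v]
        by (simp add: y_def)
      have cy: "C t *\<^sub>v y \<in> carrier_vec p" "C t *\<^sub>v y' \<in> carrier_vec p" "Cd t *\<^sub>v y \<in> carrier_vec p" using c y by auto
      have ECy: "E t *\<^sub>v (C t *\<^sub>v y) \<in> mat_image (E t)" by (rule mat_imageI[OF c(1) cy(1)])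
      show "E1' t *\<^sub>v v = M *\<^sub>v (E1 t *\<^sub>v (N t *\<^sub>v v))"
        using d'(11)[OF t v] eE[OF t C'v(1)] KCv MY[OF ECy] d(11)[OF t y(1)] by (simp add: y_def)
      have dv: "Kd t *\<^sub>v (C' t *\<^sub>v v) + K t *\<^sub>v (Cd' t *\<^sub>v v) = Cd t *\<^sub>v y + C t *\<^sub>v y'"
      proof -
        have "(Kd t * C' t + K t * Cd' t) *\<^sub>v v = Kd t *\<^sub>v (C' t *\<^sub>v v) + K t *\<^sub>v (Cd' t *\<^sub>v v)"
          using add_mult_distrib_mat_vec[OF mult_carrier_mat[OF c(10,5)] mult_carrier_mat[OF c(9,6)] v]
            assoc_mult_mat_vec[OF c(10,5) v] assoc_mult_mat_vec[OF c(9,6) v] by simp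
        moreover have "(Cd t * N t + C t * Nd t) *\<^sub>v v = Cd t *\<^sub>v y + C t *\<^sub>v y'"
          using add_mult_distrib_mat_vec[OF mult_carrier_mat[OF c(4,7)] mult_carrier_mat[OF c(3,8)] v]
            assoc_mult_mat_vec[OF c(4,7) v] assoc_mult_mat_vec[OF c(3,8) v] by (simp add: y_def y'_def)
        ultimately show ?thesis using deriv_eq[OF t] by simp
      qed
      define a b e where "a = E t *\<^sub>v (Kd t *\<^sub>v (C' t *\<^sub>v v))" and "b = E t *\<^sub>v (K t *\<^sub>v (Cd' t *\<^sub>v v))"
        and "e = F t *\<^sub>v (C t *\<^sub>v y)"
      have kc: "Kd t *\<^sub>v (C' t *\<^sub>v v) \<in> carrier_vec p" "K t *\<^sub>v (Cd' t *\<^sub>v v) \<in> carrier_vec p"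
        using c C'v by auto
      have ab: "a \<in> carrier_vec p" "b \<in> carrier_vec p" "e \<in> carrier_vec p"
        using c kc cy by (auto simp: a_def b_def e_def)
      \<comment> \<open>By the differentiated identity, L w is the vector to which Y'^T is applied
        in F1' v. At the same time w is the residual belonging to y = N v and y' = N' v, so it lies
        in im E, where M is known to transfer.\<close>
      define w where "w = E t *\<^sub>v (Cd t *\<^sub>v y + C t *\<^sub>v y') + F t *\<^sub>v (C t *\<^sub>v y)"
      note res = red_step_residual[OF s t y, folded w_def]
      have "w = (a + b) + e"
        unfolding w_def dv[symmetric] mult_add_distrib_mat_vec[OF c(1) kc] a_def b_def e_def ..
      also have "\<dots> = (e + a) + b" using ab by (intro eq_vecI) auto
      finally have w: "w = (e + a) + b" .
      have "F1' t *\<^sub>v v = transpose_mat (Y' t) *\<^sub>v (L t *\<^sub>v (e + a) + L t *\<^sub>v b)"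
        unfolding d'(12)[OF t v] eF[OF t C'v(1)] eE[OF t C'v(2)] KCv a_def b_def e_def ..
      also have "L t *\<^sub>v (e + a) + L t *\<^sub>v b = L t *\<^sub>v w"
        unfolding w by (rule mult_add_distrib_mat_vec[symmetric, OF c(11)]) (use ab in auto)
      also have "transpose_mat (Y' t) *\<^sub>v (L t *\<^sub>v w) = M *\<^sub>v (E1 t *\<^sub>v y' + F1 t *\<^sub>v y)"
        using MY[OF res(2)] res(1) by simp
      also have "E1 t *\<^sub>v y' + F1 t *\<^sub>v y = F1 t *\<^sub>v y + E1 t *\<^sub>v y'"
        using c y by (intro comm_add_vec[of _ q]) auto
      finally show "F1' t *\<^sub>v v = M *\<^sub>v (F1 t *\<^sub>v (N t *\<^sub>v v) + E1 t *\<^sub>v (Nd t *\<^sub>v v))"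
        unfolding y_def y'_def .
    qed
  qed
qed

lemma equiv_pair_refl:
  assumes E: "\<And>t. t \<in> I \<Longrightarrow> E t \<in> carrier_mat p p" and F: "\<And>t. t \<in> I \<Longrightarrow> F t \<in> carrier_mat p p"
  shows "equiv_pair I p E F E F"
  unfolding equiv_pair_def
proof (rule exI[of _ "\<lambda>t. 1\<^sub>m p"], rule exI[of _ "\<lambda>t. 0\<^sub>m p p"], intro conjI ballI)
  show "mat_Ck 1 I p p (\<lambda>t. 1\<^sub>m p)" by (rule mat_Ck_const) simp
  show "has_mat_deriv_on I p p (\<lambda>t. 1\<^sub>m p) (\<lambda>t. 0\<^sub>m p p)" by (auto simp: has_mat_deriv_on_def)
  fix t assume t: "t \<in> I"
  show "E t \<in> carrier_mat p p" "F t \<in> carrier_mat p p" using E F t by auto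
  show "Determinant.det (1\<^sub>m p) \<noteq> (0::real)" by simp
  show "\<exists>L\<in>carrier_mat p p. Determinant.det L \<noteq> 0 \<and>
          (\<forall>v\<in>carrier_vec p. E t *\<^sub>v v = L *\<^sub>v (E t *\<^sub>v (1\<^sub>m p *\<^sub>v v)) \<and>
             F t *\<^sub>v v = L *\<^sub>v (F t *\<^sub>v (1\<^sub>m p *\<^sub>v v) + E t *\<^sub>v (0\<^sub>m p p *\<^sub>v v)))"
  proof (intro bexI[of _ "1\<^sub>m p"] conjI ballI)
    fix v :: "real vec" assume v: "v \<in> carrier_vec p"
    have "E t *\<^sub>v v \<in> carrier_vec p" "F t *\<^sub>v v \<in> carrier_vec p" using E[OF t] F[OF t] v by auto
    moreover have "0\<^sub>m p p *\<^sub>v v = 0\<^sub>v p" using v by auto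
    ultimately show "E t *\<^sub>v v = 1\<^sub>m p *\<^sub>v (E t *\<^sub>v (1\<^sub>m p *\<^sub>v v))"
      "F t *\<^sub>v v = 1\<^sub>m p *\<^sub>v (F t *\<^sub>v (1\<^sub>m p *\<^sub>v v) + E t *\<^sub>v (0\<^sub>m p p *\<^sub>v v))"
      using v E[OF t] by simp_all
  qed simp_all
qed

section \<open>Local bases\<close>

lemma full_col_open:
  assumes A: "mat_Ck k I n l A" and t0: "t0 \<in> I" and f: "full_col n l (A t0)"
  obtains \<delta> where "\<delta> > 0" "\<And>t. t \<in> {t0 - \<delta><..<t0 + \<delta>} \<inter> I \<Longrightarrow> full_col n l (A t)"
proof -
  define g where "g t = Determinant.det (transpose_mat (A t) * A t)" for t
  have "Ck_on k I g" unfolding g_def by (rule Ck_on_det[OF mat_Ck_mult[OF mat_Ck_transpose[OF A] A]])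
  from Ck_on_le[OF this, of 0] have "continuous_on I g" by simp
  moreover have "g t0 \<noteq> 0" unfolding g_def using gram_det_nonzero_iff[OF mat_Ck_carrier[OF A t0]] f by simp
  ultimately obtain \<delta> where \<delta>: "\<delta> > 0" "\<And>t. t \<in> I \<Longrightarrow> dist t0 t < \<delta> \<Longrightarrow> g t \<noteq> 0"
    using continuous_on_avoid[of I g t0 0] t0 by blast
  show thesis
  proof (rule that[OF \<delta>(1)])
    fix t assume "t \<in> {t0 - \<delta><..<t0 + \<delta>} \<inter> I"
    then have t: "t \<in> I" "dist t0 t < \<delta>" by (auto simp: dist_real_def)
    then show "full_col n l (A t)"
      using \<delta>(2)[OF t] gram_det_nonzero_iff[OF mat_Ck_carrier[OF A t(1)]] by (simp add: g_def)
  qed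
qed

lemma kernel_transpose_basis:
  assumes "full_col n l A"
  obtains B where "full_col n (n - l) B" "mat_image B = mat_kernel (transpose_mat A)"
proof -
  have "is_subspace n (mat_kernel (transpose_mat A))"
    using assms by (intro is_subspace_mat_kernel[of _ l]) (auto dest: full_colD)
  then obtain k B where B: "full_col n k B" "mat_image B = mat_kernel (transpose_mat A)"
    by (rule subspace_basis_exists)
  moreover have "k = n - l"
    using subspace_dim_full_col[OF B(1)] subspace_dim_kernel_transpose[OF assms] B(2) by simp
  ultimately show thesis using that by blast
qed

text \<open>Project a fixed basis B of the kernel at t0 onto the moving kernel: N = (1 - A pinv(A))
  B is smooth, equals B at t0 and so stays independent nearby. Having n - l columns, it spans the
  whole kernel.\<close>

lemma local_kernel_basis:
  assumes A: "mat_Ck k I n l A" and t0: "t0 \<in> I" and f: "full_col n l (A t0)"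
  obtains \<delta> N where "\<delta> > 0" "mat_Ck k ({t0 - \<delta><..<t0 + \<delta>} \<inter> I) n (n - l) N"
    "\<And>t. t \<in> {t0 - \<delta><..<t0 + \<delta>} \<inter> I \<Longrightarrow> full_col n (n - l) (N t)"
    "\<And>t. t \<in> {t0 - \<delta><..<t0 + \<delta>} \<inter> I \<Longrightarrow> mat_image (N t) = mat_kernel (transpose_mat (A t))"
proof -
  obtain \<delta>1 where d1: "\<delta>1 > 0" "\<And>t. t \<in> {t0 - \<delta>1<..<t0 + \<delta>1} \<inter> I \<Longrightarrow> full_col n l (A t)"
    using full_col_open[OF A t0 f] by blast
  define J where "J = {t0 - \<delta>1<..<t0 + \<delta>1} \<inter> I"
  have J: "J \<subseteq> I" "t0 \<in> J" using t0 d1 by (auto simp: J_def)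
  have fJ: "\<And>t. t \<in> J \<Longrightarrow> full_col n l (A t)" using d1(2) by (simp add: J_def)
  have AJ: "mat_Ck k J n l A" by (rule mat_Ck_subset[OF A J(1)])
  obtain B where B: "full_col n (n - l) B" "mat_image B = mat_kernel (transpose_mat (A t0))"
    using kernel_transpose_basis[OF f] .
  have cB: "B \<in> carrier_mat n (n - l)" using B(1) by (rule full_colD)
  \<comment> \<open>Carries the minus sign of the projection, so that \<open>N\<close> is a sum of
    matrices.\<close>
  define B' where "B' = (-1) \<cdot>\<^sub>m B"
  have cB': "B' \<in> carrier_mat n (n - l)" using cB by (simp add: B'_def)
  have B'v: "B' *\<^sub>v v = (-1) \<cdot>\<^sub>v (B *\<^sub>v v)" if "v \<in> carrier_vec (n - l)" for v
    unfolding B'_def using cB that by (intro eq_vecI) (auto simp: scalar_prod_def sum_negf)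
  define N where "N t = B + A t * (pinv (A t) * B')" for t
  have N: "mat_Ck k J n (n - l) N"
    unfolding N_def
    by (intro mat_Ck_add mat_Ck_const cB mat_Ck_mult[OF AJ] mat_Ck_mult[OF mat_Ck_pinv[OF AJ fJ]] cB')
  have Nv: "N t *\<^sub>v v = B *\<^sub>v v + A t *\<^sub>v (pinv (A t) *\<^sub>v (B' *\<^sub>v v))" if t: "t \<in> J" and v: "v \<in> carrier_vec (n - l)" for t v
  proof -
    have c: "A t \<in> carrier_mat n l" "pinv (A t) \<in> carrier_mat l n" "pinv (A t) * B' \<in> carrier_mat l (n - l)"
      "A t * (pinv (A t) * B') \<in> carrier_mat n (n - l)"
      using mat_Ck_carrier[OF AJ t] pinv(1)[OF fJ[OF t]] cB' by auto
    show ?thesis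
      unfolding N_def add_mult_distrib_mat_vec[OF cB c(4) v] assoc_mult_mat_vec[OF c(1,3) v]
        assoc_mult_mat_vec[OF c(2) cB' v] ..
  qed
  have N_ker: "N t *\<^sub>v v \<in> mat_kernel (transpose_mat (A t))" if t: "t \<in> J" and v: "v \<in> carrier_vec (n - l)" for t v
  proof -
    have c: "A t \<in> carrier_mat n l" "pinv (A t) \<in> carrier_mat l n" "transpose_mat (A t) \<in> carrier_mat l n"
      using mat_Ck_carrier[OF AJ t] pinv(1)[OF fJ[OF t]] by auto
    have cv: "B *\<^sub>v v \<in> carrier_vec n" "B' *\<^sub>v v \<in> carrier_vec n" using cB cB' v by auto
    have cp: "A t *\<^sub>v (pinv (A t) *\<^sub>v (B' *\<^sub>v v)) \<in> carrier_vec n" using c cv by auto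
    have "transpose_mat (A t) *\<^sub>v (N t *\<^sub>v v) =
        transpose_mat (A t) *\<^sub>v (B *\<^sub>v v) + transpose_mat (A t) *\<^sub>v (B' *\<^sub>v v)"
      unfolding Nv[OF t v] mult_add_distrib_mat_vec[OF c(3) cv(1) cp] transpose_mult_projection[OF fJ[OF t] cv(2)] ..
    also have "\<dots> = 0\<^sub>v l"
      unfolding B'v[OF v] mult_mat_vec[OF c(3) cv(1)] using c cv by (intro eq_vecI) auto
    finally show ?thesis
      using cv cp by (intro mat_kernelI[OF c(3)]) (simp_all add: Nv[OF t v])
  qed
  \<comment> \<open>At t0 the columns of B already lie in the kernel, so the part projected onto im
    A vanishes.\<close>
  have "full_col n (n - l) (N t0)"
  proof -
    have "N t0 *\<^sub>v v = B *\<^sub>v v" if v: "v \<in> carrier_vec (n - l)" for v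
    proof -
      have c: "A t0 \<in> carrier_mat n l" "transpose_mat (A t0) \<in> carrier_mat l n"
        using mat_Ck_carrier[OF AJ J(2)] by auto
      have cv: "B *\<^sub>v v \<in> carrier_vec n" "B' *\<^sub>v v \<in> carrier_vec n" using cB cB' v by auto
      define w where "w = A t0 *\<^sub>v (pinv (A t0) *\<^sub>v (B' *\<^sub>v v))"
      have pc: "pinv (A t0) *\<^sub>v (B' *\<^sub>v v) \<in> carrier_vec l" using pinv(1)[OF f] cv by auto
      have "B *\<^sub>v v \<in> mat_kernel (transpose_mat (A t0))" using mat_imageI[OF cB v] B(2) by simp
      then have "transpose_mat (A t0) *\<^sub>v (B *\<^sub>v v) = 0\<^sub>v l" using mat_kernelD[OF c(2)] by blast
      then have "transpose_mat (A t0) *\<^sub>v (B' *\<^sub>v v) = 0\<^sub>v l"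
        unfolding B'v[OF v] mult_mat_vec[OF c(2) cv(1)] by auto
      then have "transpose_mat (A t0) *\<^sub>v w = 0\<^sub>v l"
        unfolding w_def transpose_mult_projection[OF f cv(2)] .
      then have "w = 0\<^sub>v n"
        by (rule transpose_injective_on_image[OF f, rotated]) (simp add: w_def mat_imageI[OF c(1) pc])
      then show ?thesis unfolding Nv[OF J(2) v] w_def[symmetric] using cv by simp
    qed
    then show ?thesis using B(1) mat_Ck_carrier[OF N J(2)] by (auto simp: full_col_def)
  qed
  from full_col_open[OF N J(2) this] obtain \<delta>2 where
    d2: "\<delta>2 > 0" "\<And>t. t \<in> {t0 - \<delta>2<..<t0 + \<delta>2} \<inter> J \<Longrightarrow> full_col n (n - l) (N t)" by blast
  define \<delta> where "\<delta> = min \<delta>1 \<delta>2"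
  have sub: "{t0 - \<delta><..<t0 + \<delta>} \<inter> I \<subseteq> J" "{t0 - \<delta><..<t0 + \<delta>} \<inter> I \<subseteq> {t0 - \<delta>2<..<t0 + \<delta>2} \<inter> J"
    by (auto simp: \<delta>_def J_def)
  show thesis
  proof (rule that[of \<delta> N])
    show "\<delta> > 0" using d1 d2 by (simp add: \<delta>_def)
    show "mat_Ck k ({t0 - \<delta><..<t0 + \<delta>} \<inter> I) n (n - l) N" by (rule mat_Ck_subset[OF N sub(1)])
    fix t assume t: "t \<in> {t0 - \<delta><..<t0 + \<delta>} \<inter> I"
    show fN: "full_col n (n - l) (N t)" using d2(2) sub(2) t by blast
    have tJ: "t \<in> J" using t sub by blast
    obtain D where D: "full_col n (n - l) D" "mat_image D = mat_kernel (transpose_mat (A t))"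
      using kernel_transpose_basis[OF fJ[OF tJ]] .
    have "mat_image (N t) \<subseteq> mat_image D"
      unfolding D(2) using N_ker[OF tJ] mat_Ck_carrier[OF N tJ] by (auto elim!: mat_imageE)
    from mat_image_eq_of_subset[OF fN D(1) this] D(2)
    show "mat_image (N t) = mat_kernel (transpose_mat (A t))" by simp
  qed
qed

text \<open>A constant matrix P selects r combinations of the columns of E. If E P is independent at
  t0, it remains so nearby, and constant rank then forces its image to be all of im E.\<close>

lemma local_image_basis:
  assumes E: "mat_Ck k I p p E" and t0: "t0 \<in> I" and rank: "\<And>t. t \<in> I \<Longrightarrow> vec_space.rank p (E t) = r"
  obtains \<delta> Y where "\<delta> > 0" "mat_Ck k ({t0 - \<delta><..<t0 + \<delta>} \<inter> I) p r Y"
    "\<And>t. t \<in> {t0 - \<delta><..<t0 + \<delta>} \<inter> I \<Longrightarrow> full_col p r (Y t)"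
    "\<And>t. t \<in> {t0 - \<delta><..<t0 + \<delta>} \<inter> I \<Longrightarrow> mat_image (Y t) = mat_image (E t)"
proof -
  have basis: "\<exists>B. full_col p r B \<and> mat_image B = mat_image (E t)" if t: "t \<in> I" for t
  proof -
    have c: "E t \<in> carrier_mat p p" by (rule mat_Ck_carrier[OF E t])
    obtain l B where B: "full_col p l B" "mat_image B = mat_image (E t)"
      using subspace_basis_exists[OF is_subspace_mat_image[OF c]] .
    moreover have "l = r"
      using subspace_dim_full_col[OF B(1)] B(2) rank[OF t] rank_eq_subspace_dim[OF c] by simp
    ultimately show ?thesis by blast
  qed
  obtain B where B: "full_col p r B" "mat_image B = mat_image (E t0)" using basis[OF t0] by blast
  have cB: "B \<in> carrier_mat p r" using B(1) by (rule full_colD)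
  have cE: "E t0 \<in> carrier_mat p p" by (rule mat_Ck_carrier[OF E t0])
  \<comment> \<open>With B a basis of im E(t0), the product E P equals E E^T B at t0. If E E^T w = 0
    then |E^T w|^2 = 0, so w is orthogonal to im E; for w in im E this gives w = 0.\<close>
  define P where "P = transpose_mat (E t0) * B"
  have cP: "P \<in> carrier_mat p r" using cE cB by (simp add: P_def)
  define Y where "Y t = E t * P" for t
  have Y: "mat_Ck k I p r Y" unfolding Y_def by (rule mat_Ck_mult[OF E mat_Ck_const[OF cP]])
  have "full_col p r (Y t0)"
    unfolding full_col_def
  proof (intro conjI ballI impI mat_Ck_carrier[OF Y t0])
    fix v assume v: "v \<in> carrier_vec r" and 0: "Y t0 *\<^sub>v v = 0\<^sub>v p"
    have T: "transpose_mat (E t0) \<in> carrier_mat p p" using cE by simp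
    define w where "w = B *\<^sub>v v"
    have w: "w \<in> carrier_vec p" using cB v by (auto simp: w_def)
    define u where "u = transpose_mat (E t0) *\<^sub>v w"
    have u: "u \<in> carrier_vec p" using T w by (auto simp: u_def)
    have Eu: "E t0 *\<^sub>v u = 0\<^sub>v p"
      using 0 assoc_mult_mat_vec[OF cE cP v] assoc_mult_mat_vec[OF T cB v] by (simp add: Y_def P_def u_def w_def)
    have "scalar_prod u u = scalar_prod w (E t0 *\<^sub>v u)"
      using cE w u by (subst (1) u_def) (simp add: transpose_vec_mult_scalar)
    also have "\<dots> = 0" using Eu w by simp
    finally have u0: "u = 0\<^sub>v p" by (rule scalar_prod_self_eq_0[OF u])
    have "w \<in> orth_compl p (mat_image (E t0))"
      unfolding orth_compl_mat_image[OF cE] using u0 by (intro mat_kernelI[OF T w]) (simp add: u_def)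
    moreover have "w \<in> mat_image (E t0)" using mat_imageI[OF cB v] B(2) by (simp add: w_def)
    ultimately have "scalar_prod w w = 0" by (auto simp: orth_compl_def)
    then have "w = 0\<^sub>v p" by (rule scalar_prod_self_eq_0[OF w])
    then show "v = 0\<^sub>v r" unfolding w_def by (rule full_colD(2)[OF B(1) v])
  qed
  from full_col_open[OF Y t0 this] obtain \<delta> where
    d: "\<delta> > 0" "\<And>t. t \<in> {t0 - \<delta><..<t0 + \<delta>} \<inter> I \<Longrightarrow> full_col p r (Y t)" by blast
  show thesis
  proof (rule that[OF d(1) mat_Ck_subset[OF Y] d(2)])
    fix t assume t: "t \<in> {t0 - \<delta><..<t0 + \<delta>} \<inter> I"
    then have tI: "t \<in> I" by simp
    obtain D where D: "full_col p r D" "mat_image D = mat_image (E t)" using basis[OF tI] by blast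
    have cEt: "E t \<in> carrier_mat p p" by (rule mat_Ck_carrier[OF E tI])
    have "mat_image (Y t) \<subseteq> mat_image D"
    proof
      fix w assume "w \<in> mat_image (Y t)"
      then have "w \<in> (\<lambda>v. E t *\<^sub>v v) ` mat_image P" unfolding Y_def mat_image_mult[OF cEt cP] .
      then obtain x where x: "x \<in> mat_image P" "w = E t *\<^sub>v x" by blast
      from mat_imageI[OF cEt mat_image_carrier[OF cP x(1)]] x(2) D(2) show "w \<in> mat_image D" by simp
    qed
    from mat_image_eq_of_subset[OF d(2)[OF t] D(1) this] D(2) show "mat_image (Y t) = mat_image (E t)" by simp
  qed auto
qed

lemma local_reduction_bases:
  assumes E: "mat_Ck k I p p E" and F: "mat_Ck k I p p F" and t0: "t0 \<in> I"
    and pre: "pre_regular I p E F r \<theta>"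
  obtains \<delta> Y Z C where "\<delta> > 0"
    "mat_Ck k ({t0 - \<delta><..<t0 + \<delta>} \<inter> I) p r Y"
    "mat_Ck k ({t0 - \<delta><..<t0 + \<delta>} \<inter> I) p (p - r) Z"
    "mat_Ck k ({t0 - \<delta><..<t0 + \<delta>} \<inter> I) p r C"
    "\<And>t. t \<in> {t0 - \<delta><..<t0 + \<delta>} \<inter> I \<Longrightarrow> cols_basis p (Y t) (mat_image (E t))"
    "\<And>t. t \<in> {t0 - \<delta><..<t0 + \<delta>} \<inter> I \<Longrightarrow> cols_basis p (Z t) (orth_compl p (mat_image (E t)))"
    "\<And>t. t \<in> {t0 - \<delta><..<t0 + \<delta>} \<inter> I \<Longrightarrow> cols_basis p (C t) (mat_kernel (transpose_mat (Z t) * F t))"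
proof -
  have rank: "\<And>t. t \<in> I \<Longrightarrow> vec_space.rank p (E t) = r" using pre by (simp add: pre_regular_def)
  obtain \<delta>1 Y where d1: "\<delta>1 > 0" and Y: "mat_Ck k ({t0 - \<delta>1<..<t0 + \<delta>1} \<inter> I) p r Y"
    and fY: "\<And>t. t \<in> {t0 - \<delta>1<..<t0 + \<delta>1} \<inter> I \<Longrightarrow> full_col p r (Y t)"
    and iY: "\<And>t. t \<in> {t0 - \<delta>1<..<t0 + \<delta>1} \<inter> I \<Longrightarrow> mat_image (Y t) = mat_image (E t)"
    using local_image_basis[OF E t0 rank] by blast
  define J1 where "J1 = {t0 - \<delta>1<..<t0 + \<delta>1} \<inter> I"
  have J1: "t0 \<in> J1" "J1 \<subseteq> I" using t0 d1 by (auto simp: J1_def)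
  note Y = Y[folded J1_def] and fY = fY[folded J1_def] and iY = iY[folded J1_def]
  obtain \<delta>2 Z where d2: "\<delta>2 > 0" and Z: "mat_Ck k ({t0 - \<delta>2<..<t0 + \<delta>2} \<inter> J1) p (p - r) Z"
    and fZ: "\<And>t. t \<in> {t0 - \<delta>2<..<t0 + \<delta>2} \<inter> J1 \<Longrightarrow> full_col p (p - r) (Z t)"
    and iZ: "\<And>t. t \<in> {t0 - \<delta>2<..<t0 + \<delta>2} \<inter> J1 \<Longrightarrow> mat_image (Z t) = mat_kernel (transpose_mat (Y t))"
    using local_kernel_basis[OF Y J1(1) fY[OF J1(1)]] by blast
  define J2 where "J2 = {t0 - \<delta>2<..<t0 + \<delta>2} \<inter> J1"
  have J2: "t0 \<in> J2" "J2 \<subseteq> J1" "J2 \<subseteq> I" using J1 d2 by (auto simp: J2_def)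
  note Z = Z[folded J2_def] and fZ = fZ[folded J2_def] and iZ = iZ[folded J2_def]
  have iZ': "mat_image (Z t) = orth_compl p (mat_image (E t))" if t: "t \<in> J2" for t
  proof -
    have t1: "t \<in> J1" using t J2 by blast
    show ?thesis using iZ[OF t] orth_compl_mat_image[OF mat_Ck_carrier[OF Y t1]] iY[OF t1] by simp
  qed
  \<comment> \<open>Transposed because \<open>local_kernel_basis\<close> describes the kernel of a
    transpose.\<close>
  define A where "A t = transpose_mat (transpose_mat (Z t) * F t)" for t
  have A: "mat_Ck k J2 p (p - r) A"
    unfolding A_def
    by (rule mat_Ck_transpose[OF mat_Ck_mult[OF mat_Ck_transpose[OF Z] mat_Ck_subset[OF F J2(3)]]])
  \<comment> \<open>Here im [E F] = R^p enters. A vector w = Z v with F^T w = 0 is orthogonal to im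
    E and to im F, hence to every vector, in particular to itself.\<close>
  have "full_col p (p - r) (A t0)"
    unfolding full_col_def
  proof (intro conjI ballI impI mat_Ck_carrier[OF A J2(1)])
    fix v assume v: "v \<in> carrier_vec (p - r)" and 0: "A t0 *\<^sub>v v = 0\<^sub>v p"
    have c: "Z t0 \<in> carrier_mat p (p - r)" "F t0 \<in> carrier_mat p p" "E t0 \<in> carrier_mat p p"
      using mat_Ck_carrier[OF Z J2(1)] mat_Ck_carrier[OF F t0] mat_Ck_carrier[OF E t0] .
    have TF: "transpose_mat (F t0) \<in> carrier_mat p p" using c by simp
    define w where "w = Z t0 *\<^sub>v v"
    have w: "w \<in> carrier_vec p" using c v by (auto simp: w_def)
    have "A t0 = transpose_mat (F t0) * Z t0"
      unfolding A_def using c by (subst transpose_mult[of _ "p - r" p _ p]) auto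
    then have Fw: "transpose_mat (F t0) *\<^sub>v w = 0\<^sub>v p"
      using 0 assoc_mult_mat_vec[OF TF c(1) v] by (simp add: w_def)
    have wo: "w \<in> orth_compl p (mat_image (E t0))"
      using mat_imageI[OF c(1) v] iZ'[OF J2(1)] by (simp add: w_def)
    obtain a b where ab: "a \<in> carrier_vec p" "b \<in> carrier_vec p" "w = E t0 *\<^sub>v a + F t0 *\<^sub>v b"
      using pre t0 w unfolding pre_regular_def by meson
    have "scalar_prod w w = scalar_prod w (E t0 *\<^sub>v a) + scalar_prod w (F t0 *\<^sub>v b)"
      by (subst (2) ab(3)) (use w c ab(1,2) in \<open>intro scalar_prod_add_distrib[of _ p]; auto\<close>)
    also have "scalar_prod w (E t0 *\<^sub>v a) = 0" using wo mat_imageI[OF c(3) ab(1)] by (auto simp: orth_compl_def)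
    also have "scalar_prod w (F t0 *\<^sub>v b) = scalar_prod (transpose_mat (F t0) *\<^sub>v w) b"
      using transpose_vec_mult_scalar[OF c(2) ab(2) w] by simp
    also have "\<dots> = 0" using Fw ab(2) by simp
    finally have "w = 0\<^sub>v p" using w by (intro scalar_prod_self_eq_0) auto
    then show "v = 0\<^sub>v (p - r)" unfolding w_def by (rule full_colD(2)[OF fZ[OF J2(1)] v])
  qed
  from local_kernel_basis[OF A J2(1) this] obtain \<delta>3 C where d3: "\<delta>3 > 0"
    and C: "mat_Ck k ({t0 - \<delta>3<..<t0 + \<delta>3} \<inter> J2) p (p - (p - r)) C"
    and fC: "\<And>t. t \<in> {t0 - \<delta>3<..<t0 + \<delta>3} \<inter> J2 \<Longrightarrow> full_col p (p - (p - r)) (C t)"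
    and iC: "\<And>t. t \<in> {t0 - \<delta>3<..<t0 + \<delta>3} \<inter> J2 \<Longrightarrow> mat_image (C t) = mat_kernel (transpose_mat (A t))"
    by blast
  \<comment> \<open>The subtraction is truncated, so this needs \<open>r \<le> p\<close>, read off
    from the independent columns of Y.\<close>
  have r: "p - (p - r) = r" using full_col_le[OF fY[OF J1(1)]] by simp
  define \<delta> where "\<delta> = min \<delta>1 (min \<delta>2 \<delta>3)"
  define J where "J = {t0 - \<delta><..<t0 + \<delta>} \<inter> I"
  have sub: "J \<subseteq> J1" "J \<subseteq> J2" "J \<subseteq> {t0 - \<delta>3<..<t0 + \<delta>3} \<inter> J2"
    by (auto simp: \<delta>_def J_def J1_def J2_def)
  show thesis
  proof (rule that[of \<delta> Y Z C], fold J_def)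
    show "\<delta> > 0" using d1 d2 d3 by (simp add: \<delta>_def)
    show "mat_Ck k J p r Y" by (rule mat_Ck_subset[OF Y sub(1)])
    show "mat_Ck k J p (p - r) Z" by (rule mat_Ck_subset[OF Z sub(2)])
    show "mat_Ck k J p r C" using mat_Ck_subset[OF C sub(3)] unfolding r .
    fix t assume t: "t \<in> J"
    have tt: "t \<in> J1" "t \<in> J2" "t \<in> {t0 - \<delta>3<..<t0 + \<delta>3} \<inter> J2" using t sub by blast+
    show "cols_basis p (Y t) (mat_image (E t))" by (rule full_col_imp_cols_basis[OF fY iY]) (rule tt)+
    show "cols_basis p (Z t) (orth_compl p (mat_image (E t)))" by (rule full_col_imp_cols_basis[OF fZ iZ']) (rule tt)+
    show "cols_basis p (C t) (mat_kernel (transpose_mat (Z t) * F t))"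
      using full_col_imp_cols_basis[OF fC[OF tt(3)] iC[OF tt(3)]] by (simp add: A_def)
  qed
qed

section \<open>Runs of the reduction procedure\<close>

lemma reduction_runD:
  assumes "reduction_run I m E F n Es Fs Ys Zs Cs Cds ms"
  shows "ms 0 = m" "Es 0 = E" "Fs 0 = F"
    and "i < n \<Longrightarrow> mat_Ck (m - i) I (ms i) (ms (Suc i)) (Ys i)"
    and "i < n \<Longrightarrow> mat_Ck (m - i) I (ms i) (ms (Suc i)) (Cs i)"
    and "i < n \<Longrightarrow> has_mat_deriv_on I (ms i) (ms (Suc i)) (Cs i) (Cds i)"
    and "i < n \<Longrightarrow> t \<in> I \<Longrightarrow> cols_basis (ms i) (Ys i t) (mat_image (Es i t))"
    and "i < n \<Longrightarrow> t \<in> I \<Longrightarrow> cols_basis (ms i) (Zs i t) (orth_compl (ms i) (mat_image (Es i t)))"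
    and "i < n \<Longrightarrow> t \<in> I \<Longrightarrow> cols_basis (ms i) (Cs i t) (mat_kernel (transpose_mat (Zs i t) * Fs i t))"
    and "i < n \<Longrightarrow> t \<in> I \<Longrightarrow> Es (Suc i) t = transpose_mat (Ys i t) * Es i t * Cs i t"
    and "i < n \<Longrightarrow> t \<in> I \<Longrightarrow> Fs (Suc i) t = transpose_mat (Ys i t) * (Fs i t * Cs i t + Es i t * Cds i t)"
  using assms unfolding reduction_run_def by blast+

text \<open>One derivative is spent per level on that of \<open>Cs i\<close>. Since \<mu> \<le> m
  for a regular pair, the coefficients at level \<mu> are still continuous, as the final linear
  equation requires.\<close>

lemma reduction_run_smooth:
  assumes I: "real_interval I" and E: "mat_Ck m I m m E" and F: "mat_Ck m I m m F"
    and run: "reduction_run I m E F n Es Fs Ys Zs Cs Cds ms" and i: "i \<le> n" "i \<le> m"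
  shows "mat_Ck (m - i) I (ms i) (ms i) (Es i) \<and> mat_Ck (m - i) I (ms i) (ms i) (Fs i)"
  using i
proof (induction i)
  case 0
  then show ?case using E F reduction_runD(1,2,3)[OF run] by simp
next
  case (Suc i)
  note D = reduction_runD[OF run]
  have i: "i < n" "m - i = Suc (m - Suc i)" using Suc.prems by auto
  let ?k = "m - Suc i"
  have Ei: "mat_Ck ?k I (ms i) (ms i) (Es i)" and Fi: "mat_Ck ?k I (ms i) (ms i) (Fs i)"
    using Suc mat_Ck_le[of "m - i" I _ _ _ ?k] by auto
  have Y: "mat_Ck ?k I (ms i) (ms (Suc i)) (Ys i)" by (rule mat_Ck_le[OF D(4)[OF i(1)]]) simp
  have C: "mat_Ck ?k I (ms i) (ms (Suc i)) (Cs i)" by (rule mat_Ck_le[OF D(5)[OF i(1)]]) simp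
  have Cd: "mat_Ck ?k I (ms i) (ms (Suc i)) (Cds i)"
    by (rule mat_Ck_of_deriv[OF I _ D(6)[OF i(1)]]) (use D(5)[OF i(1)] i(2) in simp)
  have "mat_Ck ?k I (ms (Suc i)) (ms (Suc i)) (\<lambda>t. transpose_mat (Ys i t) * Es i t * Cs i t)"
    by (rule mat_Ck_mult[OF mat_Ck_mult[OF mat_Ck_transpose[OF Y] Ei] C])
  moreover have "mat_Ck ?k I (ms (Suc i)) (ms (Suc i))
      (\<lambda>t. transpose_mat (Ys i t) * (Fs i t * Cs i t + Es i t * Cds i t))"
    by (rule mat_Ck_mult[OF mat_Ck_transpose[OF Y] mat_Ck_add[OF mat_Ck_mult[OF Fi C] mat_Ck_mult[OF Ei Cd]]])
  ultimately show ?case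
    using mat_Ck_cong D(10,11)[OF i(1)] by blast
qed

text \<open>The bound \<open>i < m\<close> ensures that \<open>Cs i\<close>, of class C^(m-i), is at
  least C^1.\<close>

lemma reduction_run_red_step:
  assumes I: "real_interval I" and E: "mat_Ck m I m m E" and F: "mat_Ck m I m m F"
    and run: "reduction_run I m E F n Es Fs Ys Zs Cs Cds ms" and i: "i < n" "i < m"
  shows "red_step I (ms i) (ms (Suc i)) (Es i) (Fs i) (Ys i) (Cs i) (Cds i) (Es (Suc i)) (Fs (Suc i))"
  unfolding red_step_def
proof (intro conjI ballI)
  note D = reduction_runD[OF run] and sm = reduction_run_smooth[OF I E F run]
  let ?p = "ms i" and ?q = "ms (Suc i)"
  show "mat_Ck 1 I ?p ?q (Cs i)" by (rule mat_Ck_le[OF D(5)[OF i(1)]]) (use i in simp)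
  show "has_mat_deriv_on I ?p ?q (Cs i) (Cds i)" by (rule D(6)[OF i(1)])
  fix t assume t: "t \<in> I"
  show cE: "Es i t \<in> carrier_mat ?p ?p" and cF: "Fs i t \<in> carrier_mat ?p ?p"
    using sm[of i] i mat_Ck_carrier[OF _ t] by auto
  have cY: "Ys i t \<in> carrier_mat ?p ?q" by (rule mat_Ck_carrier[OF D(4)[OF i(1)] t])
  have cC: "Cs i t \<in> carrier_mat ?p ?q" by (rule mat_Ck_carrier[OF D(5)[OF i(1)] t])
  have cCd: "Cds i t \<in> carrier_mat ?p ?q" by (rule has_mat_deriv_onD(1)[OF D(6)[OF i(1)] t])
  note bY = cols_basis_imp[OF D(7)[OF i(1) t] is_subspace_mat_image[OF cE]]
  show "full_col ?p ?q (Ys i t)" "mat_image (Ys i t) = mat_image (Es i t)" using bY cY by auto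
  have S: "mat_kernel (transpose_mat (Zs i t) * Fs i t) = S_space (Es i t) (Fs i t)"
    by (rule kernel_orth_basis_eq_S_space[OF cE cF D(8)[OF i(1) t]])
  note bC = cols_basis_imp[OF D(9)[OF i(1) t, unfolded S] is_subspace_S_space[OF cE cF]]
  show "full_col ?p ?q (Cs i t)" "mat_image (Cs i t) = S_space (Es i t) (Fs i t)" using bC cC by auto
  show "Es (Suc i) t \<in> carrier_mat ?q ?q" "Fs (Suc i) t \<in> carrier_mat ?q ?q"
    using sm[of "Suc i"] i mat_Ck_carrier[OF _ t] by auto
  fix v :: "real vec" assume v: "v \<in> carrier_vec ?q"
  have T: "transpose_mat (Ys i t) \<in> carrier_mat ?q ?p" using cY by simp
  have Cv: "Cs i t *\<^sub>v v \<in> carrier_vec ?p" using cC v by auto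
  show "Es (Suc i) t *\<^sub>v v = transpose_mat (Ys i t) *\<^sub>v (Es i t *\<^sub>v (Cs i t *\<^sub>v v))"
    unfolding D(10)[OF i(1) t] assoc_mult_mat_vec[OF mult_carrier_mat[OF T cE] cC v] assoc_mult_mat_vec[OF T cE Cv] ..
  have c: "Fs i t * Cs i t \<in> carrier_mat ?p ?q" "Es i t * Cds i t \<in> carrier_mat ?p ?q" using cF cC cE cCd by auto
  show "Fs (Suc i) t *\<^sub>v v = transpose_mat (Ys i t) *\<^sub>v (Fs i t *\<^sub>v (Cs i t *\<^sub>v v) + Es i t *\<^sub>v (Cds i t *\<^sub>v v))"
    unfolding D(11)[OF i(1) t] assoc_mult_mat_vec[OF T add_carrier_mat[OF c(2)] v]
      add_mult_distrib_mat_vec[OF c v] assoc_mult_mat_vec[OF cF cC v] assoc_mult_mat_vec[OF cE cCd v] ..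
qed

lemma flow_subspace_chain:
  assumes I: "real_interval I" and t: "t \<in> I"
    and 0: "ms 0 = m" "Es 0 = E" "Fs 0 = F"
    and s: "\<And>i. i < n \<Longrightarrow>
      red_step I (ms i) (ms (Suc i)) (Es i) (Fs i) (Ys i) (Cs i) (Cds i) (Es (Suc i)) (Fs (Suc i))"
  shows "full_col m (ms n) (chain_prod m Cs n t) \<and>
    flow_subspace I m E F t = (\<lambda>v. chain_prod m Cs n t *\<^sub>v v) ` flow_subspace I (ms n) (Es n) (Fs n) t"
  using s
proof (induction n)
  case 0
  have "flow_subspace I m E F t \<subseteq> carrier_vec m"
    using t by (auto simp: flow_subspace_def dae_solution_on_def)
  then have "flow_subspace I m E F t = (\<lambda>v. 1\<^sub>m m *\<^sub>v v) ` flow_subspace I m E F t" by force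
  then show ?case using assms(3-5) by (auto simp: full_col_def)
next
  case (Suc n)
  let ?A = "chain_prod m Cs n t" and ?C = "Cs n t"
  have sn: "red_step I (ms n) (ms (Suc n)) (Es n) (Fs n) (Ys n) (Cs n) (Cds n) (Es (Suc n)) (Fs (Suc n))"
    using Suc.prems by simp
  have IH: "full_col m (ms n) ?A"
    "flow_subspace I m E F t = (\<lambda>v. ?A *\<^sub>v v) ` flow_subspace I (ms n) (Es n) (Fs n) t"
    using Suc by auto
  have "full_col m (ms (Suc n)) (chain_prod m Cs (Suc n) t)"
    using full_col_mult[OF IH(1) red_stepD(7)[OF sn t]] by simp
  moreover have "(\<lambda>v. ?A *\<^sub>v v) ` (\<lambda>y. ?C *\<^sub>v y) ` flow_subspace I (ms (Suc n)) (Es (Suc n)) (Fs (Suc n)) t =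
      (\<lambda>v. (?A * ?C) *\<^sub>v v) ` flow_subspace I (ms (Suc n)) (Es (Suc n)) (Fs (Suc n)) t"
    unfolding image_image
  proof (rule image_cong[OF refl])
    fix v assume "v \<in> flow_subspace I (ms (Suc n)) (Es (Suc n)) (Fs (Suc n)) t"
    then have "v \<in> carrier_vec (ms (Suc n))"
      using t by (auto simp: flow_subspace_def dae_solution_on_def)
    then show "?A *\<^sub>v (?C *\<^sub>v v) = (?A * ?C) *\<^sub>v v"
      by (rule assoc_mult_mat_vec[symmetric, OF full_colD(1)[OF IH(1)] red_stepD(13)[OF sn t]])
  qed
  ultimately show ?case
    using IH(2) flow_subspace_red_step[OF I sn t] by simp
qed

section \<open>Regular pairs: restriction, ranks and comparison of runs\<close>

lemma reduction_run_subset: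
  assumes "reduction_run I m E F n Es Fs Ys Zs Cs Cds ms" "J \<subseteq> I"
  shows "reduction_run J m E F n Es Fs Ys Zs Cs Cds ms"
  using assms mat_Ck_subset[OF _ assms(2)] has_mat_deriv_on_subset[OF _ assms(2)]
  unfolding reduction_run_def by (simp add: subset_iff)

text \<open>The given run restricts: its conditions are pointwise or pass to subsets. This yields
  the claim on subintervals and also permits localisation around a point.\<close>

lemma regular_index_subset:
  assumes "regular_index I m E F \<mu> r \<theta>" "J \<subseteq> I"
  shows "regular_index J m E F \<mu> r \<theta>"
proof -
  have pre: "pre_regular J p E F r \<theta>" if "pre_regular I p E F r \<theta>" for p E F r \<theta>
    using that assms(2) unfolding pre_regular_def by blast
  from assms(1) obtain Es Fs Ys Zs Cs Cds ms rs where
    run: "reduction_run I m E F (\<mu> - 1) Es Fs Ys Zs Cs Cds ms"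
    and pr: "\<forall>i<\<mu>. pre_regular I (ms i) (Es i) (Fs i) (rs i) (\<theta> i)" and r0: "rs 0 = r"
    unfolding regular_index_def by blast
  have "\<forall>i<\<mu>. pre_regular J (ms i) (Es i) (Fs i) (rs i) (\<theta> i)" using pr pre by blast
  with reduction_run_subset[OF run assms(2)] r0 have "\<exists>Es Fs Ys Zs Cs Cds ms rs.
        reduction_run J m E F (\<mu> - 1) Es Fs Ys Zs Cs Cds ms \<and>
        (\<forall>i<\<mu>. pre_regular J (ms i) (Es i) (Fs i) (rs i) (\<theta> i)) \<and> rs 0 = r"
    by blast
  with assms(1) show ?thesis unfolding regular_index_def by (elim conjE, intro conjI)
qed

text \<open>Guarantees that each step before the last level lowers the rank by at least 1, which
  bounds \<mu> by m.\<close>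

lemma characteristic_values_pos:
  assumes mono: "\<forall>i. Suc i \<le> \<mu> - 2 \<longrightarrow> \<theta> (Suc i) \<le> (\<theta> i :: nat)" and pos: "2 \<le> \<mu> \<longrightarrow> \<theta> (\<mu> - 2) > 0"
    and i: "i < \<mu> - 1"
  shows "\<theta> i > 0"
proof -
  have "i \<le> \<mu> - 2" using i by simp
  then have "\<theta> (\<mu> - 2) \<le> \<theta> i"
  proof (induction rule: inc_induct)
    case (step k)
    then show ?case using mono by (meson Suc_leI order_trans)
  qed simp
  then show ?thesis using pos i by linarith
qed

lemma regular_run_ranks:
  assumes I: "real_interval I" and E: "mat_Ck m I m m E" and F: "mat_Ck m I m m F"
    and run: "reduction_run I m E F (\<mu> - 1) Es Fs Ys Zs Cs Cds ms"
    and pre: "\<And>i. i < \<mu> \<Longrightarrow> pre_regular I (ms i) (Es i) (Fs i) (rs i) (\<theta> i)"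
    and r: "rs 0 = r" "r < m" and pos: "\<And>i. i < \<mu> - 1 \<Longrightarrow> \<theta> i > 0" and j: "j < \<mu>"
  shows "rs j + (\<Sum>i<j. \<theta> i) = r" "j < m"
proof -
  \<comment> \<open>The inequality is carried along because it gives j \<le> r < m, and the step
    from level j is available only for j < m.\<close>
  have "j \<le> (\<Sum>i<j. \<theta> i) \<and> rs j + (\<Sum>i<j. \<theta> i) = r"
    using j
  proof (induction j)
    case 0
    then show ?case using r by simp
  next
    case (Suc j)
    then have j: "j < \<mu>" "j < \<mu> - 1" and IH: "j \<le> (\<Sum>i<j. \<theta> i)" "rs j + (\<Sum>i<j. \<theta> i) = r" by auto
    then have "j < m" using r by linarith
    note s = reduction_run_red_step[OF I E F run j(2) this]
    obtain t where t: "t \<in> I" using I by (auto simp: real_interval_def)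
    have "rs j = ms (Suc j)"
      using red_step_rank(1)[OF s t] pre[OF j(1)] t by (simp add: pre_regular_def)
    moreover have "rs (Suc j) + \<theta> j = ms (Suc j)"
      using red_step_rank(2)[OF s t] pre[OF j(1)] pre[OF Suc.prems] t by (simp add: pre_regular_def)
    ultimately show ?case using IH pos[OF j(2)] by simp
  qed
  then show "rs j + (\<Sum>i<j. \<theta> i) = r" "j < m" using r by linarith+
qed

text \<open>The lengths may differ: regularity provides a run of length \<open>\<mu> - 1\<close>,
  whereas the flow is described by one of length \<mu>.\<close>

lemma reduction_runs_equiv:
  assumes I: "real_interval I" and E: "mat_Ck m I m m E" and F: "mat_Ck m I m m F"
    and run: "reduction_run I m E F n Es Fs Ys Zs Cs Cds ms"
    and run': "reduction_run I m E F n' Es' Fs' Ys' Zs' Cs' Cds' ms'"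
    and i: "i \<le> n" "i \<le> n'" "i \<le> m"
  shows "ms' i = ms i \<and> equiv_pair I (ms i) (Es i) (Fs i) (Es' i) (Fs' i)"
  using i
proof (induction i)
  case 0
  have "equiv_pair I m E F E F"
    by (intro equiv_pair_refl mat_Ck_carrier[OF E] mat_Ck_carrier[OF F])
  then show ?case using reduction_runD(1-3)[OF run] reduction_runD(1-3)[OF run'] by simp
next
  case (Suc i)
  then have i: "i < n" "i < n'" "i < m" and IH: "ms' i = ms i" "equiv_pair I (ms i) (Es i) (Fs i) (Es' i) (Fs' i)"
    by auto
  note s = reduction_run_red_step[OF I E F run i(1,3)]
    and s' = reduction_run_red_step[OF I E F run' i(2,3), unfolded IH(1)]
  have q: "ms' (Suc i) = ms (Suc i)" by (rule equiv_pair_red_step_size[OF I IH(2) s s'])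
  show ?case using equiv_pair_red_step[OF I IH(2) s s'[unfolded q]] q by simp
qed

text \<open>The values \<theta> belong to the run hidden in regularity, the product to the given
  one. They are compared at level \<open>\<mu> - 1\<close>, the last one both runs reach; the
  additional step of the given run then has a nonsingular leading matrix of size d.\<close>

lemma regular_run_flow:
  assumes I: "real_interval I" and E: "mat_Ck m I m m E" and F: "mat_Ck m I m m F"
    and reg: "regular_index I m E F \<mu> r \<theta>"
    and run': "reduction_run I m E F \<mu> Es' Fs' Ys' Zs' Cs' Cds' ms'" and t: "t \<in> I"
  defines "d \<equiv> r - (\<Sum>i<\<mu> - 1. \<theta> i)"
  shows "vec_space.rank (ms' (\<mu> - 1)) (Es' (\<mu> - 1) t) = d"
    and "full_col m d (chain_prod m Cs' \<mu> t)"
    and "mat_image (chain_prod m Cs' \<mu> t) = flow_subspace I m E F t"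
proof -
  from reg obtain Es Fs Ys Zs Cs Cds ms rs where \<mu>: "1 \<le> \<mu>" and rm: "r < m"
    and run: "reduction_run I m E F (\<mu> - 1) Es Fs Ys Zs Cs Cds ms"
    and pre: "\<And>i. i < \<mu> \<Longrightarrow> pre_regular I (ms i) (Es i) (Fs i) (rs i) (\<theta> i)"
    and r0: "rs 0 = r" and mono: "\<forall>i. Suc i \<le> \<mu> - 2 \<longrightarrow> \<theta> (Suc i) \<le> \<theta> i"
    and pos: "2 \<le> \<mu> \<longrightarrow> \<theta> (\<mu> - 2) > 0" and last: "\<theta> (\<mu> - 1) = 0"
    unfolding regular_index_def by blast
  define k where "k = \<mu> - 1"
  have k: "k < \<mu>" "\<mu> = Suc k" using \<mu> by (auto simp: k_def)
  note rk = regular_run_ranks[OF I E F run pre r0 rm characteristic_values_pos[OF mono pos]]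
  have km: "k < m" by (rule rk(2)[OF _ _ k(1)])
  have d: "d = rs k" using rk(1)[OF _ _ k(1)] by (simp add: d_def k_def)
  have eqv: "ms' k = ms k" "equiv_pair I (ms k) (Es k) (Fs k) (Es' k) (Fs' k)"
    using reduction_runs_equiv[OF I E F run run', of k] k(1) km by (auto simp: k_def)
  note pk = pre[OF k(1), unfolded pre_regular_def]
  have inv: "vec_space.rank (ms' k) (Es' k t) = d"
    "subspace_dim (ms' k) (S_space (Es' k t) (Fs' k t) \<inter> mat_kernel (Es' k t)) = 0" if t: "t \<in> I" for t
    using equiv_pair_invariants[OF eqv(2) t] pk t eqv(1) d last by (auto simp: k_def)
  show "vec_space.rank (ms' (\<mu> - 1)) (Es' (\<mu> - 1) t) = d" using inv(1)[OF t] by (simp add: k_def)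
  have s: "red_step I (ms' i) (ms' (Suc i)) (Es' i) (Fs' i) (Ys' i) (Cs' i) (Cds' i) (Es' (Suc i)) (Fs' (Suc i))"
    if "i < \<mu>" for i
    by (rule reduction_run_red_step[OF I E F run' that]) (use that k km in simp)
  \<comment> \<open>The size at level \<mu> is the rank at level \<open>\<mu> - 1\<close>; this is
    why the product of \<mu> factors has d columns.\<close>
  have md: "ms' \<mu> = d" using red_step_rank(1)[OF s[OF k(1)] t] inv(1)[OF t] k by simp
  have det: "Determinant.det (Es' \<mu> t) \<noteq> 0" if t: "t \<in> I" for t
    using red_step_nonsingular[OF s[OF k(1)] t inv(2)[OF t]] k by simp
  have "mat_Ck 0 I d d (Es' \<mu>)" "mat_Ck 0 I d d (Fs' \<mu>)"
    using reduction_run_smooth[OF I E F run', of \<mu>] k km md mat_Ck_le[of "m - \<mu>" I d d _ 0] by auto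
  from flow_subspace_nonsingular[OF I this det t]
  have flow: "flow_subspace I (ms' \<mu>) (Es' \<mu>) (Fs' \<mu>) t = carrier_vec d" by (simp add: md)
  have ch: "full_col m d (chain_prod m Cs' \<mu> t)"
    "flow_subspace I m E F t = (\<lambda>v. chain_prod m Cs' \<mu> t *\<^sub>v v) ` carrier_vec d"
    using flow_subspace_chain[OF I t reduction_runD(1-3)[OF run'] s] flow md by auto
  show "full_col m d (chain_prod m Cs' \<mu> t)" by (rule ch(1))
  show "mat_image (chain_prod m Cs' \<mu> t) = flow_subspace I m E F t"
    using ch(2) mat_image_eq[OF full_colD(1)[OF ch(1)]] by simp
qed

section \<open>Localisation and the existence of local runs\<close>

lemma dae_solution_on_subset:
  assumes "dae_solution_on I m E F x" "J \<subseteq> I"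
  shows "dae_solution_on J m E F x"
proof -
  obtain x' where x': "vec_C1 I m x x'" "\<forall>t\<in>I. E t *\<^sub>v x' t + F t *\<^sub>v x t = 0\<^sub>v m"
    using assms(1) unfolding dae_solution_on_iff by blast
  have "vec_C1 J m x x'"
    using x'(1) assms(2) DERIV_subset[OF _ assms(2)] continuous_on_subset[OF _ assms(2)]
    unfolding vec_C1_def by blast
  then show ?thesis using x'(2) assms(2) unfolding dae_solution_on_iff by blast
qed

lemma flow_subspace_localize:
  assumes "\<delta> > 0"
  shows "flow_subspace ({t - \<delta><..<t + \<delta>} \<inter> I) m E F t = flow_subspace I m E F t"
proof (intro equalityI subsetI)
  fix z assume "z \<in> flow_subspace ({t - \<delta><..<t + \<delta>} \<inter> I) m E F t"
  then obtain x e where x: "z = x t" "e > 0"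
    "dae_solution_on ({t - e<..<t + e} \<inter> ({t - \<delta><..<t + \<delta>} \<inter> I)) m E F x"
    unfolding flow_subspace_def by blast
  have "{t - e<..<t + e} \<inter> ({t - \<delta><..<t + \<delta>} \<inter> I) = {t - min e \<delta><..<t + min e \<delta>} \<inter> I" by auto
  with x show "z \<in> flow_subspace I m E F t"
    using flow_subspaceI[of t "min e \<delta>" I m E F x] assms by simp
next
  fix z assume "z \<in> flow_subspace I m E F t"
  then obtain x e where x: "z = x t" "e > 0" "dae_solution_on ({t - e<..<t + e} \<inter> I) m E F x"
    unfolding flow_subspace_def by blast
  have eq: "{t - min e \<delta><..<t + min e \<delta>} \<inter> ({t - \<delta><..<t + \<delta>} \<inter> I) \<subseteq> {t - e<..<t + e} \<inter> I" by auto
  have "dae_solution_on ({t - min e \<delta><..<t + min e \<delta>} \<inter> ({t - \<delta><..<t + \<delta>} \<inter> I)) m E F x"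
    by (rule dae_solution_on_subset[OF x(3) eq])
  from flow_subspaceI[OF this] x(1,2) assms
  show "z \<in> flow_subspace ({t - \<delta><..<t + \<delta>} \<inter> I) m E F t" by simp
qed

text \<open>Level \<open>\<mu> - 1\<close> is pre-regular but comes without bases. Near the given
  point they are constructed and appended to the restricted run.\<close>

lemma local_run_extension:
  assumes I: "real_interval I" and E: "mat_Ck m I m m E" and F: "mat_Ck m I m m F"
    and reg: "regular_index I m E F \<mu> r \<theta>" and t: "t \<in> I"
  obtains \<delta> Es Fs Ys Zs Cs Cds ms where "\<delta> > 0"
    "reduction_run ({t - \<delta><..<t + \<delta>} \<inter> I) m E F \<mu> Es Fs Ys Zs Cs Cds ms"
proof -
  from reg obtain Es Fs Ys Zs Cs Cds ms rs where \<mu>: "1 \<le> \<mu>" and rm: "r < m"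
    and run: "reduction_run I m E F (\<mu> - 1) Es Fs Ys Zs Cs Cds ms"
    and pre: "\<And>i. i < \<mu> \<Longrightarrow> pre_regular I (ms i) (Es i) (Fs i) (rs i) (\<theta> i)"
    and r0: "rs 0 = r" and mono: "\<forall>i. Suc i \<le> \<mu> - 2 \<longrightarrow> \<theta> (Suc i) \<le> \<theta> i"
    and pos: "2 \<le> \<mu> \<longrightarrow> \<theta> (\<mu> - 2) > 0"
    unfolding regular_index_def by blast
  define k where "k = \<mu> - 1"
  have k: "k < \<mu>" "\<mu> = Suc k" using \<mu> by (auto simp: k_def)
  have km: "k < m"
    by (rule regular_run_ranks(2)[OF I E F run pre r0 rm characteristic_values_pos[OF mono pos] k(1)])
  have sm: "mat_Ck (m - k) I (ms k) (ms k) (Es k)" "mat_Ck (m - k) I (ms k) (ms k) (Fs k)"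
    using reduction_run_smooth[OF I E F run, of k] km by (auto simp: k_def)
  obtain \<delta> Y Z C where \<delta>: "\<delta> > 0"
    and Y: "mat_Ck (m - k) ({t - \<delta><..<t + \<delta>} \<inter> I) (ms k) (rs k) Y"
    and Z: "mat_Ck (m - k) ({t - \<delta><..<t + \<delta>} \<inter> I) (ms k) (ms k - rs k) Z"
    and C: "mat_Ck (m - k) ({t - \<delta><..<t + \<delta>} \<inter> I) (ms k) (rs k) C"
    and bY: "\<And>s. s \<in> {t - \<delta><..<t + \<delta>} \<inter> I \<Longrightarrow> cols_basis (ms k) (Y s) (mat_image (Es k s))"
    and bZ: "\<And>s. s \<in> {t - \<delta><..<t + \<delta>} \<inter> I \<Longrightarrow> cols_basis (ms k) (Z s) (orth_compl (ms k) (mat_image (Es k s)))"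
    and bC: "\<And>s. s \<in> {t - \<delta><..<t + \<delta>} \<inter> I \<Longrightarrow> cols_basis (ms k) (C s) (mat_kernel (transpose_mat (Z s) * Fs k s))"
    using local_reduction_bases[OF sm t pre[OF k(1)]] by blast
  define J where "J = {t - \<delta><..<t + \<delta>} \<inter> I"
  note loc = Y[folded J_def] Z[folded J_def] C[folded J_def] and bas = bY[folded J_def] bZ[folded J_def] bC[folded J_def]
  \<comment> \<open>The new C is still differentiable because k < m, so the next F can be
    formed.\<close>
  have "m - k = Suc (m - k - 1)" using km by simp
  with loc(3) have "mat_Ck (Suc (m - k - 1)) J (ms k) (rs k) C" by metis
  then obtain Cd where Cd: "has_mat_deriv_on J (ms k) (rs k) C Cd" by (rule mat_Ck_Suc_deriv)
  have runJ: "reduction_run J m E F k Es Fs Ys Zs Cs Cds ms"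
    using reduction_run_subset[OF run] by (simp add: J_def k_def)
  \<comment> \<open>The bases are inserted at index k, the reduced pair and its size at k + 1; all
    earlier entries of the run are untouched.\<close>
  have "reduction_run J m E F (Suc k)
      (Es(Suc k := (\<lambda>s. transpose_mat (Y s) * Es k s * C s)))
      (Fs(Suc k := (\<lambda>s. transpose_mat (Y s) * (Fs k s * C s + Es k s * Cd s))))
      (Ys(k := Y)) (Zs(k := Z)) (Cs(k := C)) (Cds(k := Cd)) (ms(Suc k := rs k))"
    using runJ loc bas Cd unfolding reduction_run_def by (simp add: less_Suc_eq all_conj_distrib)
  then show thesis using that[OF \<delta>] unfolding k(2) J_def by blast
qed

text \<open>The product runs over the \<mu> factors with indices 0 to \<open>\<mu> - 1\<close>. The
  factor with index i has as many columns as the rank at level i, so the one with index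
  \<open>\<mu> - 1\<close> brings the number of columns down to d.\<close>

theorem theoremt:
  fixes I :: "real set" and m \<mu> r :: nat and \<theta> :: "nat \<Rightarrow> nat"
    and E F :: "real \<Rightarrow> real mat"
  assumes I: "real_interval I"
    and E: "mat_Ck m I m m E" and F: "mat_Ck m I m m F"
    and reg: "regular_index I m E F \<mu> r \<theta>"
  shows
    "(\<forall>t\<in>I. subspace_dim m (flow_subspace I m E F t) = r - (\<Sum>i<\<mu> - 1. \<theta> i))
     \<and> (\<forall>Es Fs Ys Zs Cs Cds ms. reduction_run I m E F \<mu> Es Fs Ys Zs Cs Cds ms \<longrightarrow>
          (\<forall>t\<in>I. vec_space.rank (ms (\<mu> - 1)) (Es (\<mu> - 1) t) = r - (\<Sum>i<\<mu> - 1. \<theta> i) \<and>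
                 chain_prod m Cs \<mu> t \<in> carrier_mat m (r - (\<Sum>i<\<mu> - 1. \<theta> i)) \<and>
                 cols_basis m (chain_prod m Cs \<mu> t) (flow_subspace I m E F t)))
     \<and> (\<forall>Isub. real_interval Isub \<and> Isub \<subseteq> I \<longrightarrow> regular_index Isub m E F \<mu> r \<theta>)"
proof (intro conjI ballI allI impI)
  fix t assume t: "t \<in> I"
  \<comment> \<open>The dimension formula presupposes no run of length \<mu> on all of
    \<open>I\<close>, hence the passage to a neighbourhood of t, which has the same flow-subspace at
    t.\<close>
  obtain \<delta> Es Fs Ys Zs Cs Cds ms where \<delta>: "\<delta> > 0"
    and run: "reduction_run ({t - \<delta><..<t + \<delta>} \<inter> I) m E F \<mu> Es Fs Ys Zs Cs Cds ms"
    using local_run_extension[OF I E F reg t] .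
  define J where "J = {t - \<delta><..<t + \<delta>} \<inter> I"
  have J: "real_interval J" "J \<subseteq> I" "t \<in> J"
    unfolding J_def using real_interval_localize[OF I t \<delta>] t \<delta> by auto
  note fl = regular_run_flow(2,3)[OF J(1) mat_Ck_subset[OF E J(2)] mat_Ck_subset[OF F J(2)]
      regular_index_subset[OF reg J(2)] run[folded J_def] J(3)]
  show "subspace_dim m (flow_subspace I m E F t) = r - (\<Sum>i<\<mu> - 1. \<theta> i)"
    using subspace_dim_full_col[OF fl(1)] fl(2) flow_subspace_localize[OF \<delta>, of t I m E F] by (simp add: J_def)
next
  fix Es Fs Ys Zs Cs Cds ms t
  assume run: "reduction_run I m E F \<mu> Es Fs Ys Zs Cs Cds ms" and t: "t \<in> I"
  note fl = regular_run_flow[OF I E F reg run t]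
  show "vec_space.rank (ms (\<mu> - 1)) (Es (\<mu> - 1) t) = r - (\<Sum>i<\<mu> - 1. \<theta> i)" by (rule fl(1))
  show "chain_prod m Cs \<mu> t \<in> carrier_mat m (r - (\<Sum>i<\<mu> - 1. \<theta> i))" by (rule full_colD(1)[OF fl(2)])
  show "cols_basis m (chain_prod m Cs \<mu> t) (flow_subspace I m E F t)"
    by (rule full_col_imp_cols_basis[OF fl(2,3)])
next
  fix Isub assume "real_interval Isub \<and> Isub \<subseteq> I"
  then show "regular_index Isub m E F \<mu> r \<theta>" using regular_index_subset[OF reg] by blast
qed

end
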